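(* Let $\tau(P,P',\beta,q)$ be the generating function of weighted numbers of (possibly disconnected) coverings of $\mathbb{P}^1$ with arbitrary ramification over $0,\infty$ and simple ramification elsewhere, as defined in the context. Let $S=(s_1,s_2,\dots)$ and $S'=(s'_1,s'_2,\dots)$ be two arbitrary sequences (of independent formal variables), let $z$ be a formal variable, and put $\vec z=(z,z^2,z^3,\dots)$. Then for every $m\in\mathbb{Z}$ the following Hirota-type bilinear equation holds: $$ q^{m+1}\, e^{m(m+1)\beta/2}\,[z^{-1-m}]\; \exp\Big(-2\sum_{n\ge1} \frac{s'_n}{n\,z^n}\Big)\, A_m\, B \;=\; [z^{m+1}]\; \exp\Big(2\sum_{n\ge1} \frac{s_n}{n\,z^n}\Big)\, C_m\, D , $$ where $[z^{k}]$ denotes the coefficient of $z^{k}$ and $$ A_m=\tau\big(P+S,\;P'+S'+\vec z,\;\beta,\;e^{(m+1)\beta}q\big),\qquad B=\tau\big(P-S,\;P'-S'-\vec z,\;\beta,\;e^{-\beta}q\big), $$ $$ C_m=\tau\big(P+S-\vec z,\;P'+S',\;\beta,\;e^{m\beta}q\big),\qquad D=\tau\big(P-S+\vec z,\;P'-S',\;\beta,\;q\big). $$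
   Context: Let $S(d)$ denote the symmetric group, and for a partition $\mu$ of $d$ let $C_\mu\subset S(d)$ be the conjugacy class of permutations of cycle type $\mu$. Let $C_{(2)}\subset S(d)$ be the conjugacy class of transpositions (empty if $d<2$). For conjugacy classes $C_1,\dots,C_s\subset S(d)$, $\mathrm{Cov}_d(C_1,\dots,C_s)$ denotes the weighted number of $d$-fold coverings of $\mathbb{P}^1$, not necessarily connected, ramified over $s$ fixed points of $\mathbb{P}^1$ with monodromies in $C_1,\dots,C_s$ respectively. Each covering is weighted by the reciprocal of the order of its automorphism group. Equivalently, $\mathrm{Cov}_d(C_1,\dots,C_s)=\frac1{d!}\#\{(g_1,\dots,g_s): g_i\in C_i,\ g_1\cdots g_s=1\}$. For $d=0$ the empty covering contributes $1$ (to the term with $b=0$ below). Let $P=(p_1,p_2,\dots)$ and $P'=(p'_1,p'_2,\dots)$ be two sequences of independent variables, and let $\beta,q$ be further formal variables. For a partition $\mu$, put $p_\mu=\prod_i p_{\mu_i}$ and $p'_\mu=\prod_i p'_{\mu_i}$. Define the formal power series $$ \tau(P,P',\beta,q)=\sum_{d\ge0}\ \sum_{b\ge 0}\ \sum_{|\mu|=|\nu|=d} q^d\,\frac{\beta^b}{b!}\,p_\mu\,p'_\nu\,\mathrm{Cov}_d\big(C_\mu,C_\nu,\underbrace{C_{(2)},\dots,C_{(2)}}_{b\text{ times}}\big). $$ Sums of sequences of variables such as $P+S-\vec z$ are taken componentwise. All identities are identities of formal series: each coefficient of a given power of $q$ and $\beta$ in $\tau$ is a polynomial in the remaining variables, $e^{k\beta}$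 is expanded as a power series in $\beta$, and coefficients of powers of $z$ are extracted for each power of $q$ and $\beta$. *)

theory Defs
  imports
    "HOL-Library.Multiset"
    "HOL-Library.Poly_Mapping"
    "HOL-Combinatorics.Orbits"
    "HOL-Computational_Algebra.Formal_Laurent_Series"
begin

section \<open>Weighted numbers of coverings\<close>

text \<open>The symmetric group on \<open>d\<close> letters is \<open>{g. g permutes {1..d}}\<close>; partitions are multisets of
  positive natural numbers.\<close>

definition partitions :: "nat \<Rightarrow> nat multiset set" where
  "partitions d = {\<mu>. 0 \<notin># \<mu> \<and> sum_mset \<mu> = d}"

lemma finite_partitions: "finite (partitions d)"
proof (rule finite_subset)
  show "partitions d \<subseteq> (\<Union>n\<in>{..d}. mset ` {xs. set xs \<subseteq> {..d} \<and> length xs = n})"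
  proof
    fix \<mu> assume "\<mu> \<in> partitions d"
    then have pos: "0 \<notin># \<mu>" and sum: "sum_mset \<mu> = d"
      by (auto simp: partitions_def)
    obtain xs where xs: "mset xs = \<mu>"
      using ex_mset by blast
    have "sum_list xs = d"
      using xs sum by (metis sum_mset_sum_list)
    moreover have "length xs \<le> sum_list xs" if "0 \<notin> set xs" for xs :: "nat list"
      using that by (induction xs) auto
    ultimately have "length xs \<le> d"
      using pos xs by auto
    moreover have "set xs \<subseteq> {..d}"
      using member_le_sum_list[of _ xs] \<open>sum_list xs = d\<close> by auto
    ultimately show "\<mu> \<in> (\<Union>n\<in>{..d}. mset ` {xs. set xs \<subseteq> {..d} \<and> length xs = n})"
      using xs by blast
  qed
  show "finite (\<Union>n\<in>{..d}. mset ` {xs. set xs \<subseteq> {..d::nat} \<and> length xs = n})"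
    by (auto intro: finite_lists_length_eq)
qed

definition cycle_type :: "nat set \<Rightarrow> (nat \<Rightarrow> nat) \<Rightarrow> nat multiset" where
  "cycle_type A g = image_mset card (mset_set (orbit g ` A))"

definition conj_class :: "nat \<Rightarrow> nat multiset \<Rightarrow> (nat \<Rightarrow> nat) set" where
  "conj_class d \<mu> = {g. g permutes {1..d} \<and> cycle_type {1..d} g = \<mu>}"

definition transpositions :: "nat \<Rightarrow> (nat \<Rightarrow> nat) set" where
  "transpositions d = {transpose i j | i j. i \<in> {1..d} \<and> j \<in> {1..d} \<and> i \<noteq> j}"

text \<open>The number of possibly disconnected coverings, each weighted by the reciprocal of the order of
  its automorphism group, expressed through monodromy tuples.\<close>

definition Cov :: "nat \<Rightarrow> (nat \<Rightarrow> nat) set list \<Rightarrow> rat" where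
  "Cov d Cs = of_nat (card {gs \<in> listset Cs. foldr (\<circ>) gs id = id}) / fact d"

section \<open>Rings of formal series\<close>

text \<open>
  All sequences below are indexed by \<open>n \<ge> 1\<close>; the entry at index \<open>0\<close> is never used.

  \<open>coeff_ring\<close> is the ring of polynomials with rational coefficients in the independent variables
  \<open>p\<^sub>n\<close>, \<open>p'\<^sub>n\<close>, \<open>s\<^sub>n\<close>, \<open>s'\<^sub>n\<close>.  An element of \<open>zseries\<close> is a Laurent series in \<open>z\<^sup>-\<^sup>1\<close>: the formal
  variable \<open>fls_X\<close> of the library stands for \<open>z\<^sup>-\<^sup>1\<close>, so that \<open>z\<close> may occur with
  arbitrarily negative, but only boundedly positive, powers.  Series in \<open>\<beta>\<close> and \<open>q\<close> are
  iterated power series, \<open>q\<close> being the outer variable.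
\<close>

datatype var = VP nat | VP' nat | VS nat | VS' nat

type_synonym coeff_ring = "(var \<Rightarrow>\<^sub>0 nat) \<Rightarrow>\<^sub>0 rat"
type_synonym zseries = "coeff_ring fls"

definition Var :: "var \<Rightarrow> coeff_ring" where
  "Var v = Poly_Mapping.single (Poly_Mapping.single v 1) 1"

definition Const :: "rat \<Rightarrow> coeff_ring" where
  "Const c = Poly_Mapping.single 0 c"

definition zConst :: "rat \<Rightarrow> zseries" where
  "zConst c = fls_const (Const c)"

definition p_seq :: "nat \<Rightarrow> zseries" where "p_seq n = fls_const (Var (VP n))"
definition p'_seq :: "nat \<Rightarrow> zseries" where "p'_seq n = fls_const (Var (VP' n))"
definition s_seq :: "nat \<Rightarrow> zseries" where "s_seq n = fls_const (Var (VS n))"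
definition s'_seq :: "nat \<Rightarrow> zseries" where "s'_seq n = fls_const (Var (VS' n))"
definition z_seq :: "nat \<Rightarrow> zseries" where "z_seq n = fls_X_inv ^ n"

definition z_coeff :: "int \<Rightarrow> zseries fps fps \<Rightarrow> coeff_ring fps fps" where
  "z_coeff k F = Abs_fps (\<lambda>d. Abs_fps (\<lambda>b. fls_nth (fps_nth (fps_nth F d) b) (- k)))"

text \<open>\<open>exp (c X)\<close> with coefficients in a ring that contains the rationals via \<open>emb\<close>.\<close>

definition exp_series :: "(rat \<Rightarrow> 'a) \<Rightarrow> rat \<Rightarrow> 'a::comm_ring_1 fps" where
  "exp_series emb c = Abs_fps (\<lambda>n. emb (fps_nth (fps_exp c) n))"

text \<open>\<open>vertex_exp c v\<close> is \<open>exp (c \<Sum>\<^sub>n\<^sub>\<ge>\<^sub>1 x\<^sub>n / (n z\<^sup>n))\<close>, where \<open>x\<^sub>n\<close> is the variable \<open>v n\<close>.\<close>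

definition vertex_exp :: "rat \<Rightarrow> (nat \<Rightarrow> var) \<Rightarrow> zseries" where
  "vertex_exp c v =
     fps_to_fls (fps_compose (exp_series Const 1)
       (Abs_fps (\<lambda>n. if n = 0 then 0 else Const (c / of_nat n) * Var (v n))))"

section \<open>The generating function\<close>

definition tau :: "(nat \<Rightarrow> zseries) \<Rightarrow> (nat \<Rightarrow> zseries) \<Rightarrow> zseries fps fps" where
  "tau P P' = Abs_fps (\<lambda>d. Abs_fps (\<lambda>b.
     \<Sum>\<mu>\<in>partitions d. \<Sum>\<nu>\<in>partitions d.
       zConst (Cov d (conj_class d \<mu> # conj_class d \<nu> # replicate b (transpositions d)) / fact b)
         * (\<Prod>i\<in>#\<mu>. P i) * (\<Prod>i\<in>#\<nu>. P' i)))"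

text \<open>\<open>tau_at P P' k\<close> is \<open>\<tau>(P, P', \<beta>, e\<^sup>k\<^sup>\<beta> q)\<close>.\<close>

definition tau_at :: "(nat \<Rightarrow> zseries) \<Rightarrow> (nat \<Rightarrow> zseries) \<Rightarrow> int \<Rightarrow> zseries fps fps" where
  "tau_at P P' k =
     fps_compose (tau P P') (fps_const (exp_series zConst (of_int k)) * fps_X)"

end

theory Submission
  imports Defs
begin

text \<open>
  Write \<open>\<delta>\<^sub>n = n \<partial>/\<partial>p\<^sub>n\<close>.  Multiplying a permutation by a transposition cuts or joins
  cycles, so that \<open>\<tau>\<close> solves the heat equation \<open>\<partial>\<tau>/\<partial>\<beta> = H \<tau>\<close> for the cut-and-join operator
  \<open>H = 1/2 \<Sum>\<^sub>i\<^sub>,\<^sub>j (p\<^sub>i p\<^sub>j \<delta>\<^sub>i\<^sub>+\<^sub>j + p\<^sub>i\<^sub>+\<^sub>j \<delta>\<^sub>i \<delta>\<^sub>j)\<close>, and replacing \<open>q\<close> by \<open>e\<^sup>k\<^sup>\<beta> q\<close> adds \<open>k\<close> times the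
  Euler operator \<open>E\<close> to \<open>H\<close>.  In the variables \<open>p\<^sub>n \<plusminus> s\<^sub>n\<close> of the two factors, the left-hand side,
  whose shifts only involve \<open>P'\<close> and \<open>S'\<close>, therefore evolves in \<open>\<beta>\<close> by the operator
  \<open>H\<^sub>1 + (m + 1) E\<^sub>1 + H\<^sub>2 - E\<^sub>2 + m (m + 1) / 2\<close>.  Commuting \<open>H\<close> and \<open>E\<close> with the vertex
  operators on the right-hand side shows that it evolves by the same operator, up to a term
  \<open>(z d/dz - (m + 1)) G\<close>, which has no coefficient at \<open>z\<^sup>m\<^sup>+\<^sup>1\<close>.  At \<open>\<beta> = 0\<close> one has
  \<open>\<tau> = exp(\<Sum>\<^sub>n q\<^sup>n p\<^sub>n p'\<^sub>n / n)\<close>, and both sides are the same explicit sum.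
\<close>

section \<open>Orbits of a permutation multiplied by a transposition\<close>

text \<open>Two obstacles shape the proof. First, the operators are infinite sums while each
  identity concerns one coefficient of q, so operators and exponentials are truncated at a bound
  \<open>N\<close>. Truncating the exponential causes an error in powers of z below
  \<open>z^(-N)\<close>; since the coefficient of \<open>q^d\<close> in the product of the two tau
  functions reaches at most \<open>z^d\<close>, the error is invisible at \<open>z^(m+1)\<close>
  once \<open>N >= d - (m + 1)\<close>. Second, the vertex factor on the right depends on S alone,
  whereas the operator must be moved past it in each tau function separately. It is therefore
  written as exp(sum (p_n + s_n)/(n z^n)) times exp(-sum (p_n - s_n)/(n z^n)), where p_n cancels.
  Each half is attached to the tau function in the same variables; passing it turns the Euler
  coefficient m into m + 1 in one factor and 0 into -1 in the other. The heat equation is read as a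
  recursion on the coefficients of beta, so that the values at beta = 0 decide. As m + 1 may be
  negative, coefficients are compared at every integer power of q.\<close>

lemma orbit_eq_image_path:
  assumes "0 < k" and "\<And>m. Suc m < k \<Longrightarrow> h (x m) = x (Suc m)" and "h (x (k - 1)) = x 0"
  shows "orbit h (x 0) = x ` {..<k}"
proof -
  have path: "m < k \<Longrightarrow> (h ^^ m) (x 0) = x m" for m
    by (induction m) (auto simp: assms(2))
  have "(h ^^ k) (x 0) = h ((h ^^ (k - 1)) (x 0))"
    using assms(1) by (cases k) auto
  also have "\<dots> = x 0"
    using path[of "k - 1"] assms(1,3) by auto
  finally have "orbit h (x 0) = {(h ^^ m) (x 0) | m. m < k}"
    using assms(1) by (rule orbit_altdef_bounded)
  also have "\<dots> = (\<lambda>m. (h ^^ m) (x 0)) ` {..<k}"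
    by auto
  also have "\<dots> = x ` {..<k}"
    by (intro image_cong) (auto simp: path)
  finally show ?thesis .
qed

text \<open>The cycle length is the least positive return time of \<open>i\<close>: a coincidence
  \<open>(g ^^ l) i = (g ^^ m) i\<close> with \<open>l < m\<close> would, by injectivity of
  \<open>g ^^ l\<close>, give the earlier return \<open>m - l\<close>.\<close>

lemma orbit_parametrization:
  assumes "permutation g"
  shows "orbit g i = (\<lambda>m. (g ^^ m) i) ` {..<card (orbit g i)}"
    and "inj_on (\<lambda>m. (g ^^ m) i) {..<card (orbit g i)}"
    and "(g ^^ card (orbit g i)) i = i"
    and "0 < card (orbit g i)"
proof -
  define n where "n = (LEAST n. 0 < n \<and> (g ^^ n) i = i)"
  have "\<exists>n. 0 < n \<and> (g ^^ n) i = i"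
  proof -
    have "i \<in> {(g ^^ n) i | n. 0 < n}"
      using permutation_self_in_orbit[OF assms, of i] unfolding orbit_altdef .
    then obtain n where n: "i = (g ^^ n) i" "0 < n"
      unfolding mem_Collect_eq by (elim exE conjE)
    show ?thesis
      by (intro exI[of _ n] conjI n(2) n(1)[symmetric])
  qed
  then have n: "0 < n \<and> (g ^^ n) i = i"
    unfolding n_def by (rule LeastI_ex)
  have least: "(g ^^ m) i \<noteq> i" if "0 < m" "m < n" for m
    using not_less_Least[of m "\<lambda>n. 0 < n \<and> (g ^^ n) i = i", folded n_def] that by blast
  have orb: "orbit g i = (\<lambda>m. (g ^^ m) i) ` {..<n}"
    using orbit_altdef_bounded[OF conjunct2[OF n] conjunct1[OF n]] by (simp only: lessThan_def image_Collect)
  have bij: "inj (g ^^ m)" for m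
    by (rule inj_fn[OF bij_is_inj[OF permutation_bijective[OF assms]]])
  have ne: "(g ^^ l) i \<noteq> (g ^^ m) i" if "l < m" "m < n" for l m
  proof
    assume "(g ^^ l) i = (g ^^ m) i"
    also have "\<dots> = (g ^^ l) ((g ^^ (m - l)) i)"
      using that(1) by (metis comp_apply funpow_add le_add_diff_inverse less_imp_le_nat)
    finally have "(g ^^ (m - l)) i = i"
      by (rule injD[OF bij, of l, symmetric])
    then show False
      using least[of "m - l"] that by auto
  qed
  have inj: "inj_on (\<lambda>m. (g ^^ m) i) {..<n}"
    by (rule linorder_inj_onI) (auto simp: ne)
  have card: "card (orbit g i) = n"
    unfolding orb using inj by (simp add: card_image)
  show "orbit g i = (\<lambda>m. (g ^^ m) i) ` {..<card (orbit g i)}"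
    unfolding card by (fact orb)
  show "inj_on (\<lambda>m. (g ^^ m) i) {..<card (orbit g i)}"
    unfolding card by (fact inj)
  show "(g ^^ card (orbit g i)) i = i"
    unfolding card by (fact conjunct2[OF n])
  show "0 < card (orbit g i)"
    unfolding card by (fact conjunct1[OF n])
qed

lemma orbit_eqI_mem:
  assumes "permutation g" "y \<in> orbit g x"
  shows "orbit g y = orbit g x"
  by (rule orbit_cyclic_eq3[OF cyclic_on_orbit'[OF assms(1)] assms(2)])

text \<open>From \<open>i\<close> the product follows the cycle of \<open>g\<close> up to the step
  that would reach \<open>j\<close>, which is redirected to \<open>i\<close>; from \<open>j\<close>
  it runs to the end of the cycle, where the return to \<open>i\<close> is redirected to
  \<open>j\<close>. The length \<open>n\<close> is thus split into \<open>k\<close> and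
  \<open>n - k\<close>.\<close>

lemma orbit_transpose_cut:
  assumes g: "permutation g" and k: "0 < k" "k < card (orbit g i)"
  defines "j \<equiv> (g ^^ k) i"
  shows "orbit (transpose i j \<circ> g) i = (\<lambda>m. (g ^^ m) i) ` {..<k}"
    and "orbit (transpose i j \<circ> g) j = (\<lambda>m. (g ^^ m) i) ` {k..<card (orbit g i)}"
proof -
  let ?n = "card (orbit g i)" and ?x = "\<lambda>m. (g ^^ m) i"
  note par = orbit_parametrization[OF g, of i]
  have x_eq: "?x l = ?x m \<longleftrightarrow> l = m" if "l < ?n" "m < ?n" for l m
    using inj_on_eq_iff[OF par(2)] that by auto
  have "orbit (transpose i j \<circ> g) (?x 0) = ?x ` {..<k}"
  proof (rule orbit_eq_image_path)
    show "(transpose i j \<circ> g) (?x m) = ?x (Suc m)" if "Suc m < k" for m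
      using x_eq[of "Suc m" 0] x_eq[of "Suc m" k] that k by (auto simp: j_def transpose_def)
    show "(transpose i j \<circ> g) (?x (k - 1)) = ?x 0"
      using k by (cases k) (auto simp: j_def)
  qed (use k in auto)
  then show "orbit (transpose i j \<circ> g) i = ?x ` {..<k}"
    by simp
  have "orbit (transpose i j \<circ> g) (?x (0 + k)) = (\<lambda>m. ?x (m + k)) ` {..<?n - k}"
  proof (rule orbit_eq_image_path)
    show "(transpose i j \<circ> g) (?x (m + k)) = ?x (Suc m + k)" if "Suc m < ?n - k" for m
      using x_eq[of "Suc m + k" 0] x_eq[of "Suc m + k" k] that k by (auto simp: j_def transpose_def)
    have "g (?x (?n - k - 1 + k)) = ?x ?n"
      using k by (cases ?n) (auto simp flip: funpow.simps(2)[unfolded comp_def])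
    then show "(transpose i j \<circ> g) (?x (?n - k - 1 + k)) = ?x (0 + k)"
      using par(3) by (simp add: j_def)
  qed (use k in auto)
  also have "(\<lambda>m. ?x (m + k)) ` {..<?n - k} = ?x ` (\<lambda>m. m + k) ` {..<?n - k}"
    by (simp only: image_image)
  also have "(\<lambda>m. m + k) ` {..<?n - k} = {k..<?n}"
    using k by (simp add: lessThan_atLeast0)
  finally show "orbit (transpose i j \<circ> g) j = ?x ` {k..<?n}"
    by (simp add: j_def comp_def)
qed

lemma orbit_transpose_other:
  assumes g: "permutation g" and "i \<notin> orbit g x" "j \<notin> orbit g x"
  shows "orbit (transpose i j \<circ> g) x = orbit g x"
proof (rule orbit_cong[OF permutation_self_in_orbit[OF g]])
  fix s assume "s \<in> orbit g x"
  then have "g s \<in> orbit g x"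
    by (rule orbit.step)
  then show "(transpose i j \<circ> g) s = g s"
    using assms by (auto simp: transpose_def)
qed

lemma orbit_disjoint:
  assumes "permutation g" "X \<in> orbit g ` A" "Y \<in> orbit g ` A" "X \<noteq> Y"
  shows "X \<inter> Y = {}"
proof -
  obtain x y where xy: "X = orbit g x" "Y = orbit g y"
    using assms(2,3) by auto
  then have "X = Y" if "z \<in> X" "z \<in> Y" for z
    using orbit_eqI_mem[OF assms(1), of z] that by metis
  then show ?thesis
    using assms(4) by auto
qed

lemma orbits_transpose_cut:
  assumes g: "permutation g" and iA: "i \<in> A" "j \<in> A" and j: "j \<in> orbit g i" "j \<noteq> i"
  defines "g' \<equiv> transpose i j \<circ> g"
  shows "orbit g' ` A = insert (orbit g' i) (insert (orbit g' j) (orbit g ` A - {orbit g i}))"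
    and "orbit g' i \<union> orbit g' j = orbit g i" and "orbit g' i \<inter> orbit g' j = {}"
proof -
  obtain k where k: "k < card (orbit g i)" "j = (g ^^ k) i"
    using j(1) orbit_parametrization(1)[OF g, of i] by auto
  have "0 < k"
    using k j(2) by (cases k) auto
  note cut = orbit_transpose_cut[OF g this k(1), folded k(2), folded g'_def]
  note par = orbit_parametrization[OF g, of i]
  show un: "orbit g' i \<union> orbit g' j = orbit g i"
    by (subst par(1)) (use k(1) in \<open>auto simp: cut simp flip: image_Un\<close>)
  show "orbit g' i \<inter> orbit g' j = {}"
    unfolding cut using k(1) \<open>0 < k\<close>
    by (subst inj_on_image_Int[OF par(2), symmetric]) auto
  have g': "permutation g'"
    unfolding g'_def by (intro permutation_compose permutation_swap_id g)
  \<comment> \<open>A cycle disjoint from that of \<open>i\<close> contains neither \<open>i\<close>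
    nor \<open>j\<close>, so the transposition leaves it alone.\<close>
  have other: "orbit g' x = orbit g x" if "x \<notin> orbit g i" for x
  proof -
    have "y \<notin> orbit g x" if "y \<in> orbit g i" for y
    proof
      assume "y \<in> orbit g x"
      then have "orbit g x = orbit g i"
        using orbit_eqI_mem[OF g that] orbit_eqI_mem[OF g, of y x] by simp
      then show False
        using \<open>x \<notin> orbit g i\<close> permutation_self_in_orbit[OF g, of x] by simp
    qed
    then show ?thesis
      unfolding g'_def using j(1) permutation_self_in_orbit[OF g, of i]
      by (intro orbit_transpose_other[OF g]) auto
  qed
  show "orbit g' ` A = insert (orbit g' i) (insert (orbit g' j) (orbit g ` A - {orbit g i}))"
    (is "_ = ?R")
  proof (intro equalityI subsetI)
    fix X assume "X \<in> orbit g' ` A"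
    then obtain x where x: "x \<in> A" "X = orbit g' x"
      by auto
    show "X \<in> ?R"
    proof (cases "x \<in> orbit g i")
      case True
      then have "x \<in> orbit g' i \<or> x \<in> orbit g' j"
        using un by auto
      then have "X = orbit g' i \<or> X = orbit g' j"
        using x(2) orbit_eqI_mem[OF g', of x] by auto
      then show ?thesis
        by auto
    next
      case False
      then have "orbit g x \<noteq> orbit g i"
        using permutation_self_in_orbit[OF g, of x] by auto
      then show ?thesis
        using other[OF False] x by auto
    qed
  next
    fix X assume "X \<in> ?R"
    then consider "X = orbit g' i" | "X = orbit g' j" | x where "x \<in> A" "X = orbit g x" "X \<noteq> orbit g i"
      by auto
    then show "X \<in> orbit g' ` A"
    proof cases
      case (3 x)
      then have "x \<notin> orbit g i"
        using orbit_eqI_mem[OF g, of x i] by auto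
      from other[OF this] show ?thesis
        using 3(1,2) by auto
    qed (use iA in auto)
  qed
qed

text \<open>Joining reverses cutting: the transposition is an involution, so once \<open>j\<close>
  is known to lie on the cycle of \<open>i\<close> under \<open>g'\<close>, the cut lemma applied to
  \<open>g'\<close> describes the cycles of \<open>g\<close>. The second claim makes the union a
  separate factor in products over cycles.\<close>

lemma orbits_transpose_join:
  assumes g: "permutation g" and iA: "i \<in> A" "j \<in> A" and j: "j \<notin> orbit g i"
  defines "g' \<equiv> transpose i j \<circ> g"
  shows "orbit g' ` A = insert (orbit g i \<union> orbit g j) (orbit g ` A - {orbit g i, orbit g j})"
    and "orbit g i \<union> orbit g j \<notin> orbit g ` A - {orbit g i, orbit g j}"
proof -
  let ?n = "card (orbit g i)" and ?x = "\<lambda>m. (g ^^ m) i"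
  note par = orbit_parametrization[OF g, of i]
  have g': "permutation g'"
    unfolding g'_def by (intro permutation_compose permutation_swap_id g)
  have ne: "i \<noteq> j"
    using j permutation_self_in_orbit[OF g] by auto
  \<comment> \<open>\<open>g'\<close> repeats the path of \<open>g\<close> from \<open>i\<close>
    until \<open>g\<close> would return to \<open>i\<close>; that step leads to \<open>j\<close>
    instead.\<close>
  have step: "m < ?n \<Longrightarrow> (g' ^^ m) i = ?x m" for m
  proof (induction m)
    case (Suc m)
    have "?x (Suc m) \<in> orbit g i"
      by (rule funpow_in_orbit[OF permutation_self_in_orbit[OF g]])
    moreover have "?x (Suc m) \<noteq> ?x 0"
      using inj_on_eq_iff[OF par(2), of "Suc m" 0] Suc.prems by auto
    ultimately show ?case
      using Suc j by (auto simp: g'_def transpose_def)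
  qed simp
  have "(g' ^^ ?n) i = g' ((g' ^^ (?n - 1)) i)"
    using par(4) by (cases ?n) auto
  also have "\<dots> = transpose i j (g (?x (?n - 1)))"
    using step[of "?n - 1"] par(4) by (simp add: g'_def)
  also have "g (?x (?n - 1)) = ?x ?n"
    using par(4) by (cases ?n) auto
  finally have "(g' ^^ ?n) i = j"
    using par(3) by simp
  then have j': "j \<in> orbit g' i"
    using funpow_in_orbit[OF permutation_self_in_orbit[OF g'], of ?n i] by simp
  have undo: "transpose i j \<circ> g' = g"
    by (simp add: g'_def fun_eq_iff)
  note cut = orbits_transpose_cut[OF g' iA j' ne[symmetric], unfolded undo]
  have in_orb: "i \<in> orbit g i" "j \<in> orbit g j"
    using permutation_self_in_orbit[OF g] by auto
  show "orbit g i \<union> orbit g j \<notin> orbit g ` A - {orbit g i, orbit g j}"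
  proof
    assume "orbit g i \<union> orbit g j \<in> orbit g ` A - {orbit g i, orbit g j}"
    then obtain x where x: "orbit g i \<union> orbit g j = orbit g x" "orbit g x \<noteq> orbit g i"
      by auto
    then have "i \<in> orbit g x"
      using in_orb by auto
    then show False
      using orbit_eqI_mem[OF g] x(2) by metis
  qed
  have *: "orbit g k \<notin> orbit g' ` A - {orbit g' i}" if "k \<in> orbit g k" "orbit g k \<subseteq> orbit g' i" for k
  proof
    assume "orbit g k \<in> orbit g' ` A - {orbit g' i}"
    then have "orbit g k \<in> orbit g' ` A" "orbit g k \<noteq> orbit g' i"
      by auto
    then have "orbit g k \<inter> orbit g' i = {}"
      using orbit_disjoint[OF g', of "orbit g k" A "orbit g' i"] iA(1) by auto
    then show False
      using that by auto
  qed
  have "orbit g i \<notin> orbit g' ` A - {orbit g' i}" "orbit g j \<notin> orbit g' ` A - {orbit g' i}"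
    using *[OF in_orb(1)] *[OF in_orb(2)] cut(2) by auto
  then have "orbit g ` A - {orbit g i, orbit g j} = orbit g' ` A - {orbit g' i}"
    unfolding cut(1) by (simp add: insert_Diff_if)
  then show "orbit g' ` A = insert (orbit g i \<union> orbit g j) (orbit g ` A - {orbit g i, orbit g j})"
    using cut(2) iA(1) by (simp add: insert_absorb)
qed

section \<open>Derivations and the cut-and-join operator\<close>

definition derivation :: "('a::comm_ring_1 \<Rightarrow> 'a) \<Rightarrow> bool" where
  "derivation D \<longleftrightarrow> (\<forall>x y. D (x + y) = D x + D y) \<and> (\<forall>x y. D (x * y) = D x * y + x * D y)"

lemma derivation_add: "derivation D \<Longrightarrow> D (x + y) = D x + D y"
  and derivation_mult: "derivation D \<Longrightarrow> D (x * y) = D x * y + x * D y"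
  by (auto simp: derivation_def)

lemma derivation_0: "derivation D \<Longrightarrow> D 0 = 0"
  using derivation_add[of D 0 0] by simp

lemma derivation_1: "derivation D \<Longrightarrow> D 1 = 0"
  using derivation_mult[of D 1 1] by simp

lemma derivation_minus: "derivation D \<Longrightarrow> D (- x) = - D x"
  using derivation_add[of D x "- x"] by (simp add: derivation_0 eq_neg_iff_add_eq_0 add.commute)

lemma derivation_diff: "derivation D \<Longrightarrow> D (x - y) = D x - D y"
  using derivation_add[of D x "- y"] by (simp add: derivation_minus)

lemma derivation_sum: "derivation D \<Longrightarrow> D (sum f A) = (\<Sum>x\<in>A. D (f x))"
  by (induction A rule: infinite_finite_induct) (auto simp: derivation_0 derivation_add)

lemma derivation_of_nat: "derivation D \<Longrightarrow> D (of_nat n) = 0"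
  by (induction n) (auto simp: derivation_0 derivation_1 derivation_add)

lemma derivation_of_int: "derivation D \<Longrightarrow> D (of_int n) = 0"
  by (cases n) (auto simp: derivation_of_nat derivation_minus derivation_diff derivation_1)

lemmas derivation_simps = derivation_add derivation_mult derivation_0 derivation_1
  derivation_minus derivation_diff derivation_sum derivation_of_nat derivation_of_int

lemma derivation_prod:
  assumes "derivation D" "finite A"
  shows "D (prod f A) = (\<Sum>x\<in>A. D (f x) * prod f (A - {x}))"
  using assms(2)
proof induction
  case empty
  then show ?case
    using assms(1) by (simp add: derivation_1)
next
  case (insert a A)
  have "(\<Sum>x\<in>A. D (f x) * prod f (insert a A - {x})) = (\<Sum>x\<in>A. f a * (D (f x) * prod f (A - {x})))"
  proof (rule sum.cong)
    fix x assume x: "x \<in> A"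
    then have "insert a A - {x} = insert a (A - {x})"
      using insert.hyps by auto
    then show "D (f x) * prod f (insert a A - {x}) = f a * (D (f x) * prod f (A - {x}))"
      using insert.hyps by (simp add: mult_ac)
  qed simp
  then show ?case
    using insert by (simp add: derivation_mult[OF assms(1)] flip: sum_distrib_left)
qed

definition index_pairs :: "nat \<Rightarrow> (nat \<times> nat) set" where
  "index_pairs N = {(i, j). 0 < i \<and> 0 < j \<and> i + j \<le> N}"

lemma finite_index_pairs [simp]: "finite (index_pairs N)"
  by (rule finite_subset[of _ "{..N} \<times> {..N}"]) (auto simp: index_pairs_def)

text \<open>With \<open>\<delta> n\<close> in the role of \<open>n \<partial>/\<partial>p\<^sub>n\<close>, this is twice the usual cut-and-join operator,
  truncated to the variables \<open>p\<^sub>n\<close> with \<open>n \<le> N\<close>; this normalization is free of denominators.\<close>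

definition cutjoin :: "nat \<Rightarrow> (nat \<Rightarrow> 'a) \<Rightarrow> (nat \<Rightarrow> 'a \<Rightarrow> 'a) \<Rightarrow> 'a \<Rightarrow> 'a::comm_ring_1" where
  "cutjoin N a \<delta> f =
     (\<Sum>(i, j)\<in>index_pairs N. a i * a j * \<delta> (i + j) f + a (i + j) * \<delta> i (\<delta> j f))"

definition euler :: "nat \<Rightarrow> (nat \<Rightarrow> 'a) \<Rightarrow> (nat \<Rightarrow> 'a \<Rightarrow> 'a) \<Rightarrow> 'a \<Rightarrow> 'a::comm_ring_1" where
  "euler N a \<delta> f = (\<Sum>n\<in>{1..N}. a n * \<delta> n f)"

text \<open>For the orbits of a permutation of cycle type \<open>\<mu>\<close> this is the monomial
  \<open>p\<^sub>\<mu>\<close>. Indexing by sets of orbits keeps cycles of equal length apart, so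
  that removing a cycle is a set difference.\<close>

definition family_weight :: "(nat \<Rightarrow> 'a::comm_ring_1) \<Rightarrow> 'b set set \<Rightarrow> 'a" where
  "family_weight Q F = (\<Prod>X\<in>F. Q (card X))"

text \<open>An abstract form of \<open>n \<partial>/\<partial>p\<^sub>n\<close>, so that the same
  results apply to the variables themselves and to their translates by powers of z.\<close>

definition dual_derivations :: "(nat \<Rightarrow> 'a \<Rightarrow> 'a) \<Rightarrow> (nat \<Rightarrow> 'a::comm_ring_1) \<Rightarrow> bool" where
  "dual_derivations \<delta> Q \<longleftrightarrow>
     (\<forall>n. derivation (\<delta> n)) \<and> (\<forall>n>0. \<forall>k. \<delta> n (Q k) = (if k = n then of_nat n else 0))"

lemma family_weight_derivation:
  assumes "derivation D" "finite F"
  shows "D (family_weight Q F) = (\<Sum>X\<in>F. D (Q (card X)) * family_weight Q (F - {X}))"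
  using derivation_prod[OF assms, of "\<lambda>X. Q (card X)"] by (simp add: family_weight_def)

lemma family_weight_dual_derivation2:
  assumes "dual_derivations \<delta> Q" "finite F" "0 < i" "0 < j"
  shows "\<delta> i (\<delta> j (family_weight Q F)) = (\<Sum>X\<in>F. \<Sum>Y\<in>F - {X}.
    (if card X = j then of_nat j else 0) * ((if card Y = i then of_nat i else 0)
      * family_weight Q (F - {X, Y})))"
proof -
  have D: "derivation (\<delta> n)" for n
    using assms(1) by (simp add: dual_derivations_def)
  have dQ: "\<delta> n (Q k) = (if k = n then of_nat n else 0)" if "0 < n" for n k
    using assms(1) that by (simp add: dual_derivations_def)
  have "\<delta> i ((if card X = j then of_nat j else 0) * W) = (if card X = j then of_nat j else 0) * \<delta> i W"
    for X :: "'b set" and W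
    by (simp add: derivation_simps[OF D])
  moreover have "F - {X} - {Y} = F - {X, Y}" for X Y
    by auto
  ultimately show ?thesis
    using assms(2-4)
    by (simp add: family_weight_derivation[OF D] derivation_sum[OF D] dQ sum_distrib_left)
qed

lemma sum_fixed_index_sum:
  assumes "c \<le> N"
  shows "(\<Sum>(i, j)\<in>index_pairs N. if c = i + j then f i j else 0) = (\<Sum>k\<in>{1..<c}. f k (c - k))"
proof -
  have "(\<Sum>k\<in>{1..<c}. f k (c - k)) = (\<Sum>(i, j)\<in>{(i, j) \<in> index_pairs N. c = i + j}. f i j)"
    by (rule sum.reindex_bij_witness[of _ fst "\<lambda>k. (k, c - k)"])
      (use assms in \<open>auto simp: index_pairs_def\<close>)
  also have "\<dots> = (\<Sum>(i, j)\<in>index_pairs N. if c = i + j then f i j else 0)"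
    by (simp add: case_prod_unfold sum.inter_filter)
  finally show ?thesis ..
qed

text \<open>By the product rule a first derivative selects one member and a second derivative an
  ordered pair of distinct members, each contributing its size; this fixes the indices
  \<open>i + j\<close> or \<open>(i, j)\<close>. The bound \<open>N\<close> on the total size
  ensures that the truncation loses no term.\<close>

lemma cutjoin_family_weight:
  fixes F :: "'b set set"
  assumes \<delta>: "dual_derivations \<delta> Q" and F: "finite F" "\<And>X. X \<in> F \<Longrightarrow> 0 < card X"
    and N: "(\<Sum>X\<in>F. card X) \<le> N"
  shows "cutjoin N Q \<delta> (family_weight Q F) =
    (\<Sum>X\<in>F. of_nat (card X) * (\<Sum>k\<in>{1..<card X}. Q k * Q (card X - k) * family_weight Q (F - {X}))) +
    (\<Sum>X\<in>F. \<Sum>Y\<in>F - {X}. of_nat (card X) * of_nat (card Y) *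
       (Q (card X + card Y) * family_weight Q (F - {X, Y})))"
    (is "_ = ?cut + ?join")
proof -
  have D: "derivation (\<delta> n)" for n
    using \<delta> by (simp add: dual_derivations_def)
  have dQ: "\<delta> n (Q k) = (if k = n then of_nat n else 0)" if "0 < n" for n k
    using \<delta> that by (simp add: dual_derivations_def)
  have le: "card X + card Y \<le> N" if "X \<in> F" "Y \<in> F - {X}" for X Y
  proof -
    have "(\<Sum>Z\<in>{X, Y}. card Z) \<le> (\<Sum>Z\<in>F. card Z)"
      using that F(1) by (intro sum_mono2) auto
    moreover have "X \<noteq> Y"
      using that by auto
    ultimately show ?thesis
      using N by simp
  qed
  have le1: "card X \<le> N" if "X \<in> F" for X
    using member_le_sum[OF that, of card] F(1) N by simp
  have "(\<Sum>(i, j)\<in>index_pairs N. Q i * Q j * \<delta> (i + j) (family_weight Q F)) =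
      (\<Sum>(i, j)\<in>index_pairs N. \<Sum>X\<in>F. if card X = i + j
         then of_nat (card X) * (Q i * Q j * family_weight Q (F - {X})) else 0)"
    by (intro sum.cong refl)
      (auto simp: family_weight_derivation[OF D F(1)] dQ sum_distrib_left index_pairs_def mult_ac
        intro!: sum.cong simp flip: of_nat_add)
  also have "\<dots> = (\<Sum>X\<in>F. \<Sum>(i, j)\<in>index_pairs N. if card X = i + j
         then of_nat (card X) * (Q i * Q j * family_weight Q (F - {X})) else 0)"
    unfolding case_prod_unfold by (rule sum.swap)
  also have "\<dots> = ?cut"
    by (intro sum.cong refl) (subst sum_fixed_index_sum[OF le1], auto simp: sum_distrib_left)
  finally have cut: "(\<Sum>(i, j)\<in>index_pairs N. Q i * Q j * \<delta> (i + j) (family_weight Q F)) = ?cut" .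
  have "(\<Sum>(i, j)\<in>index_pairs N. Q (i + j) * \<delta> i (\<delta> j (family_weight Q F))) =
      (\<Sum>p\<in>index_pairs N. \<Sum>X\<in>F. \<Sum>Y\<in>F - {X}. if p = (card Y, card X)
         then of_nat (card X) * of_nat (card Y) *
           (Q (card X + card Y) * family_weight Q (F - {X, Y})) else 0)"
  proof (intro sum.cong refl, clarify)
    fix i j assume "(i, j) \<in> index_pairs N"
    then have ij: "0 < i" "0 < j"
      by (auto simp: index_pairs_def)
    show "Q (i + j) * \<delta> i (\<delta> j (family_weight Q F)) =
      (\<Sum>X\<in>F. \<Sum>Y\<in>F - {X}. if (i, j) = (card Y, card X)
         then of_nat (card X) * of_nat (card Y) *
           (Q (card X + card Y) * family_weight Q (F - {X, Y})) else 0)"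
      unfolding family_weight_dual_derivation2[where \<delta> = \<delta>, OF \<delta> F(1) ij] sum_distrib_left
    proof (intro sum.cong refl)
      fix X Y :: "'b set"
      show "Q (i + j) * ((if card X = j then of_nat j else 0) *
          ((if card Y = i then of_nat i else 0) * family_weight Q (F - {X, Y}))) =
        (if (i, j) = (card Y, card X) then of_nat (card X) * of_nat (card Y) *
           (Q (card X + card Y) * family_weight Q (F - {X, Y})) else 0)"
        by (cases "card X = j"; cases "card Y = i") (simp_all add: mult_ac add_ac)
    qed
  qed
  also have "\<dots> = (\<Sum>X\<in>F. \<Sum>Y\<in>F - {X}. \<Sum>p\<in>index_pairs N. if p = (card Y, card X)
         then of_nat (card X) * of_nat (card Y) *
           (Q (card X + card Y) * family_weight Q (F - {X, Y})) else 0)"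
    by (subst sum.swap, intro sum.cong refl, rule sum.swap)
  also have "\<dots> = ?join"
  proof (intro sum.cong refl)
    fix X Y assume XY: "X \<in> F" "Y \<in> F - {X}"
    then have "(card Y, card X) \<in> index_pairs N"
      using le[OF XY] F(2) by (auto simp: index_pairs_def)
    then show "(\<Sum>p\<in>index_pairs N. if p = (card Y, card X) then of_nat (card X) * of_nat (card Y) *
           (Q (card X + card Y) * family_weight Q (F - {X, Y})) else 0) =
         of_nat (card X) * of_nat (card Y) * (Q (card X + card Y) * family_weight Q (F - {X, Y}))"
      by (simp add: sum.delta)
  qed
  finally show ?thesis
    using cut by (simp add: cutjoin_def sum.distrib case_prod_unfold)
qed

section \<open>Cycle weights of a permutation multiplied by transpositions\<close>

definition cyc_weight :: "nat set \<Rightarrow> (nat \<Rightarrow> 'a::comm_ring_1) \<Rightarrow> (nat \<Rightarrow> nat) \<Rightarrow> 'a" where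
  "cyc_weight A Q g = family_weight Q (orbit g ` A)"

text \<open>Each orbit \<open>X\<close> is met from exactly \<open>card X\<close> points; this is
  the source of the factors \<open>card X\<close> in the cut-and-join formula.\<close>

lemma sum_over_orbits:
  assumes g: "permutation g" and B: "finite B" "\<And>x. x \<in> B \<Longrightarrow> orbit g x \<subseteq> B"
  shows "(\<Sum>x\<in>B. f (orbit g x)) = (\<Sum>X\<in>orbit g ` B. of_nat (card X) * (f X :: 'a::comm_ring_1))"
proof -
  have "{x \<in> B. orbit g x = X} = X" if X: "X \<in> orbit g ` B" for X
  proof -
    obtain y where y: "X = orbit g y" "y \<in> B"
      using X by (rule imageE)
    show ?thesis
    proof (intro equalityI subsetI)
      fix x assume "x \<in> {x \<in> B. orbit g x = X}"
      then show "x \<in> X"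
        using permutation_self_in_orbit[OF g, of x] by auto
    next
      fix x assume "x \<in> X"
      then show "x \<in> {x \<in> B. orbit g x = X}"
        using B(2)[OF y(2)] orbit_eqI_mem[OF g, of x y] y(1) by auto
    qed
  qed
  note fibre = this
  have "(\<Sum>x\<in>{x \<in> B. orbit g x = X}. f (orbit g x)) = of_nat (card X) * f X"
    if "X \<in> orbit g ` B" for X
  proof -
    have "(\<Sum>x\<in>{x \<in> B. orbit g x = X}. f (orbit g x)) = (\<Sum>x\<in>{x \<in> B. orbit g x = X}. f X)"
      by (rule sum.cong) auto
    then show ?thesis
      using fibre[OF that] by simp
  qed
  then show ?thesis
    by (subst sum.image_gen[OF B(1), of _ "orbit g"]) (rule sum.cong[OF refl])
qed

lemma card_orbits:
  assumes "g permutes A" "finite A"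
  shows "(\<Sum>X\<in>orbit g ` A. card X) = card A"
proof -
  have g: "permutation g"
    using assms by (auto simp: permutation_permutes)
  have "int (\<Sum>X\<in>orbit g ` A. card X) = (\<Sum>X\<in>orbit g ` A. of_nat (card X) * 1)"
    by simp
  also have "\<dots> = int (card A)"
    using sum_over_orbits[OF g assms(2) permutes_orbit_subset[OF assms(1)], of "\<lambda>_. 1 :: int"]
    by simp
  finally show ?thesis
    by linarith
qed

lemma card_orbit_pos: "permutation g \<Longrightarrow> X \<in> orbit g ` A \<Longrightarrow> 0 < card X"
  by (elim imageE) (simp add: orbit_parametrization(4))

text \<open>Multiplication by a transposition either cuts a cycle or joins two cycles, whence the two
  terms of the cut-and-join operator.\<close>

lemma sum_transpose_cyc_weight:
  assumes gA: "g permutes A" and A: "finite A" "card A \<le> N" and \<delta>: "dual_derivations \<delta> Q"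
  shows "(\<Sum>i\<in>A. \<Sum>j\<in>A - {i}. cyc_weight A Q (transpose i j \<circ> g)) =
    cutjoin N Q \<delta> (cyc_weight A Q g)"
proof -
  have g: "permutation g"
    using gA A by (auto simp: permutation_permutes)
  define F where "F = orbit g ` A"
  have F: "finite F"
    using A by (simp add: F_def)
  have sub: "orbit g i \<subseteq> A" if "i \<in> A" for i
    using permutes_orbit_subset[OF gA that] .
  have fin_orb: "finite (orbit g i)" for i
    using finite_orbit[OF permutation_self_in_orbit[OF g]] .
  \<comment> \<open>The points of the cycle other than \<open>i\<close> are
    \<open>(g ^^ k) i\<close> with \<open>1 \<le> k < card (orbit g i)\<close>, one for each way to
    cut.\<close>
  have cut: "(\<Sum>j\<in>orbit g i - {i}. cyc_weight A Q (transpose i j \<circ> g)) =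
      (\<Sum>k\<in>{1..<card (orbit g i)}. Q k * Q (card (orbit g i) - k) * family_weight Q (F - {orbit g i}))"
    if i: "i \<in> A" for i
  proof -
    let ?n = "card (orbit g i)" and ?x = "\<lambda>m. (g ^^ m) i"
    note par = orbit_parametrization[OF g, of i]
    have set: "orbit g i - {i} = ?x ` {1..<?n}"
    proof -
      have "?x ` ({..<?n} - {0}) = ?x ` {..<?n} - ?x ` {0}"
        using par(4) by (intro inj_on_image_set_diff[OF par(2)]) auto
      moreover have "{..<?n} - {0} = {1..<?n}"
        by auto
      ultimately show ?thesis
        using par(1) by simp
    qed
    have "(\<Sum>j\<in>orbit g i - {i}. cyc_weight A Q (transpose i j \<circ> g)) =
        (\<Sum>k\<in>{1..<?n}. cyc_weight A Q (transpose i (?x k) \<circ> g))"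
      unfolding set
      by (subst sum.reindex) (auto intro: inj_on_subset[OF par(2)])
    also have "\<dots> = (\<Sum>k\<in>{1..<?n}. Q k * Q (?n - k) * family_weight Q (F - {orbit g i}))"
    proof (rule sum.cong)
      fix k assume k: "k \<in> {1..<?n}"
      let ?t = "transpose i (?x k) \<circ> g"
      have xk: "?x k \<in> orbit g i" "?x k \<noteq> i"
      proof -
        have "?x k \<in> orbit g i - {i}"
          unfolding set by (rule imageI[OF k])
        then show "?x k \<in> orbit g i" "?x k \<noteq> i"
          by (auto simp only: Diff_iff insert_iff)
      qed
      note co = orbit_transpose_cut[OF g, of k i] and
        or = orbits_transpose_cut[OF g i _ xk]
      have t: "permutation ?t"
        by (intro permutation_compose permutation_swap_id g)
      have card: "card (orbit ?t i) = k" "card (orbit ?t (?x k)) = ?n - k"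
        using k par(2) by (subst co; auto intro!: card_image[THEN trans] intro: inj_on_subset)+
      have xA: "?x k \<in> A"
        using xk(1) sub[OF i] by auto
      \<comment> \<open>The two pieces must differ from all remaining cycles, otherwise their
        factors would be absorbed by the set.\<close>
      have notin: "Y \<notin> F - {orbit g i}" if "Y \<noteq> {}" "Y \<subseteq> orbit g i" for Y
        using that orbit_disjoint[OF g, of Y A "orbit g i"] i by (auto simp: F_def)
      have un: "orbit ?t i \<union> orbit ?t (?x k) = orbit g i" "orbit ?t i \<inter> orbit ?t (?x k) = {}"
        using or[OF xA] by auto
      have "orbit ?t i \<noteq> orbit ?t (?x k)"
        using un(2) orbit_nonempty[of ?t i] by auto
      moreover have "orbit ?t i \<notin> F - {orbit g i}" "orbit ?t (?x k) \<notin> F - {orbit g i}"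
        using notin[OF orbit_nonempty[of ?t i]] notin[OF orbit_nonempty[of ?t "?x k"]] un(1) by blast+
      ultimately have "family_weight Q (insert (orbit ?t i) (insert (orbit ?t (?x k)) (F - {orbit g i}))) =
          Q (card (orbit ?t i)) * (Q (card (orbit ?t (?x k))) * family_weight Q (F - {orbit g i}))"
        using F unfolding family_weight_def by (subst prod.insert; simp)
      then show "cyc_weight A Q ?t = Q k * Q (?n - k) * family_weight Q (F - {orbit g i})"
        unfolding cyc_weight_def or(1)[OF xA] F_def[symmetric] card by (simp only: mult.assoc)
    qed simp
    finally show ?thesis .
  qed
  have join: "(\<Sum>j\<in>A - orbit g i. cyc_weight A Q (transpose i j \<circ> g)) =
      (\<Sum>Y\<in>F - {orbit g i}. of_nat (card Y) *
        (Q (card (orbit g i) + card Y) * family_weight Q (F - {orbit g i, Y})))"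
    if i: "i \<in> A" for i
  proof -
    have inv: "orbit g x \<subseteq> A - orbit g i" if "x \<in> A - orbit g i" for x
    proof
      fix y assume y: "y \<in> orbit g x"
      have "orbit g x = orbit g i" if "y \<in> orbit g i"
        using orbit_eqI_mem[OF g y] orbit_eqI_mem[OF g that] by simp
      then show "y \<in> A - orbit g i"
        using y sub[of x] that permutation_self_in_orbit[OF g, of x] by auto
    qed
    have "orbit g x \<noteq> orbit g i" if "x \<notin> orbit g i" for x
      using permutation_self_in_orbit[OF g, of x] that by auto
    moreover have "x \<notin> orbit g i" if "orbit g x \<noteq> orbit g i" for x
      using orbit_eqI_mem[OF g, of x i] that by auto
    ultimately have img: "orbit g ` (A - orbit g i) = F - {orbit g i}"
      by (auto simp: F_def)
    have "(\<Sum>j\<in>A - orbit g i. cyc_weight A Q (transpose i j \<circ> g)) =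
      (\<Sum>j\<in>A - orbit g i. Q (card (orbit g i) + card (orbit g j)) * family_weight Q (F - {orbit g i, orbit g j}))"
    proof (rule sum.cong)
      fix j assume j: "j \<in> A - orbit g i"
      then have jA: "j \<in> A" "j \<notin> orbit g i"
        by auto
      note or = orbits_transpose_join[OF g i jA]
      have "orbit g i \<inter> orbit g j = {}"
        using inv[OF j] by auto
      then show "cyc_weight A Q (transpose i j \<circ> g) =
          Q (card (orbit g i) + card (orbit g j)) * family_weight Q (F - {orbit g i, orbit g j})"
        unfolding cyc_weight_def or(1) family_weight_def using or(2) F fin_orb
        by (simp add: card_Un_disjoint F_def)
    qed simp
    also have "\<dots> = (\<Sum>Y\<in>F - {orbit g i}. of_nat (card Y) *
        (Q (card (orbit g i) + card Y) * family_weight Q (F - {orbit g i, Y})))"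
      by (subst sum_over_orbits[OF g _ inv]) (use A img in auto)
    finally show ?thesis .
  qed
  have "(\<Sum>i\<in>A. \<Sum>j\<in>A - {i}. cyc_weight A Q (transpose i j \<circ> g)) =
    (\<Sum>i\<in>A. (\<Sum>j\<in>orbit g i - {i}. cyc_weight A Q (transpose i j \<circ> g)) +
       (\<Sum>j\<in>A - orbit g i. cyc_weight A Q (transpose i j \<circ> g)))"
  proof (rule sum.cong)
    fix i assume i: "i \<in> A"
    have "A - {i} = (orbit g i - {i}) \<union> (A - orbit g i)"
      using sub[OF i] permutation_self_in_orbit[OF g, of i] by auto
    then show "(\<Sum>j\<in>A - {i}. cyc_weight A Q (transpose i j \<circ> g)) =
       (\<Sum>j\<in>orbit g i - {i}. cyc_weight A Q (transpose i j \<circ> g)) +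
       (\<Sum>j\<in>A - orbit g i. cyc_weight A Q (transpose i j \<circ> g))"
      using A fin_orb by (simp only:) (rule sum.union_disjoint; auto)
  qed simp
  also have "\<dots> = (\<Sum>i\<in>A. (\<lambda>X. (\<Sum>k\<in>{1..<card X}. Q k * Q (card X - k) * family_weight Q (F - {X})) +
      (\<Sum>Y\<in>F - {X}. of_nat (card Y) * (Q (card X + card Y) * family_weight Q (F - {X, Y})))) (orbit g i))"
    by (intro sum.cong refl) (simp add: cut join)
  also have "\<dots> = (\<Sum>X\<in>F. of_nat (card X) * ((\<Sum>k\<in>{1..<card X}. Q k * Q (card X - k) * family_weight Q (F - {X})) +
      (\<Sum>Y\<in>F - {X}. of_nat (card Y) * (Q (card X + card Y) * family_weight Q (F - {X, Y})))))"
    by (subst sum_over_orbits[OF g A(1) sub]) (auto simp: F_def)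
  also have "\<dots> = cutjoin N Q \<delta> (family_weight Q F)"
    by (subst cutjoin_family_weight[OF \<delta> F])
      (use card_orbit_pos[OF g, of _ A] card_orbits[OF gA A(1)] A(2) in
        \<open>auto simp: F_def distrib_left sum.distrib sum_distrib_left mult.assoc\<close>)
  finally show ?thesis
    by (simp add: cyc_weight_def F_def)
qed

lemma finite_transpositions: "finite (transpositions d)"
proof -
  have "transpositions d \<subseteq> (\<lambda>(i, j). transpose i j) ` ({1..d} \<times> {1..d})"
    by (auto simp: transpositions_def)
  then show ?thesis
    by (rule finite_subset) auto
qed

text \<open>Every transposition comes from the two ordered pairs \<open>(i, j)\<close> and
  \<open>(j, i)\<close>. This factor 2 is the one that \<open>cutjoin\<close> carries.\<close>

lemma sum_transpositions:
  "(\<Sum>i\<in>{1..d}. \<Sum>j\<in>{1..d} - {i}. f (transpose i j)) = (\<Sum>t\<in>transpositions d. 2 * (f t :: 'a::comm_ring_1))"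
proof -
  let ?S = "SIGMA i:{1..d}. {1..d} - {i}" and ?t = "\<lambda>(i, j). transpose i j"
  have fin: "finite ?S"
    by auto
  have img: "?t ` ?S = transpositions d"
    by (auto simp: transpositions_def image_iff) blast
  have fib: "(\<Sum>p\<in>{p \<in> ?S. ?t p = t}. f (?t p)) = 2 * f t" if t: "t \<in> transpositions d" for t
  proof -
    obtain i j where ij: "t = transpose i j" "i \<in> {1..d}" "j \<in> {1..d}" "i \<noteq> j"
      using t by (auto simp: transpositions_def)
    have "transpose k l = transpose i j \<longleftrightarrow> (k = i \<and> l = j) \<or> (k = j \<and> l = i)" if "k \<noteq> l" for k l
    proof
      assume eq: "transpose k l = transpose i j"
      show "(k = i \<and> l = j) \<or> (k = j \<and> l = i)"
        using fun_cong[OF eq, of k] fun_cong[OF eq, of l] that ij(4)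
        by (auto simp: transpose_def split: if_splits)
    qed (auto simp: transpose_commute)
    then have fibre: "{p \<in> ?S. ?t p = t} = {(i, j), (j, i)}"
      using ij by auto
    have "(\<Sum>p\<in>{(i, j), (j, i)}. f (?t p)) = f (transpose i j) + f (transpose j i)"
      using ij(4) by simp
    also have "\<dots> = 2 * f t"
      unfolding transpose_commute[of j i] ij(1) by (simp only: mult_2)
    finally show ?thesis
      unfolding fibre .
  qed
  have "(\<Sum>i\<in>{1..d}. \<Sum>j\<in>{1..d} - {i}. f (transpose i j)) = (\<Sum>p\<in>?S. f (?t p))"
    by (simp add: sum.Sigma case_prod_unfold)
  also have "\<dots> = (\<Sum>t\<in>?t ` ?S. \<Sum>p\<in>{p \<in> ?S. ?t p = t}. f (?t p))"
    by (rule sum.image_gen[OF fin])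
  also have "\<dots> = (\<Sum>t\<in>transpositions d. 2 * f t)"
    unfolding img by (intro sum.cong refl fib)
  finally show ?thesis .
qed

section \<open>Complete homogeneous functions\<close>

text \<open>\<open>hom_sym emb x n\<close> is the complete homogeneous symmetric function of degree \<open>n\<close>, expressed
  through the power sums \<open>x\<^sub>1, x\<^sub>2, \<dots>\<close> by Newton's recursion.\<close>

fun hom_sym :: "(rat \<Rightarrow> 'a) \<Rightarrow> (nat \<Rightarrow> 'a) \<Rightarrow> nat \<Rightarrow> 'a::comm_ring_1" where
  "hom_sym emb x n =
     (if n = 0 then 1 else emb (1 / of_nat n) * (\<Sum>k\<in>{1..n}. x k * hom_sym emb x (n - k)))"

declare hom_sym.simps [simp del]

text \<open>Used for \<open>Const\<close> and \<open>zConst\<close>. The decisive consequence is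
  that positive integers can be cancelled, so that Newton's recursion and the recursion in beta
  determine their solutions.\<close>

locale rat_algebra =
  fixes emb :: "rat \<Rightarrow> 'a::comm_ring_1"
  assumes emb_1 [simp]: "emb 1 = 1"
    and emb_add: "emb (x + y) = emb x + emb y"
    and emb_mult: "emb (x * y) = emb x * emb y"
begin

lemma emb_0 [simp]: "emb 0 = 0"
  using emb_add[of 0 0] by simp

lemma emb_of_nat: "emb (of_nat n) = of_nat n"
  by (induction n) (auto simp: emb_add)

lemma of_nat_mult_emb_inverse: "0 < n \<Longrightarrow> of_nat n * emb (1 / of_nat n) = 1"
  unfolding emb_of_nat[symmetric] emb_mult[symmetric] by simp

lemma of_nat_mult_cancel:
  fixes x y :: 'a
  assumes "0 < n" "of_nat n * x = of_nat n * y"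
  shows "x = y"
proof -
  have "of_nat n * emb (1 / of_nat n) * x = of_nat n * emb (1 / of_nat n) * y"
    using assms(2) by (metis mult.assoc mult.commute)
  then show ?thesis
    using assms(1) by (simp add: of_nat_mult_emb_inverse)
qed

lemma hom_sym_0 [simp]: "hom_sym emb x 0 = 1"
  by (simp add: hom_sym.simps)

lemma hom_sym_newton: "of_nat n * hom_sym emb x n = (\<Sum>k\<in>{1..n}. x k * hom_sym emb x (n - k))"
proof (cases "n = 0")
  case False
  then show ?thesis
    by (subst hom_sym.simps) (simp add: of_nat_mult_emb_inverse flip: mult.assoc)
qed simp

lemma hom_sym_unique:
  assumes "g 0 = 1" and "\<And>n. 0 < n \<Longrightarrow> of_nat n * g n = (\<Sum>k\<in>{1..n}. x k * g (n - k))"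
  shows "g n = hom_sym emb x n"
proof (induction n rule: less_induct)
  case (less n)
  show ?case
  proof (cases "n = 0")
    case False
    have "of_nat n * g n = of_nat n * hom_sym emb x n"
      unfolding hom_sym_newton using False by (simp add: assms(2) less)
    then show ?thesis
      using False of_nat_mult_cancel by blast
  qed (simp add: assms(1))
qed

lemma hom_sym_cong:
  assumes "\<And>k. 0 < k \<Longrightarrow> k \<le> n \<Longrightarrow> x k = y k"
  shows "hom_sym emb x n = hom_sym emb y n"
  using assms
proof (induction n rule: less_induct)
  case (less n)
  show ?case
    by (subst (1 2) hom_sym.simps) (auto intro!: sum.cong less arg_cong2[where f = "(*)"])
qed

text \<open>This is exp(sum x_n t^n / n); Newton's recursion says that
  \<open>t F' = (\<Sum> x_n t^n) F\<close>.\<close>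

definition hom_fps :: "(nat \<Rightarrow> 'a) \<Rightarrow> 'a fps" where
  "hom_fps x = Abs_fps (hom_sym emb x)"

definition sum_fps :: "(nat \<Rightarrow> 'a) \<Rightarrow> 'a fps" where
  "sum_fps x = Abs_fps (\<lambda>n. if n = 0 then 0 else x n)"

lemma sum_fps_mult_nth: "fps_nth (sum_fps x * F) n = (\<Sum>k\<in>{1..n}. x k * fps_nth F (n - k))"
proof -
  have "fps_nth (sum_fps x * F) n = (\<Sum>k\<in>{0..n}. (if k = 0 then 0 else x k) * fps_nth F (n - k))"
    by (simp add: fps_mult_nth sum_fps_def)
  also have "\<dots> = (\<Sum>k\<in>{1..n}. x k * fps_nth F (n - k))"
    by (rule sum.mono_neutral_cong_right) auto
  finally show ?thesis .
qed

lemma X_deriv_hom_fps: "fps_X * fps_deriv (hom_fps x) = sum_fps x * hom_fps x"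
proof (rule fps_ext)
  fix n
  have "fps_nth (fps_X * fps_deriv (hom_fps x)) n = of_nat n * hom_sym emb x n"
    by (cases n) (simp_all add: hom_fps_def)
  then show "fps_nth (fps_X * fps_deriv (hom_fps x)) n = fps_nth (sum_fps x * hom_fps x) n"
    by (simp add: hom_sym_newton sum_fps_mult_nth hom_fps_def)
qed

lemma hom_sym_eqI:
  assumes "fps_nth F 0 = 1" "fps_X * fps_deriv F = sum_fps x * F"
  shows "fps_nth F n = hom_sym emb x n"
proof (rule hom_sym_unique)
  fix n :: nat
  assume "0 < n"
  then have "fps_nth (fps_X * fps_deriv F) n = of_nat n * fps_nth F n"
    by (cases n) simp_all
  then show "of_nat n * fps_nth F n = (\<Sum>k\<in>{1..n}. x k * fps_nth F (n - k))"
    by (simp add: assms(2) sum_fps_mult_nth)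
qed (rule assms(1))

text \<open>The functional equation of the exponential: by the product rule, the product of the two
  series solves the differential equation for \<open>x + y\<close>.\<close>

lemma hom_sym_add:
  "hom_sym emb (\<lambda>k. x k + y k) n = (\<Sum>i\<in>{0..n}. hom_sym emb x i * hom_sym emb y (n - i))"
proof -
  have "sum_fps (\<lambda>k. x k + y k) = sum_fps x + sum_fps y"
    by (rule fps_ext) (simp add: sum_fps_def)
  moreover have "fps_X * fps_deriv (hom_fps x * hom_fps y) =
      hom_fps x * (fps_X * fps_deriv (hom_fps y)) + (fps_X * fps_deriv (hom_fps x)) * hom_fps y"
    by (simp add: algebra_simps)
  ultimately have "fps_X * fps_deriv (hom_fps x * hom_fps y) =
      sum_fps (\<lambda>k. x k + y k) * (hom_fps x * hom_fps y)"
    unfolding X_deriv_hom_fps by (simp add: algebra_simps)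
  then have "fps_nth (hom_fps x * hom_fps y) n = hom_sym emb (\<lambda>k. x k + y k) n"
    by (rule hom_sym_eqI[rotated]) (simp add: hom_fps_def)
  then show ?thesis
    by (simp add: fps_mult_nth hom_fps_def)
qed

lemma hom_sym_scale: "hom_sym emb (\<lambda>k. c ^ k * x k) n = c ^ n * hom_sym emb x n"
proof (rule sym, rule hom_sym_unique)
  fix n :: nat
  have "of_nat n * (c ^ n * hom_sym emb x n) = c ^ n * (of_nat n * hom_sym emb x n)"
    by (simp add: mult_ac)
  also have "\<dots> = (\<Sum>k\<in>{1..n}. c ^ n * (x k * hom_sym emb x (n - k)))"
    by (simp add: hom_sym_newton sum_distrib_left)
  also have "\<dots> = (\<Sum>k\<in>{1..n}. c ^ k * x k * (c ^ (n - k) * hom_sym emb x (n - k)))"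
  proof (rule sum.cong)
    fix k assume "k \<in> {1..n}"
    then have "c ^ n = c ^ k * c ^ (n - k)"
      by (simp flip: power_add)
    then show "c ^ n * (x k * hom_sym emb x (n - k)) = c ^ k * x k * (c ^ (n - k) * hom_sym emb x (n - k))"
      by (simp add: mult_ac)
  qed simp
  finally show "of_nat n * (c ^ n * hom_sym emb x n) =
    (\<Sum>k\<in>{1..n}. c ^ k * x k * (c ^ (n - k) * hom_sym emb x (n - k)))" .
qed simp

end

section \<open>The sum of the cycle weights over the symmetric group\<close>

text \<open>Splits off the cycle through a marked point \<open>a\<close>. Summing
  \<open>x n * rooted_weight A x a n g\<close> over \<open>n\<close> returns the full cycle weight,
  which is Newton's recursion at the level of permutations.\<close>

definition rooted_weight :: "nat set \<Rightarrow> (nat \<Rightarrow> 'a::comm_ring_1) \<Rightarrow> nat \<Rightarrow> nat \<Rightarrow> (nat \<Rightarrow> nat) \<Rightarrow> 'a" where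
  "rooted_weight A x a n g =
     (if card (orbit g a) = n then family_weight x (orbit g ` A - {orbit g a}) else 0)"

lemma rooted_weight_insert_fixed:
  assumes "q permutes S" "finite S" "a \<notin> S"
  shows "rooted_weight (insert a S) x a n q = (if n = 1 then cyc_weight S x q else 0)"
proof -
  have "q a = a"
    using assms by (auto simp: permutes_def)
  then have oa: "orbit q a = {a}"
    by (simp add: orbit_eq_singleton_iff)
  have "{a} \<notin> orbit q ` S"
    using permutes_orbit_subset[OF assms(1)] assms(3) by blast
  then show ?thesis
    by (simp add: rooted_weight_def oa cyc_weight_def)
qed

text \<open>The fixed point \<open>a\<close> of \<open>q\<close> is joined to the cycle of
  \<open>b\<close>, which grows by one element; the other cycles stay the same.\<close>

lemma rooted_weight_insert_transpose:
  assumes q: "q permutes S" and S: "finite S" "a \<notin> S" and b: "b \<in> S"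
  shows "rooted_weight (insert a S) x a (Suc n) (transpose a b \<circ> q) = rooted_weight S x b n q"
proof -
  let ?p = "transpose a b \<circ> q"
  have pq: "permutation q"
    using q S by (auto simp: permutation_permutes)
  have "q a = a"
    using q S by (auto simp: permutes_def)
  then have oa: "orbit q a = {a}"
    by (simp add: orbit_eq_singleton_iff)
  have pp: "permutation ?p"
    by (intro permutation_compose permutation_swap_id pq)
  have sub: "orbit q y \<subseteq> S" if "y \<in> S" for y
    using permutes_orbit_subset[OF q that] .
  have "b \<notin> orbit q a"
    using oa b S by auto
  note join = orbits_transpose_join[OF pq _ _ this, of "insert a S"]
  have J: "orbit ?p ` insert a S = insert ({a} \<union> orbit q b) (orbit q ` insert a S - {{a}, orbit q b})"
    "{a} \<union> orbit q b \<notin> orbit q ` insert a S - {{a}, orbit q b}"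
    using join b oa by auto
  have opa: "orbit ?p a = {a} \<union> orbit q b"
  proof (rule ccontr)
    assume "orbit ?p a \<noteq> {a} \<union> orbit q b"
    then have "orbit ?p a \<inter> ({a} \<union> orbit q b) = {}"
      by (intro orbit_disjoint[OF pp, of _ "insert a S"]) (use J(1) in auto)
    then show False
      using permutation_self_in_orbit[OF pp, of a] by auto
  qed
  have anot: "a \<notin> orbit q b" "{a} \<notin> orbit q ` S"
    using sub b S(2) by blast+
  have "finite (orbit q b)"
    using sub[OF b] S(1) finite_subset by auto
  then have "card (orbit ?p a) = Suc (card (orbit q b))"
    using anot by (simp add: opa)
  moreover have "orbit ?p ` insert a S - {orbit ?p a} = orbit q ` S - {orbit q b}"
    unfolding J(1) opa using J(2) anot oa by auto
  ultimately show ?thesis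
    by (simp add: rooted_weight_def)
qed

text \<open>The cycle index of the symmetric group. Both claims are proved in one induction:
  deleting \<open>a\<close> expresses the rooted sum by both claims for a smaller set, and Newton's
  recursion derives the first claim from the rooted sums.\<close>

lemma (in rat_algebra) sum_cyc_weight:
  assumes "finite A"
  shows "(\<Sum>g\<in>{g. g permutes A}. cyc_weight A x g) = of_nat (fact (card A)) * hom_sym emb x (card A)"
    and "\<And>a n. a \<in> A \<Longrightarrow> n \<in> {1..card A} \<Longrightarrow>
      (\<Sum>g\<in>{g. g permutes A}. rooted_weight A x a n g) = of_nat (fact (card A - 1)) * hom_sym emb x (card A - n)"
proof -
  define G where "G A \<longleftrightarrow>
    (\<Sum>g\<in>{g. g permutes A}. cyc_weight A x g) = of_nat (fact (card A)) * hom_sym emb x (card A) \<and>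
    (\<forall>a\<in>A. \<forall>n\<in>{1..card A}. (\<Sum>g\<in>{g. g permutes A}. rooted_weight A x a n g) =
       of_nat (fact (card A - 1)) * hom_sym emb x (card A - n))" for A
  have "G A"
    using assms
  proof (induction "card A" arbitrary: A rule: less_induct)
    case less
    have rooted: "(\<Sum>g\<in>{g. g permutes A}. rooted_weight A x a n g) =
        of_nat (fact (card A - 1)) * hom_sym emb x (card A - n)" if a: "a \<in> A" and n: "n \<in> {1..card A}" for a n
    proof -
      define S where "S = A - {a}"
      have S: "A = insert a S" "finite S" "a \<notin> S"
        using a less.prems by (auto simp: S_def)
      have cA: "card A = Suc (card S)"
        using S by simp
      then have GS: "G S"
        using less.hyps S(2) by simp
      have "(\<Sum>g\<in>{g. g permutes A}. rooted_weight A x a n g) =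
          (\<Sum>b\<in>insert a S. \<Sum>q\<in>{q. q permutes S}. rooted_weight A x a n (transpose a b \<circ> q))"
        unfolding S(1) by (rule sum_over_permutations_insert[OF S(2,3)])
      also have "\<dots> = (\<Sum>q\<in>{q. q permutes S}. rooted_weight A x a n q) +
          (\<Sum>b\<in>S. \<Sum>q\<in>{q. q permutes S}. rooted_weight A x a n (transpose a b \<circ> q))"
        using S by simp
      also have "(\<Sum>q\<in>{q. q permutes S}. rooted_weight A x a n q) =
          (if n = 1 then of_nat (fact (card S)) * hom_sym emb x (card S) else 0)"
        using GS S by (simp add: G_def rooted_weight_insert_fixed)
      also have "(\<Sum>b\<in>S. \<Sum>q\<in>{q. q permutes S}. rooted_weight A x a n (transpose a b \<circ> q)) =
          (if n = 1 then 0 else of_nat (fact (card S)) * hom_sym emb x (card A - n))"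
      proof -
        obtain m where m: "n = Suc m"
          using n by (cases n) auto
        have "(\<Sum>b\<in>S. \<Sum>q\<in>{q. q permutes S}. rooted_weight A x a n (transpose a b \<circ> q)) =
            (\<Sum>b\<in>S. \<Sum>q\<in>{q. q permutes S}. rooted_weight S x b m q)"
          unfolding m S(1) using S(2,3)
          by (intro sum.cong refl rooted_weight_insert_transpose) auto
        also have "\<dots> = (\<Sum>b\<in>S. if m = 0 then 0 else of_nat (fact (card S - 1)) * hom_sym emb x (card S - m))"
        proof (rule sum.cong)
          fix b assume b: "b \<in> S"
          show "(\<Sum>q\<in>{q. q permutes S}. rooted_weight S x b m q) =
              (if m = 0 then 0 else of_nat (fact (card S - 1)) * hom_sym emb x (card S - m))"
          proof (cases "m = 0")
            \<comment> \<open>Here \<open>n = 1\<close>: once \<open>a\<close> is joined to a cycle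
              its length is at least 2, so these terms contribute nothing.\<close>
            case True
            have "rooted_weight S x b 0 q = 0" if "q permutes S" for q
            proof -
              have "permutation q"
                using that S(2) by (auto simp: permutation_permutes)
              then have "0 < card (orbit q b)"
                by (rule orbit_parametrization(4))
              then show ?thesis
                by (simp add: rooted_weight_def)
            qed
            then show ?thesis
              using True by simp
          next
            case False
            then show ?thesis
              using GS b n m cA by (simp add: G_def)
          qed
        qed simp
        also have "\<dots> = (if n = 1 then 0 else of_nat (fact (card S)) * hom_sym emb x (card A - n))"
        proof (cases "m = 0")
          case False
          then have "0 < card S"
            using n m cA by auto
          then have "of_nat (card S) * of_nat (fact (card S - 1)) = (of_nat (fact (card S)) :: 'a)"
            by (simp add: fact_reduce flip: of_nat_mult)
          then show ?thesis
            using False by (simp add: m cA flip: mult.assoc)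
        qed (simp add: m)
        finally show ?thesis .
      qed
      finally show ?thesis
        by (simp add: cA)
    qed
    have "(\<Sum>g\<in>{g. g permutes A}. cyc_weight A x g) = of_nat (fact (card A)) * hom_sym emb x (card A)"
    proof (cases "A = {}")
      case True
      then show ?thesis
        by (simp add: cyc_weight_def family_weight_def)
    next
      case False
      then obtain a where a: "a \<in> A"
        by auto
      then have c: "0 < card A"
        using less.prems by (auto simp: card_gt_0_iff)
      have "cyc_weight A x g = (\<Sum>n\<in>{1..card A}. x n * rooted_weight A x a n g)" if g: "g permutes A" for g
      proof -
        have pg: "permutation g"
          using g less.prems by (auto simp: permutation_permutes)
        have "card (orbit g a) \<le> card A"
          by (intro card_mono less.prems permutes_orbit_subset[OF g a])
        then have n: "card (orbit g a) \<in> {1..card A}"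
          using orbit_parametrization(4)[OF pg, of a] by auto
        have "(\<Sum>n\<in>{1..card A}. x n * rooted_weight A x a n g) =
            (\<Sum>n\<in>{1..card A}. if card (orbit g a) = n
               then x n * family_weight x (orbit g ` A - {orbit g a}) else 0)"
          by (intro sum.cong) (auto simp: rooted_weight_def)
        also have "\<dots> = x (card (orbit g a)) * family_weight x (orbit g ` A - {orbit g a})"
          using n by simp
        also have "\<dots> = cyc_weight A x g"
          unfolding cyc_weight_def family_weight_def using a less.prems
          by (intro prod.remove[symmetric]) auto
        finally show ?thesis ..
      qed
      then have "(\<Sum>g\<in>{g. g permutes A}. cyc_weight A x g) =
          (\<Sum>g\<in>{g. g permutes A}. \<Sum>n\<in>{1..card A}. x n * rooted_weight A x a n g)"
        by (intro sum.cong) auto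
      also have "\<dots> = (\<Sum>n\<in>{1..card A}. x n * (\<Sum>g\<in>{g. g permutes A}. rooted_weight A x a n g))"
        by (subst sum.swap) (simp add: sum_distrib_left)
      also have "\<dots> = (\<Sum>n\<in>{1..card A}. of_nat (fact (card A - 1)) * (x n * hom_sym emb x (card A - n)))"
        by (intro sum.cong refl) (simp only: rooted[OF a] mult_ac)
      also have "\<dots> = of_nat (fact (card A - 1)) * (of_nat (card A) * hom_sym emb x (card A))"
        by (simp only: hom_sym_newton sum_distrib_left)
      also have "\<dots> = of_nat (fact (card A)) * hom_sym emb x (card A)"
        using c by (simp add: fact_reduce mult_ac)
      finally show ?thesis .
    qed
    then show ?case
      using rooted by (auto simp: G_def)
  qed
  then show "(\<Sum>g\<in>{g. g permutes A}. cyc_weight A x g) = of_nat (fact (card A)) * hom_sym emb x (card A)"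
    "\<And>a n. a \<in> A \<Longrightarrow> n \<in> {1..card A} \<Longrightarrow>
      (\<Sum>g\<in>{g. g permutes A}. rooted_weight A x a n g) = of_nat (fact (card A - 1)) * hom_sym emb x (card A - n)"
    by (auto simp: G_def)
qed

section \<open>The coefficients of the generating function\<close>

lemma rat_algebra_Const: "rat_algebra Const"
  by unfold_locales (simp_all add: Const_def single_add mult_single)

lemma rat_algebra_zConst: "rat_algebra zConst"
  by unfold_locales (simp_all add: zConst_def rat_algebra.emb_1[OF rat_algebra_Const]
      rat_algebra.emb_add[OF rat_algebra_Const] rat_algebra.emb_mult[OF rat_algebra_Const]
      flip: fls_plus_const)

interpretation C: rat_algebra Const
  by (rule rat_algebra_Const)

interpretation Z: rat_algebra zConst
  by (rule rat_algebra_zConst)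

lemma prod_mset_cycle_type: "(\<Prod>i\<in>#cycle_type A g. Q i) = cyc_weight A Q g"
  by (simp add: cycle_type_def cyc_weight_def family_weight_def image_mset.compositionality comp_def
      prod_unfold_prod_mset)

lemma cycle_type_in_partitions:
  assumes "g permutes A" "finite A"
  shows "cycle_type A g \<in> partitions (card A)"
proof -
  have g: "permutation g"
    using assms by (auto simp: permutation_permutes)
  have "0 \<notin> card ` orbit g ` A"
    using card_orbit_pos[OF g, of _ A] by force
  then show ?thesis
    using card_orbits[OF assms] assms(2)
    by (simp add: partitions_def cycle_type_def sum_unfold_sum_mset)
qed

lemma cyc_weight_inv:
  assumes "g permutes A" "finite A"
  shows "cyc_weight A Q (inv g) = cyc_weight A Q g"
proof -
  have "permutation g"
    using assms by (auto simp: permutation_permutes)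
  then show ?thesis
    by (simp add: cyc_weight_def orbit_inv_eq)
qed

lemma cyc_weight_mult:
  "cyc_weight A (\<lambda>n. P n * Q n) g = cyc_weight A P g * cyc_weight A Q g"
  by (simp add: cyc_weight_def family_weight_def prod.distrib)

text \<open>Collects the monodromy weights over one end point when the monodromy over the other is
  fixed and \<open>b\<close> simple branch points lie between them.\<close>

fun hurwitz_weight :: "nat \<Rightarrow> (nat \<Rightarrow> 'a::comm_ring_1) \<Rightarrow> nat \<Rightarrow> (nat \<Rightarrow> nat) \<Rightarrow> 'a" where
  "hurwitz_weight d Q 0 g = cyc_weight {1..d} Q g"
| "hurwitz_weight d Q (Suc b) g = (\<Sum>t\<in>transpositions d. hurwitz_weight d Q b (t \<circ> g))"

lemma transpositions_permutes: "t \<in> transpositions d \<Longrightarrow> t permutes {1..d}"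
  by (auto simp: transpositions_def intro!: permutes_swap_id)

lemma finite_listset: "(\<And>A. A \<in> set As \<Longrightarrow> finite A) \<Longrightarrow> finite (listset As)"
  by (induction As) (auto simp: set_Cons_def intro!: finite_image_set2)

lemma sum_set_Cons: "(\<Sum>xs\<in>set_Cons A B. f xs) = (\<Sum>x\<in>A. \<Sum>xs\<in>B. f (x # xs))"
proof -
  have "set_Cons A B = (\<lambda>(x, xs). x # xs) ` (A \<times> B)"
    by (auto simp: set_Cons_def)
  moreover have "inj_on (\<lambda>(x, xs). x # xs) (A \<times> B)"
    by (auto simp: inj_on_def)
  ultimately show ?thesis
    by (simp add: sum.reindex sum.cartesian_product case_prod_unfold comp_def)
qed

definition comp_list :: "('a \<Rightarrow> 'a) list \<Rightarrow> 'a \<Rightarrow> 'a" where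
  "comp_list gs = foldr (\<circ>) gs id"

lemma comp_list_simps [simp]: "comp_list [] = id" "comp_list (g # gs) = g \<circ> comp_list gs"
  by (simp_all add: comp_list_def)

lemma comp_list_transpositions_permutes:
  "ts \<in> listset (replicate b (transpositions d)) \<Longrightarrow> comp_list ts permutes {1..d}"
proof (induction b arbitrary: ts)
  case 0
  then have "ts = []"
    by simp
  then show ?case
    by (simp only: comp_list_simps permutes_id)
next
  case (Suc b)
  then obtain t ts' where "ts = t # ts'" "t \<in> transpositions d"
    "ts' \<in> listset (replicate b (transpositions d))"
    by (auto simp: set_Cons_def)
  then show ?case
    by (simp only: comp_list_simps permutes_compose[OF Suc.IH transpositions_permutes])
qed

text \<open>Inversion reverses the product and fixes each transposition, so the head of the list
  becomes the factor next to \<open>g\<close>, as in the recursion of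
  \<open>hurwitz_weight\<close>.\<close>

lemma sum_hurwitz_weight:
  assumes "g permutes {1..d}"
  shows "(\<Sum>ts\<in>listset (replicate b (transpositions d)). cyc_weight {1..d} Q (inv (comp_list ts) \<circ> g)) =
    hurwitz_weight d Q b g"
  using assms
proof (induction b arbitrary: g)
  case (Suc b)
  have inv_eq: "inv (comp_list (t # ts)) \<circ> g = inv (comp_list ts) \<circ> (t \<circ> g)"
    if t: "t \<in> transpositions d" and ts: "ts \<in> listset (replicate b (transpositions d))" for t ts
  proof -
    have "inv t = t"
      using t by (auto simp: transpositions_def)
    moreover have "inv (t \<circ> comp_list ts) = inv (comp_list ts) \<circ> inv t"
      using permutes_bij[OF transpositions_permutes[OF t]]
        permutes_bij[OF comp_list_transpositions_permutes[OF ts]] by (rule o_inv_distrib)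
    ultimately show ?thesis
      by (simp add: comp_assoc)
  qed
  have "(\<Sum>ts\<in>listset (replicate (Suc b) (transpositions d)). cyc_weight {1..d} Q (inv (comp_list ts) \<circ> g)) =
      (\<Sum>t\<in>transpositions d. \<Sum>ts\<in>listset (replicate b (transpositions d)).
        cyc_weight {1..d} Q (inv (comp_list (t # ts)) \<circ> g))"
    by (simp add: sum_set_Cons)
  also have "\<dots> = (\<Sum>t\<in>transpositions d. \<Sum>ts\<in>listset (replicate b (transpositions d)).
        cyc_weight {1..d} Q (inv (comp_list ts) \<circ> (t \<circ> g)))"
    by (intro sum.cong refl arg_cong[where f = "cyc_weight {1..d} Q"] inv_eq)
  also have "\<dots> = (\<Sum>t\<in>transpositions d. hurwitz_weight d Q b (t \<circ> g))"
    using Suc.prems by (intro sum.cong refl Suc.IH permutes_compose[OF _ transpositions_permutes])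
  finally show ?case
    by (simp only: hurwitz_weight.simps)
qed simp

lemma sum_permutes_inv: "(\<Sum>g\<in>{g. g permutes A}. f (inv g)) = (\<Sum>g\<in>{g. g permutes A}. f g)"
  by (rule sum.reindex_bij_witness[of _ inv inv]) (auto simp: permutes_inv permutes_inv_inv)

text \<open>The relation determines the first permutation from the others, leaving a free choice of
  the second one and of the transpositions. Replacing the second one by its inverse, which has the
  same cycle weight, gives the stated form.\<close>

lemma sum_monodromy:
  fixes P P' :: "nat \<Rightarrow> 'a::comm_ring_1" and d b :: nat
  defines "S \<equiv> {g. g permutes {1..d}}" and "T \<equiv> listset (replicate b (transpositions d))"
  shows "(\<Sum>gs\<in>{gs \<in> listset (S # S # replicate b (transpositions d)). comp_list gs = id}.
      cyc_weight {1..d} P (gs ! 0) * cyc_weight {1..d} P' (gs ! 1)) =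
    (\<Sum>g\<in>S. hurwitz_weight d P b g * cyc_weight {1..d} P' g)"
proof -
  have TS: "comp_list ts \<in> S" if "ts \<in> T" for ts
    using comp_list_transpositions_permutes that by (auto simp: T_def S_def)
  have bij: "bij g" if "g \<in> S" for g
    using that permutes_bij by (auto simp: S_def)
  have "(\<Sum>gs\<in>{gs \<in> listset (S # S # replicate b (transpositions d)). comp_list gs = id}.
      cyc_weight {1..d} P (gs ! 0) * cyc_weight {1..d} P' (gs ! 1)) =
    (\<Sum>(g, ts)\<in>S \<times> T. cyc_weight {1..d} P (inv (g \<circ> comp_list ts)) * cyc_weight {1..d} P' g)"
  proof (rule sum.reindex_bij_witness[of _ "\<lambda>(g, ts). inv (g \<circ> comp_list ts) # g # ts"
        "\<lambda>gs. (gs ! 1, drop 2 gs)"]; clarsimp simp: set_Cons_def simp flip: T_def)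
    fix g1 g2 ts
    assume *: "g1 \<in> S" "g2 \<in> S" "ts \<in> T" "g1 \<circ> (g2 \<circ> comp_list ts) = id"
    have "bij (g2 \<circ> comp_list ts)"
      using * TS bij by (simp add: bij_comp)
    then show "inv (g2 \<circ> comp_list ts) = g1"
      using *(4) by (metis bij_is_surj comp_assoc comp_id id_comp surj_iff)
    then show "cyc_weight {Suc 0..d} P (inv (g2 \<circ> comp_list ts)) * cyc_weight {Suc 0..d} P' g2 =
        cyc_weight {Suc 0..d} P g1 * cyc_weight {Suc 0..d} P' g2"
      by simp
  next
    fix g ts assume *: "g \<in> S" "ts \<in> T"
    then have p: "g \<circ> comp_list ts permutes {1..d}"
      using TS[of ts] by (auto simp: S_def intro: permutes_compose)
    then have "inv (g \<circ> comp_list ts) \<circ> (g \<circ> comp_list ts) = id"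
      by (rule permutes_inv_o(2))
    then show "inv (g \<circ> comp_list ts) \<in> S \<and> inv (g \<circ> comp_list ts) \<circ> (g \<circ> comp_list ts) = id"
      using permutes_inv[OF p] by (simp add: S_def)
  qed
  also have "\<dots> = (\<Sum>g\<in>S. \<Sum>ts\<in>T. cyc_weight {1..d} P (inv (g \<circ> comp_list ts)) * cyc_weight {1..d} P' g)"
    by (simp add: sum.cartesian_product)
  also have "\<dots> = (\<Sum>g\<in>S. hurwitz_weight d P b (inv g) * cyc_weight {1..d} P' (inv g))"
  proof (intro sum.cong refl)
    fix g assume g: "g \<in> S"
    have "inv (g \<circ> comp_list ts) = inv (comp_list ts) \<circ> inv g" if "ts \<in> T" for ts
      using g TS[OF that] bij by (intro o_inv_distrib)
    then have "(\<Sum>ts\<in>T. cyc_weight {1..d} P (inv (g \<circ> comp_list ts))) = hurwitz_weight d P b (inv g)"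
      using g sum_hurwitz_weight[OF permutes_inv, where Q = P] by (simp add: S_def T_def)
    then show "(\<Sum>ts\<in>T. cyc_weight {1..d} P (inv (g \<circ> comp_list ts)) * cyc_weight {1..d} P' g) =
        hurwitz_weight d P b (inv g) * cyc_weight {1..d} P' (inv g)"
      using g cyc_weight_inv[of g "{1..d}" P'] by (simp add: S_def flip: sum_distrib_right)
  qed
  also have "\<dots> = (\<Sum>g\<in>S. hurwitz_weight d P b g * cyc_weight {1..d} P' g)"
    unfolding S_def by (rule sum_permutes_inv)
  finally show ?thesis .
qed

lemma tau_nth:
  "fps_nth (fps_nth (tau P P') d) b = zConst (1 / (fact d * fact b)) *
     (\<Sum>g\<in>{g. g permutes {1..d}}. hurwitz_weight d P b g * cyc_weight {1..d} P' g)"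
proof -
  define S where "S = {g. g permutes {1..d}}"
  define M where "M = {gs \<in> listset (S # S # replicate b (transpositions d)). foldr (\<circ>) gs id = id}"
  \<comment> \<open>The fibre of \<open>ct\<close> over \<open>(\<mu>, \<nu>)\<close> is the set of
    tuples counted by \<open>Cov\<close>; the double sum over partitions thus becomes a sum over all
    tuples.\<close>
  define ct where "ct gs = (cycle_type {1..d} (gs ! 0), cycle_type {1..d} (gs ! 1))" for gs
  define W where "W \<mu> Q = (\<Prod>i\<in>#\<mu>. Q i)" for \<mu> and Q :: "nat \<Rightarrow> zseries"
  have M: "finite M"
  proof (rule finite_subset)
    show "M \<subseteq> listset (S # S # replicate b (transpositions d))"
      by (auto simp: M_def)
    show "finite (listset (S # S # replicate b (transpositions d)))"
      by (rule finite_listset) (auto simp: S_def finite_permutations finite_transpositions)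
  qed
  have ctM: "ct ` M \<subseteq> partitions d \<times> partitions d"
    using cycle_type_in_partitions[of _ "{1..d}"] by (auto simp: M_def ct_def set_Cons_def S_def)
  have cov: "zConst (Cov d (conj_class d \<mu> # conj_class d \<nu> # replicate b (transpositions d)) / fact b)
         * W \<mu> P * W \<nu> P' = zConst (1 / (fact d * fact b)) *
         (\<Sum>gs\<in>{gs \<in> M. ct gs = (\<mu>, \<nu>)}. W (fst (ct gs)) P * W (snd (ct gs)) P')" for \<mu> \<nu>
  proof -
    have "{gs \<in> listset (conj_class d \<mu> # conj_class d \<nu> # replicate b (transpositions d)).
        foldr (\<circ>) gs id = id} = {gs \<in> M. ct gs = (\<mu>, \<nu>)}"
      by (auto simp: M_def ct_def set_Cons_def S_def conj_class_def)
    then have "Cov d (conj_class d \<mu> # conj_class d \<nu> # replicate b (transpositions d)) / fact b =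
        1 / (fact d * fact b) * of_nat (card {gs \<in> M. ct gs = (\<mu>, \<nu>)})"
      by (simp add: Cov_def)
    then show ?thesis
      by (simp only: Z.emb_mult Z.emb_of_nat) (simp add: mult.assoc)
  qed
  have "fps_nth (fps_nth (tau P P') d) b =
    (\<Sum>p\<in>partitions d \<times> partitions d. zConst (1 / (fact d * fact b)) *
         (\<Sum>gs\<in>{gs \<in> M. ct gs = p}. W (fst (ct gs)) P * W (snd (ct gs)) P'))"
    by (simp add: tau_def sum.cartesian_product case_prod_unfold W_def[symmetric] cov)
  also have "\<dots> = zConst (1 / (fact d * fact b)) * (\<Sum>gs\<in>M. W (fst (ct gs)) P * W (snd (ct gs)) P')"
    by (subst sum.group[OF M _ ctM, symmetric])
      (simp_all add: finite_partitions sum_distrib_left)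
  also have "(\<Sum>gs\<in>M. W (fst (ct gs)) P * W (snd (ct gs)) P') =
      (\<Sum>g\<in>S. hurwitz_weight d P b g * cyc_weight {1..d} P' g)"
    unfolding M_def S_def W_def ct_def prod_mset_cycle_type fst_conv snd_conv
    by (rule sum_monodromy[unfolded comp_list_def])
  finally show ?thesis
    by (simp add: S_def)
qed

text \<open>Without transpositions both cycle weights are taken at the same permutation and multiply
  to the weight for \<open>P n * P' n\<close>; the cycle index formula applies.\<close>

lemma tau_nth_0: "fps_nth (fps_nth (tau P P') d) 0 = hom_sym zConst (\<lambda>n. P n * P' n) d"
proof -
  have "(\<Sum>g\<in>{g. g permutes {1..d}}. hurwitz_weight d P 0 g * cyc_weight {1..d} P' g) =
      of_nat (fact d) * hom_sym zConst (\<lambda>n. P n * P' n) d"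
    using Z.sum_cyc_weight(1)[of "{1..d}" "\<lambda>n. P n * P' n"] by (simp add: cyc_weight_mult)
  then show ?thesis
    using Z.of_nat_mult_emb_inverse[of "fact d"] by (simp add: tau_nth mult_ac flip: mult.assoc)
qed

section \<open>Linearity of the cut-and-join operator and its iteration\<close>

lemma cutjoin_add:
  assumes "\<And>n. derivation (\<delta> n)"
  shows "cutjoin N a \<delta> (f + g) = cutjoin N a \<delta> f + cutjoin N a \<delta> g"
  by (simp add: cutjoin_def derivation_simps[OF assms] case_prod_unfold algebra_simps sum.distrib)

lemma cutjoin_0:
  assumes "\<And>n. derivation (\<delta> n)"
  shows "cutjoin N a \<delta> 0 = 0"
  by (simp add: cutjoin_def derivation_simps[OF assms] case_prod_unfold)

lemma cutjoin_sum:
  assumes "\<And>n. derivation (\<delta> n)"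
  shows "cutjoin N a \<delta> (\<Sum>x\<in>A. f x) = (\<Sum>x\<in>A. cutjoin N a \<delta> (f x))"
  by (induction A rule: infinite_finite_induct) (simp_all add: cutjoin_0 cutjoin_add assms)

lemma cutjoin_scale:
  assumes "\<And>n. derivation (\<delta> n)" "\<And>n. \<delta> n c = 0"
  shows "cutjoin N a \<delta> (c * f) = c * cutjoin N a \<delta> f"
  by (simp add: cutjoin_def derivation_simps[OF assms(1)] assms(2) case_prod_unfold
      sum_distrib_left algebra_simps)

text \<open>The operator acts by the outermost transposition, whereas the recursion peels off the
  one next to \<open>g\<close>; since the operator is additive it passes through the sum over the
  latter.\<close>

lemma hurwitz_weight_Suc:
  assumes g: "g permutes {1..d}" and "d \<le> N" and \<delta>: "dual_derivations \<delta> Q"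
  shows "2 * hurwitz_weight d Q (Suc b) g = cutjoin N Q \<delta> (hurwitz_weight d Q b g)"
  using g
proof (induction b arbitrary: g)
  case 0
  have "2 * hurwitz_weight d Q (Suc 0) g = (\<Sum>t\<in>transpositions d. 2 * cyc_weight {1..d} Q (t \<circ> g))"
    by (simp add: sum_distrib_left)
  also have "\<dots> = cutjoin N Q \<delta> (cyc_weight {1..d} Q g)"
    unfolding sum_transpositions[symmetric]
    by (rule sum_transpose_cyc_weight[OF 0 _ _ \<delta>]) (use assms(2) in auto)
  finally show ?case
    by simp
next
  case (Suc b)
  have D: "derivation (\<delta> n)" for n
    using \<delta> by (simp add: dual_derivations_def)
  have "2 * hurwitz_weight d Q (Suc (Suc b)) g =
      (\<Sum>t\<in>transpositions d. 2 * hurwitz_weight d Q (Suc b) (t \<circ> g))"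
    by (simp only: hurwitz_weight.simps(2)[of d Q "Suc b"] sum_distrib_left)
  also have "\<dots> = (\<Sum>t\<in>transpositions d. cutjoin N Q \<delta> (hurwitz_weight d Q b (t \<circ> g)))"
    using Suc.prems by (intro sum.cong refl Suc.IH permutes_compose[OF _ transpositions_permutes])
  finally show ?case
    by (simp add: cutjoin_sum[where \<delta> = \<delta>, OF D])
qed

section \<open>Commutation of the cut-and-join operator with vertex operators\<close>

lemma sum_index_pairs:
  "(\<Sum>(i, j)\<in>index_pairs N. g i j) = (\<Sum>n\<in>{1..N}. \<Sum>i\<in>{1..<n}. g i (n - i))"
proof -
  have "(\<Sum>n\<in>{1..N}. \<Sum>i\<in>{1..<n}. g i (n - i)) =
      (\<Sum>(n, i)\<in>(SIGMA n:{1..N}. {1..<n}). g i (n - i))"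
    by (simp add: sum.Sigma)
  also have "\<dots> = (\<Sum>(i, j)\<in>index_pairs N. g i j)"
    by (rule sum.reindex_bij_witness[of _ "\<lambda>(i, j). (i + j, i)" "\<lambda>(n, i). (i, n - i)"])
      (auto simp: index_pairs_def)
  finally show ?thesis ..
qed

text \<open>A number \<open>n\<close> is a sum of two positive numbers in \<open>n - 1\<close>
  ordered ways.\<close>

lemma sum_index_pairs_add:
  fixes g :: "nat \<Rightarrow> 'a::comm_ring_1"
  shows "(\<Sum>(i, j)\<in>index_pairs N. g (i + j)) = (\<Sum>n\<in>{1..N}. of_nat n * g n) - (\<Sum>n\<in>{1..N}. g n)"
proof -
  have "(\<Sum>(i, j)\<in>index_pairs N. g (i + j)) = (\<Sum>n\<in>{1..N}. of_nat n * g n - g n)"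
    unfolding sum_index_pairs by (intro sum.cong) (auto simp: of_nat_diff algebra_simps)
  then show ?thesis
    by (simp add: sum_subtractf)
qed

lemma sum_index_pairs_swap: "(\<Sum>(i, j)\<in>index_pairs N. g i j) = (\<Sum>(i, j)\<in>index_pairs N. g j i)"
  by (rule sum.reindex_bij_witness[of _ prod.swap prod.swap]) (auto simp: index_pairs_def)

text \<open>Off the diagonal the square is parametrized by the difference of the indices. This suits
  products in which \<open>z^(-x)\<close> meets \<open>z^y\<close>.\<close>

lemma sum_square_index_pairs:
  "(\<Sum>x\<in>{1..N}. \<Sum>y\<in>{1..N}. g x y) = (\<Sum>x\<in>{1..N}. g x x) +
     (\<Sum>(i, j)\<in>index_pairs N. g (i + j) j) + (\<Sum>(i, j)\<in>index_pairs N. g i (i + j))"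
proof -
  let ?D = "{(x, y). x = y \<and> x \<in> {1..N}}" and ?U = "{(x, y). y < x \<and> x \<in> {1..N} \<and> y \<in> {1..N}}"
    and ?L = "{(x, y). x < y \<and> x \<in> {1..N} \<and> y \<in> {1..N}}"
  have fin: "finite ?D" "finite ?U" "finite ?L"
    by (rule finite_subset[of _ "{1..N} \<times> {1..N}"]; auto)+
  have "(\<Sum>x\<in>{1..N}. \<Sum>y\<in>{1..N}. g x y) = (\<Sum>(x, y)\<in>{1..N} \<times> {1..N}. g x y)"
    by (simp add: sum.cartesian_product)
  also have "{1..N} \<times> {1..N} = (?D \<union> ?U) \<union> ?L"
    by auto
  also have "(\<Sum>(x, y)\<in>(?D \<union> ?U) \<union> ?L. g x y) =
      (\<Sum>(x, y)\<in>?D. g x y) + (\<Sum>(x, y)\<in>?U. g x y) + (\<Sum>(x, y)\<in>?L. g x y)"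
    using fin by (subst sum.union_disjoint; (subst sum.union_disjoint)?) auto
  also have "(\<Sum>(x, y)\<in>?D. g x y) = (\<Sum>x\<in>{1..N}. g x x)"
    by (rule sum.reindex_bij_witness[of _ "\<lambda>x. (x, x)" fst]) auto
  also have "(\<Sum>(x, y)\<in>?U. g x y) = (\<Sum>(i, j)\<in>index_pairs N. g (i + j) j)"
    by (rule sum.reindex_bij_witness[of _ "\<lambda>(i, j). (i + j, j)" "\<lambda>(x, y). (x - y, y)"])
      (auto simp: index_pairs_def)
  also have "(\<Sum>(x, y)\<in>?L. g x y) = (\<Sum>(i, j)\<in>index_pairs N. g i (i + j))"
    by (rule sum.reindex_bij_witness[of _ "\<lambda>(i, j). (i, i + j)" "\<lambda>(x, y). (x, y - x)"])
      (auto simp: index_pairs_def)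
  finally show ?thesis .
qed

text \<open>The pairs with \<open>i + j > N\<close>, which a square of truncated sums contains but
  the truncated operator misses.\<close>

definition index_rest :: "nat \<Rightarrow> (nat \<times> nat) set" where
  "index_rest N = {1..N} \<times> {1..N} - index_pairs N"

lemma sum_square_split:
  "(\<Sum>x\<in>{1..N}. \<Sum>y\<in>{1..N}. g x y) =
     (\<Sum>(i, j)\<in>index_pairs N. g i j) + (\<Sum>(i, j)\<in>index_rest N. g i j)"
proof -
  have "index_pairs N \<subseteq> {1..N} \<times> {1..N}"
    by (auto simp: index_pairs_def)
  then show ?thesis
    unfolding index_rest_def sum.cartesian_product
    by (subst sum.subset_diff[of "index_pairs N"]) (auto simp: add.commute)
qed

text \<open>In the next lemma \<open>e\<close> stands for \<open>exp(s \<Sum>\<^sub>n a\<^sub>n / (n z\<^sup>n))\<close> and \<open>f\<close> for a function of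
  \<open>a\<^sub>n - s z\<^sup>n\<close>, \<open>n = 1, 2, \<dots>\<close>; \<open>\<theta>\<close> is \<open>z d/dz\<close> and \<open>Z k\<close> is \<open>z\<^sup>k\<close>.
  The last sum is the effect of truncating the cut-and-join operator.\<close>

lemma cutjoin_vertex:
  fixes a :: "nat \<Rightarrow> 'a::comm_ring_1" and Z :: "int \<Rightarrow> 'a" and e f m s :: 'a
  assumes D: "\<And>n. derivation (\<delta> n)" and T: "derivation \<theta>"
    and comm: "\<And>n. \<theta> (\<delta> n f) = \<delta> n (\<theta> f)"
    and Z0: "Z 0 = 1" and Zadd: "\<And>i j. Z (i + j) = Z i * Z j"
    and DZ: "\<And>n k. \<delta> n (Z k) = 0" and TZ: "\<And>k. \<theta> (Z k) = of_int k * Z k"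
    and Ta: "\<And>n. \<theta> (a n) = 0"
    and s: "s = 1 \<or> s = - 1"
    and De: "\<And>n. n \<in> {1..N} \<Longrightarrow> \<delta> n e = s * Z (- int n) * e"
    and Te: "\<theta> e = - s * (\<Sum>n\<in>{1..N}. a n * Z (- int n)) * e"
    and Tf: "\<theta> f = - s * (\<Sum>n\<in>{1..N}. Z (int n) * \<delta> n f)"
    and DDf: "\<And>i j. (i, j) \<in> index_rest N \<Longrightarrow> \<delta> i (\<delta> j f) = 0"
  defines "a' \<equiv> \<lambda>n. a n - s * Z (int n)"
  shows "cutjoin N a \<delta> (e * f) + 2 * (m + s) * euler N a \<delta> (e * f)
      - e * (cutjoin N a' \<delta> f + 2 * m * euler N a' \<delta> f) =
    s * \<theta> (\<theta> (e * f)) - (2 * m + s) * \<theta> (e * f)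
      - s * (\<Sum>(i, j)\<in>index_rest N. a i * a j * Z (- int i - int j)) * (e * f)"
proof -
  define c where "c n = \<delta> n f" for n
  define cc where "cc i j = \<delta> i (\<delta> j f)" for i j
  \<comment> \<open>With these sums, \<open>\<theta> e = - s * \<alpha> * e\<close> and
    \<open>\<theta> f = - s * p\<close>. \<open>A1\<close> is the part \<open>i + j \<le> N\<close>
    of \<open>\<alpha> * \<alpha>\<close>, while \<open>\<epsilon>\<close>, \<open>u\<close> and
    \<open>t\<close> are the parts of \<open>\<alpha> * p\<close> on and off the diagonal.\<close>
  define \<alpha> where "\<alpha> = (\<Sum>n\<in>{1..N}. a n * Z (- int n))"
  define \<alpha>' where "\<alpha>' = (\<Sum>n\<in>{1..N}. of_nat n * (a n * Z (- int n)))"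
  define p where "p = (\<Sum>n\<in>{1..N}. Z (int n) * c n)"
  define p' where "p' = (\<Sum>n\<in>{1..N}. of_nat n * (Z (int n) * c n))"
  define \<epsilon> where "\<epsilon> = (\<Sum>n\<in>{1..N}. a n * c n)"
  define A1 where "A1 = (\<Sum>(i, j)\<in>index_pairs N. a i * a j * Z (- int i - int j))"
  define err where "err = (\<Sum>(i, j)\<in>index_rest N. a i * a j * Z (- int i - int j))"
  define t where "t = (\<Sum>(i, j)\<in>index_pairs N. a (i + j) * Z (- int i) * c j)"
  define u where "u = (\<Sum>(i, j)\<in>index_pairs N. a i * Z (int j) * c (i + j))"
  define A4 where "A4 = (\<Sum>(i, j)\<in>index_pairs N. Z (int i) * Z (int j) * cc i j)"
  have ss: "s * s = 1" and Ds: "\<delta> n s = 0" and Ts: "\<theta> s = 0" for n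
    using s by (auto simp: derivation_simps[OF D] derivation_simps[OF T])
  have Zsub: "Z (- int i - int j) = Z (- int i) * Z (- int j)" for i j
    using Zadd[of "- int i" "- int j"] by simp
  have Zinv: "Z (- int i) * Z (int i) = 1" for i
    using Zadd[of "- int i" "int i"] Z0 by simp
  have D1: "\<delta> n (e * f) = e * (s * Z (- int n) * f + c n)" if "n \<in> {1..N}" for n
    using that by (simp add: derivation_mult[OF D] De c_def algebra_simps)
  have D2: "\<delta> i (\<delta> j (e * f)) = e * (Z (- int i - int j) * f + s * (Z (- int j) * c i + Z (- int i) * c j) + cc i j)"
    if "i \<in> {1..N}" "j \<in> {1..N}" for i j
  proof -
    have "\<delta> i (\<delta> j (e * f)) = (s * s) * (Z (- int i) * Z (- int j)) * (e * f) +
        s * Z (- int j) * (e * c i) + s * Z (- int i) * (e * c j) + e * cc i j"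
      using that
      by (simp add: D1 derivation_simps[OF D] De DZ Ds c_def cc_def algebra_simps)
    then show ?thesis
      unfolding ss Zsub by (simp add: algebra_simps)
  qed
  have pair: "i \<in> {1..N}" "j \<in> {1..N}" "i + j \<in> {1..N}" if "(i, j) \<in> index_pairs N" for i j
    using that by (auto simp: index_pairs_def)
  have "cutjoin N a \<delta> (e * f) - e * cutjoin N a' \<delta> f =
    (\<Sum>(i, j)\<in>index_pairs N. e * (s * f * (a i * a j * Z (- int i - int j)) +
       f * (a (i + j) * Z (- int (i + j))) +
       s * (a (i + j) * Z (- int i) * c j) + s * (a (i + j) * Z (- int j) * c i) +
       s * (a i * Z (int j) * c (i + j)) + s * (a j * Z (int i) * c (j + i)) -
       Z (int (i + j)) * c (i + j) + s * (Z (int i) * Z (int j) * cc i j)))"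
    unfolding cutjoin_def sum_distrib_left sum_subtractf[symmetric]
  proof (intro sum.cong refl, clarify)
    fix i j assume "(i, j) \<in> index_pairs N"
    note ij = pair[OF this]
    have Zs: "Z (int (i + j)) = Z (int i) * Z (int j)" "Z (- int (i + j)) = Z (- int i - int j)"
      using Zadd[of "int i" "int j"] by simp_all
    have expand: "(a i - s * Z (int i)) * (a j - s * Z (int j)) =
        a i * a j - s * (a i * Z (int j)) - s * (a j * Z (int i)) + (s * s) * (Z (int i) * Z (int j))"
      by (simp add: algebra_simps)
    show "a i * a j * \<delta> (i + j) (e * f) + a (i + j) * \<delta> i (\<delta> j (e * f)) -
        e * (a' i * a' j * \<delta> (i + j) f + a' (i + j) * \<delta> i (\<delta> j f)) =
      e * (s * f * (a i * a j * Z (- int i - int j)) +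
       f * (a (i + j) * Z (- int (i + j))) +
       s * (a (i + j) * Z (- int i) * c j) + s * (a (i + j) * Z (- int j) * c i) +
       s * (a i * Z (int j) * c (i + j)) + s * (a j * Z (int i) * c (j + i)) -
       Z (int (i + j)) * c (i + j) + s * (Z (int i) * Z (int j) * cc i j))"
      unfolding D1[OF ij(3)] D2[OF ij(1,2)] a'_def expand ss Zs cc_def[symmetric] add.commute[of j i]
      unfolding c_def[symmetric]
      by (simp add: algebra_simps)
  qed
  also have "\<dots> = e * (s * f * A1 + f * (\<alpha>' - \<alpha>) + s * t + s * t + s * u + s * u - (p' - p) + s * A4)"
  proof -
    have sums: "(\<Sum>(i, j)\<in>index_pairs N. a (i + j) * Z (- int (i + j))) = \<alpha>' - \<alpha>"
      "(\<Sum>(i, j)\<in>index_pairs N. Z (int (i + j)) * c (i + j)) = p' - p"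
      "(\<Sum>(i, j)\<in>index_pairs N. a (i + j) * Z (- int j) * c i) = t"
      "(\<Sum>(i, j)\<in>index_pairs N. a j * Z (int i) * c (j + i)) = u"
      using sum_index_pairs_add[of "\<lambda>n. a n * Z (- int n)" N]
        sum_index_pairs_add[of "\<lambda>n. Z (int n) * c n" N]
        sum_index_pairs_swap[of "\<lambda>i j. a (i + j) * Z (- int j) * c i" N]
        sum_index_pairs_swap[of "\<lambda>i j. a j * Z (int i) * c (j + i)" N]
      by (simp_all only: \<alpha>_def \<alpha>'_def p_def p'_def t_def u_def add.commute)
    show ?thesis
      unfolding sums(1,2)[symmetric] A1_def A4_def
      apply (subst (2) sums(3)[symmetric], subst (2) sums(4)[symmetric])
      unfolding t_def u_def
      by (simp only: case_prod_unfold sum_distrib_left[symmetric] sum.distrib sum_subtractf)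
  qed
  finally have CJ: "cutjoin N a \<delta> (e * f) - e * cutjoin N a' \<delta> f =
    e * (s * f * A1 + f * (\<alpha>' - \<alpha>) + s * t + s * t + s * u + s * u - (p' - p) + s * A4)" .
  have "euler N a \<delta> (e * f) = (\<Sum>n\<in>{1..N}. e * (s * f * (a n * Z (- int n)) + a n * c n))"
    unfolding euler_def by (intro sum.cong refl) (simp only: D1, simp add: algebra_simps)
  then have E1: "euler N a \<delta> (e * f) = e * (s * f * \<alpha> + \<epsilon>)"
    by (simp add: \<alpha>_def \<epsilon>_def sum.distrib flip: sum_distrib_left)
  have "euler N a' \<delta> f = (\<Sum>n\<in>{1..N}. a n * c n - s * (Z (int n) * c n))"
    unfolding euler_def by (intro sum.cong refl) (simp add: a'_def c_def algebra_simps)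
  then have E2: "euler N a' \<delta> f = \<epsilon> - s * p"
    by (simp add: \<epsilon>_def p_def sum_subtractf flip: sum_distrib_left)
  have T\<alpha>: "\<theta> \<alpha> = - \<alpha>'"
    by (simp add: \<alpha>_def \<alpha>'_def derivation_simps[OF T] Ta TZ mult_ac sum_negf)
  have full: "(\<Sum>x\<in>{1..N}. \<Sum>y\<in>{1..N}. Z (int x) * Z (int y) * cc x y) = A4"
    unfolding sum_square_split A4_def
    by (simp add: cc_def DDf case_prod_unfold)
  have "\<theta> p = (\<Sum>n\<in>{1..N}. of_nat n * (Z (int n) * c n) + Z (int n) * \<delta> n (\<theta> f))"
    by (simp add: p_def derivation_simps[OF T] TZ c_def comm algebra_simps)
  also have "\<dots> = (\<Sum>n\<in>{1..N}. of_nat n * (Z (int n) * c n)) +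
      (\<Sum>n\<in>{1..N}. - s * (\<Sum>k\<in>{1..N}. Z (int n) * Z (int k) * cc n k))"
    unfolding Tf
    by (simp add: derivation_simps[OF D] Ds DZ sum.distrib cc_def sum_distrib_left mult_ac sum_negf
        sum_subtractf)
  finally have Tp: "\<theta> p = p' - s * A4"
    by (simp add: p'_def sum_negf flip: full sum_distrib_left)
  have \<alpha>2: "\<alpha> * \<alpha> = A1 + err"
    unfolding \<alpha>_def sum_product sum_square_split A1_def err_def
    by (intro arg_cong2[where f = "(+)"] sum.cong refl) (auto simp: Zsub mult_ac)
  have \<alpha>p: "\<alpha> * p = \<epsilon> + t + u"
  proof -
    have Zmix: "Z (- int (i + j)) * Z (int j) = Z (- int i)" "Z (- int i) * Z (int (i + j)) = Z (int j)" for i j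
      by (simp_all flip: Zadd)
    have "a i * Z (- int i) * (Z (int i) * c i) = (Z (- int i) * Z (int i)) * (a i * c i)" for i
      by (simp add: mult_ac)
    then have 1: "a i * Z (- int i) * (Z (int i) * c i) = a i * c i" for i
      by (simp add: Zinv)
    have "a (i + j) * Z (- int (i + j)) * (Z (int j) * c j) = a (i + j) * (Z (- int (i + j)) * Z (int j)) * c j" for i j
      by (simp only: mult_ac)
    then have 2: "a (i + j) * Z (- int (i + j)) * (Z (int j) * c j) = a (i + j) * Z (- int i) * c j" for i j
      by (simp only: Zmix)
    have "a i * Z (- int i) * (Z (int (i + j)) * c (i + j)) = a i * (Z (- int i) * Z (int (i + j))) * c (i + j)" for i j
      by (simp only: mult_ac)
    then have 3: "a i * Z (- int i) * (Z (int (i + j)) * c (i + j)) = a i * Z (int j) * c (i + j)" for i j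
      by (simp only: Zmix)
    show ?thesis
      unfolding \<alpha>_def p_def sum_product sum_square_index_pairs 1 2 3 \<epsilon>_def t_def u_def ..
  qed
  have Te': "\<theta> e = - (s * \<alpha> * e)" and Tf': "\<theta> f = - (s * p)"
    using Te Tf by (simp_all add: \<alpha>_def p_def c_def)
  have T1: "\<theta> (e * f) = - (s * (e * (\<alpha> * f + p)))"
    by (simp add: derivation_mult[OF T] Te' Tf' algebra_simps)
  have "\<theta> (\<theta> (e * f)) = (s * s) * (e * (\<alpha> * \<alpha> * f + 2 * (\<alpha> * p) + A4)) + s * (e * (\<alpha>' * f - p'))"
    unfolding T1 by (simp add: derivation_simps[OF T] Ts Te' Tf' T\<alpha> Tp algebra_simps)
  then have T2: "\<theta> (\<theta> (e * f)) = e * ((A1 + err) * f + 2 * (\<epsilon> + t + u) + A4) + s * (e * (\<alpha>' * f - p'))"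
    by (simp add: ss \<alpha>2 \<alpha>p)
  have "cutjoin N a \<delta> (e * f) + 2 * (m + s) * euler N a \<delta> (e * f)
      - e * (cutjoin N a' \<delta> f + 2 * m * euler N a' \<delta> f) =
     (cutjoin N a \<delta> (e * f) - e * cutjoin N a' \<delta> f) + 2 * (m + s) * euler N a \<delta> (e * f)
      - 2 * m * e * euler N a' \<delta> f"
    by (simp add: algebra_simps)
  \<comment> \<open>The cut-and-join operator yields the mixed terms \<open>2 * s * (t + u)\<close>,
    but \<open>s * \<theta> (\<theta> (e * f))\<close> contains
    \<open>2 * s * (\<epsilon> + t + u)\<close>. The missing \<open>2 * s * \<epsilon>\<close> is
    supplied by the Euler operators, whose coefficients must therefore differ by
    \<open>s\<close>.\<close>
  also have "\<dots> = s * \<theta> (\<theta> (e * f)) - (2 * m + s) * \<theta> (e * f) - s * err * (e * f)"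
    unfolding CJ E1 E2 T2 unfolding T1 using s by (auto simp: algebra_simps)
  finally show ?thesis
    by (simp add: err_def)
qed

section \<open>Derivations on polynomials and Laurent series\<close>

text \<open>The formal partial derivative. Truncated subtraction in the exponent is harmless: if
  \<open>v\<close> does not occur in \<open>m\<close>, the coefficient is 0.\<close>

definition pd :: "var \<Rightarrow> coeff_ring \<Rightarrow> coeff_ring" where
  "pd v f = (\<Sum>m\<in>Poly_Mapping.keys f. Poly_Mapping.single (m - Poly_Mapping.single v 1)
     (of_nat (Poly_Mapping.lookup m v) * Poly_Mapping.lookup f m))"

lemma pd_superset:
  assumes "finite K" "Poly_Mapping.keys f \<subseteq> K"
  shows "pd v f = (\<Sum>m\<in>K. Poly_Mapping.single (m - Poly_Mapping.single v 1)
     (of_nat (Poly_Mapping.lookup m v) * Poly_Mapping.lookup f m))"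
  unfolding pd_def by (rule sum.mono_neutral_left) (use assms in \<open>auto simp: in_keys_iff\<close>)

lemma pd_add: "pd v (f + g) = pd v f + pd v g"
proof -
  let ?K = "Poly_Mapping.keys f \<union> Poly_Mapping.keys g"
  have "Poly_Mapping.keys (f + g) \<subseteq> ?K"
    by (rule keys_add)
  then show ?thesis
    by (simp add: pd_superset[of ?K] lookup_add distrib_left single_add sum.distrib)
qed

lemma pd_single: "pd v (Poly_Mapping.single m c) =
    Poly_Mapping.single (m - Poly_Mapping.single v 1) (of_nat (Poly_Mapping.lookup m v) * c)"
  by (simp add: pd_superset[of "{m}"])

lemma coeff_ring_induct [case_names zero single add]:
  fixes f :: coeff_ring
  assumes zero: "P 0" and single: "\<And>m c. P (Poly_Mapping.single m c)"
    and add: "\<And>f g. P f \<Longrightarrow> P g \<Longrightarrow> P (f + g)"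
  shows "P f"
proof (induction f rule: update_induct)
  case (update f a b)
  have "Poly_Mapping.update a b f = f + Poly_Mapping.single a b"
    by (rule poly_mapping_eqI)
      (use update.hyps(1) in \<open>auto simp: lookup_update lookup_add lookup_single when_def in_keys_iff\<close>)
  then show ?case
    by (simp add: add single update.IH)
qed (rule zero)

lemma pd_mult_single:
  "pd v (Poly_Mapping.single m c * Poly_Mapping.single n d) =
     pd v (Poly_Mapping.single m c) * Poly_Mapping.single n d +
     Poly_Mapping.single m c * pd v (Poly_Mapping.single n d)"
proof -
  let ?e = "Poly_Mapping.single v (1 :: nat)"
  have shift: "k - ?e + l = k + l - ?e" if "0 < Poly_Mapping.lookup k v" for k l
    using that by (intro poly_mapping_eqI) (auto simp: lookup_add lookup_minus lookup_single when_def)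
  have 1: "Poly_Mapping.single (m - ?e + n) (of_nat (Poly_Mapping.lookup m v) * (c * d)) =
      Poly_Mapping.single (m + n - ?e) (of_nat (Poly_Mapping.lookup m v) * (c * d))"
    using shift[of m n] by (cases "Poly_Mapping.lookup m v = 0") simp_all
  have 2: "Poly_Mapping.single (m + (n - ?e)) (of_nat (Poly_Mapping.lookup n v) * (c * d)) =
      Poly_Mapping.single (m + n - ?e) (of_nat (Poly_Mapping.lookup n v) * (c * d))"
    using shift[of n m] by (cases "Poly_Mapping.lookup n v = 0") (simp_all add: add.commute)
  show ?thesis
    unfolding mult_single pd_single lookup_add
    using 1 2 by (simp add: mult_ac distrib_left single_add)
qed

lemma pd_0: "pd v 0 = 0"
  by (simp add: pd_def)

lemma pd_mult: "pd v (f * g) = pd v f * g + f * pd v g"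
proof (induction f rule: coeff_ring_induct)
  case (single m c)
  show ?case
    by (induction g rule: coeff_ring_induct)
      (simp_all add: pd_mult_single pd_add pd_0 algebra_simps)
qed (simp_all add: pd_add pd_0 algebra_simps)

lemma derivation_pd: "derivation (pd v)"
  by (simp add: derivation_def pd_add pd_mult)

lemma pd_Var: "pd v (Var w) = (if v = w then 1 else 0)"
  by (simp add: Var_def pd_single lookup_single when_def)

lemma pd_Const: "pd v (Const c) = 0"
  by (simp add: Const_def pd_single)

lemma derivation_lincomb:
  assumes "derivation D" "derivation D'"
  shows "derivation (\<lambda>f. c * (D f + c' * D' f))"
  using assms by (auto simp: derivation_def algebra_simps)

text \<open>For \<open>s = 1\<close> and \<open>s = -1\<close>, the variables of the two factors of the bilinear equation are the
  sums and differences \<open>p\<^sub>n + s s\<^sub>n\<close>, and \<open>gen_deriv s n\<close> is \<open>n\<close> times the partial derivative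
  with respect to \<open>p\<^sub>n + s s\<^sub>n\<close>.\<close>

definition gen :: "int \<Rightarrow> nat \<Rightarrow> coeff_ring" where
  "gen s n = Var (VP n) + of_int s * Var (VS n)"

definition gen_deriv :: "int \<Rightarrow> nat \<Rightarrow> coeff_ring \<Rightarrow> coeff_ring" where
  "gen_deriv s n f = Const (of_nat n / 2) * (pd (VP n) f + of_int s * pd (VS n) f)"

lemma derivation_gen_deriv: "derivation (gen_deriv s n)"
  unfolding gen_deriv_def by (rule derivation_lincomb[OF derivation_pd derivation_pd])

lemma gen_deriv_Const: "gen_deriv s n (Const c) = 0"
  by (simp add: gen_deriv_def pd_Const)

lemma gen_deriv_Var':
  "gen_deriv s n (Var (VP' k)) = 0" "gen_deriv s n (Var (VS' k)) = 0"
  by (simp_all add: gen_deriv_def pd_Var)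

text \<open>The bare operator \<open>\<partial>/\<partial>p\<^sub>n + s
  \<partial>/\<partial>s\<^sub>n\<close> maps \<open>p\<^sub>n + s' s\<^sub>n\<close> to
  \<open>1 + s s'\<close>, which is 2 or 0; hence the factor 1/2 in
  \<open>gen_deriv\<close>.\<close>

lemma gen_deriv_gen:
  assumes "s \<in> {1, -1}" "s' \<in> {1, -1}"
  shows "gen_deriv s n (gen s' k) = (if s = s' \<and> k = n then of_nat n else 0)"
proof -
  have "Const (of_nat n / 2) * 2 = of_nat n"
    using C.emb_mult[of "of_nat n / 2" "of_nat 2"] by (simp add: C.emb_of_nat del: of_nat_numeral)
      (simp add: C.emb_of_nat)
  moreover have "pd v (of_int s' * f) = of_int s' * pd v f" for v f
    by (simp add: derivation_simps[OF derivation_pd])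
  ultimately show ?thesis
    using assms by (auto simp: gen_deriv_def gen_def pd_add pd_Var)
qed

text \<open>The operator may depend on the exponent, so that coefficientwise derivations and
  \<open>z d/dz\<close> are instances of one construction.\<close>

definition lift_deriv :: "(int \<Rightarrow> 'a \<Rightarrow> 'a) \<Rightarrow> 'a fls \<Rightarrow> 'a::comm_ring_1 fls" where
  "lift_deriv D F = Abs_fls (\<lambda>k. D k (fls_nth F k))"

lemma lift_deriv_nth:
  assumes "\<And>k. D k 0 = 0"
  shows "fls_nth (lift_deriv D F) k = D k (fls_nth F k)"
  unfolding lift_deriv_def
  by (rule nth_Abs_fls_lower_bound[of "fls_subdegree F"]) (simp add: assms)

lemma fls_times_nth_bounds:
  fixes F G :: "'a::comm_ring_1 fls"
  assumes "A \<le> fls_subdegree F" "B \<le> fls_subdegree G"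
  shows "fls_nth (F * G) n = (\<Sum>i=A..n - B. fls_nth F i * fls_nth G (n - i))"
  unfolding fls_times_nth(2)
  by (rule sum.mono_neutral_left) (use assms in auto)

lemma derivation_lift_deriv:
  assumes add: "\<And>k x y. D k (x + y) = D k x + D k y"
    and mult: "\<And>j k x y. D (j + k) (x * y) = D j x * y + x * D k y"
  shows "derivation (lift_deriv D)"
proof -
  have D0: "D k 0 = 0" for k
    using add[of k 0 0] by simp
  note nth = lift_deriv_nth[of D, OF D0]
  have sum: "D k (sum f S) = (\<Sum>x\<in>S. D k (f x))" for k f and S :: "int set"
    by (induction S rule: infinite_finite_induct) (simp_all add: add D0)
  have sub: "fls_subdegree F \<le> fls_subdegree (lift_deriv D F) \<or> lift_deriv D F = 0" for F
    by (cases "lift_deriv D F = 0") (auto intro!: fls_subdegree_geI simp: nth D0)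
  have "lift_deriv D (F * G) = lift_deriv D F * G + F * lift_deriv D G" for F G
  proof (rule fls_eqI)
    fix n
    \<comment> \<open>A series and its derivative may have different orders; common lower bounds let
      all convolutions run over the same range.\<close>
    define A where "A = min (fls_subdegree F) (fls_subdegree (lift_deriv D F))"
    define B where "B = min (fls_subdegree G) (fls_subdegree (lift_deriv D G))"
    have AB: "A \<le> fls_subdegree F" "A \<le> fls_subdegree (lift_deriv D F)"
      "B \<le> fls_subdegree G" "B \<le> fls_subdegree (lift_deriv D G)"
      by (auto simp: A_def B_def)
    have "fls_nth (lift_deriv D (F * G)) n = (\<Sum>i=A..n - B. D n (fls_nth F i * fls_nth G (n - i)))"
      by (simp add: nth fls_times_nth_bounds[OF AB(1,3)] sum)
    also have "\<dots> = (\<Sum>i=A..n - B. fls_nth (lift_deriv D F) i * fls_nth G (n - i) +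
        fls_nth F i * fls_nth (lift_deriv D G) (n - i))"
      using mult[of i "n - i" for i] by (simp add: nth)
    also have "\<dots> = fls_nth (lift_deriv D F * G + F * lift_deriv D G) n"
      by (simp add: fls_times_nth_bounds[OF AB(2,3)] fls_times_nth_bounds[OF AB(1,4)] sum.distrib)
    finally show "fls_nth (lift_deriv D (F * G)) n = fls_nth (lift_deriv D F * G + F * lift_deriv D G) n" .
  qed
  moreover have "lift_deriv D (F + G) = lift_deriv D F + lift_deriv D G" for F G
    by (rule fls_eqI) (simp add: nth add)
  ultimately show ?thesis
    by (simp add: derivation_def)
qed

definition zgen_deriv :: "int \<Rightarrow> nat \<Rightarrow> zseries \<Rightarrow> zseries" where
  "zgen_deriv s n = lift_deriv (\<lambda>_. gen_deriv s n)"

lemma zgen_deriv_nth: "fls_nth (zgen_deriv s n F) k = gen_deriv s n (fls_nth F k)"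
  unfolding zgen_deriv_def by (rule lift_deriv_nth) (simp add: derivation_0[OF derivation_gen_deriv])

lemma derivation_zgen_deriv: "derivation (zgen_deriv s n)"
  unfolding zgen_deriv_def
  by (rule derivation_lift_deriv) (simp_all add: derivation_simps[OF derivation_gen_deriv])

lemma zgen_deriv_const: "zgen_deriv s n (fls_const c) = fls_const (gen_deriv s n c)"
  by (rule fls_eqI) (simp add: zgen_deriv_nth derivation_0[OF derivation_gen_deriv])

text \<open>Since \<open>fls_X\<close> stands for \<open>z\<^sup>-\<^sup>1\<close>, the derivation \<open>z d/dz\<close> has a minus sign.\<close>

definition z_euler :: "zseries \<Rightarrow> zseries" where
  "z_euler = lift_deriv (\<lambda>k x. - of_int k * x)"

lemma z_euler_nth: "fls_nth (z_euler F) k = - of_int k * fls_nth F k"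
  unfolding z_euler_def by (rule lift_deriv_nth) simp

lemma derivation_z_euler: "derivation z_euler"
  unfolding z_euler_def by (rule derivation_lift_deriv) (simp_all add: algebra_simps)

lemma z_euler_const: "z_euler (fls_const c) = 0"
  by (rule fls_eqI) (simp add: z_euler_nth)

lemma z_euler_zgen_deriv: "z_euler (zgen_deriv s n F) = zgen_deriv s n (z_euler F)"
  by (rule fls_eqI)
    (simp add: z_euler_nth zgen_deriv_nth derivation_simps[OF derivation_gen_deriv])

definition z_pow :: "int \<Rightarrow> zseries" where
  "z_pow k = fls_X_intpow (- k)"

lemma z_pow_nth: "fls_nth (z_pow k) j = (if j = - k then 1 else 0)"
  by (auto simp: z_pow_def)

lemma z_pow_0: "z_pow 0 = 1"
  by (simp add: z_pow_def)

lemma z_pow_add: "z_pow (i + j) = z_pow i * z_pow j"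
  unfolding z_pow_def using fls_X_intpow_times_fls_X_intpow[of "- i" "- j", where 'a = coeff_ring]
  by (simp add: add.commute)

lemma z_pow_mult_nth: "fls_nth (z_pow k * F) j = fls_nth F (j + k)"
  unfolding z_pow_def fls_X_intpow_times_conv_shift by simp

lemma z_seq_eq: "z_seq n = z_pow (int n)"
  by (simp add: z_seq_def z_pow_def fls_X_inv_power_conv_shift_1)

lemma zgen_deriv_z_pow: "zgen_deriv s n (z_pow k) = 0"
  by (rule fls_eqI)
    (simp add: zgen_deriv_nth z_pow_nth derivation_simps[OF derivation_gen_deriv])

lemma z_euler_z_pow: "z_euler (z_pow k) = of_int k * z_pow k"
  by (rule fls_eqI) (simp add: z_euler_nth z_pow_nth fls_of_int_nth)

text \<open>Coefficientwise form of the fact that \<open>n \<partial>/\<partial>x_n\<close>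
  multiplies exp(sum x_k t^k / k) by \<open>t^n\<close>.\<close>

lemma (in rat_algebra) derivation_hom_sym:
  assumes D: "derivation D" and "0 < n"
    and x: "\<And>k. 0 < k \<Longrightarrow> D (x k) = (if k = n then of_nat n * c else 0)"
  shows "D (hom_sym emb x k) = (if k < n then 0 else c * hom_sym emb x (k - n))"
proof (induction k rule: less_induct)
  case (less k)
  show ?case
  proof (cases "k = 0")
    case False
    have "of_nat k * D (hom_sym emb x k) = D (of_nat k * hom_sym emb x k)"
      by (simp add: derivation_simps[OF D])
    also have "\<dots> = (\<Sum>j\<in>{1..k}. D (x j) * hom_sym emb x (k - j)) +
        (\<Sum>j\<in>{1..k}. x j * D (hom_sym emb x (k - j)))"
      unfolding hom_sym_newton by (simp add: derivation_simps[OF D] sum.distrib)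
    also have "(\<Sum>j\<in>{1..k}. D (x j) * hom_sym emb x (k - j)) =
        (\<Sum>j\<in>{1..k}. if j = n then of_nat n * c * hom_sym emb x (k - n) else 0)"
      by (intro sum.cong) (auto simp: x)
    also have "\<dots> = (if k < n then 0 else of_nat n * c * hom_sym emb x (k - n))"
      using \<open>0 < n\<close> by auto
    also have "(\<Sum>j\<in>{1..k}. x j * D (hom_sym emb x (k - j))) =
        (\<Sum>j\<in>{1..k}. if j \<le> k - n then c * (x j * hom_sym emb x (k - n - j)) else 0)"
      using \<open>0 < n\<close> by (intro sum.cong) (auto simp: less ac_simps)
    also have "\<dots> = (\<Sum>j\<in>{1..k - n}. c * (x j * hom_sym emb x (k - n - j)))"
      by (rule sum.mono_neutral_cong_right) auto
    also have "\<dots> = c * (of_nat (k - n) * hom_sym emb x (k - n))"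
      by (simp add: hom_sym_newton sum_distrib_left)
    \<comment> \<open>The weights \<open>n\<close> and \<open>k - n\<close> of the two contributions
      add up to \<open>k\<close>, which is then cancelled.\<close>
    also have "(if k < n then 0 else of_nat n * c * hom_sym emb x (k - n)) +
        c * (of_nat (k - n) * hom_sym emb x (k - n)) =
      of_nat k * (if k < n then 0 else c * hom_sym emb x (k - n))"
      by (auto simp: of_nat_diff algebra_simps)
    finally show ?thesis
      by (rule of_nat_mult_cancel[rotated]) (use False in simp)
  qed (use \<open>0 < n\<close> derivation_1[OF D] in simp)
qed

text \<open>As \<open>fls_X\<close> is \<open>z^(-1)\<close>, this is exp(sum x_n / (n z^n)), the
  general shape of a vertex exponential.\<close>

definition hom_series :: "(nat \<Rightarrow> coeff_ring) \<Rightarrow> zseries" where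
  "hom_series x = fps_to_fls (C.hom_fps x)"

lemma hom_series_nth: "fls_nth (hom_series x) k = (if k < 0 then 0 else hom_sym Const x (nat k))"
  by (simp add: hom_series_def C.hom_fps_def)

lemma hom_series_add: "hom_series (\<lambda>k. x k + y k) = hom_series x * hom_series y"
proof -
  have "C.hom_fps (\<lambda>k. x k + y k) = C.hom_fps x * C.hom_fps y"
    by (rule fps_ext) (simp add: C.hom_fps_def C.hom_sym_add fps_mult_nth)
  then show ?thesis
    by (simp add: hom_series_def fls_times_fps_to_fls)
qed

lemma zgen_deriv_hom_series:
  assumes "0 < n" and "\<And>k. 0 < k \<Longrightarrow> gen_deriv s n (x k) = (if k = n then of_nat n * of_int c else 0)"
  shows "zgen_deriv s n (hom_series x) = of_int c * z_pow (- int n) * hom_series x"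
proof (rule fls_eqI)
  fix k
  have "fls_nth (of_int c * z_pow (- int n) * hom_series x) k = of_int c * fls_nth (hom_series x) (k - int n)"
    unfolding fls_of_int mult.assoc by (simp add: z_pow_mult_nth)
  moreover have "gen_deriv s n (hom_sym Const x k) =
      (if k < n then 0 else of_int c * hom_sym Const x (k - n))" for k
    by (rule C.derivation_hom_sym[OF derivation_gen_deriv assms])
  ultimately show "fls_nth (zgen_deriv s n (hom_series x)) k =
      fls_nth (of_int c * z_pow (- int n) * hom_series x) k"
    by (auto simp: zgen_deriv_nth hom_series_nth derivation_0[OF derivation_gen_deriv] nat_diff_distrib)
qed

lemma z_euler_hom_series:
  assumes "\<And>k. N < k \<Longrightarrow> x k = 0"
  shows "z_euler (hom_series x) = - (\<Sum>n\<in>{1..N}. fls_const (x n) * z_pow (- int n)) * hom_series x"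
proof (rule fls_eqI)
  fix k
  show "fls_nth (z_euler (hom_series x)) k =
    fls_nth (- (\<Sum>n\<in>{1..N}. fls_const (x n) * z_pow (- int n)) * hom_series x) k"
  proof (cases "k < 0")
    case False
    then obtain j where j: "k = int j"
      using zero_le_imp_eq_int by (metis not_le)
    have "fls_nth ((\<Sum>n\<in>{1..N}. fls_const (x n) * z_pow (- int n)) * hom_series x) k =
        (\<Sum>n\<in>{1..N}. if j < n then 0 else x n * hom_sym Const x (j - n))"
      unfolding sum_distrib_right fls_nth_sum mult.assoc
      by (intro sum.cong refl) (auto simp: z_pow_mult_nth hom_series_nth j nat_diff_distrib)
    also have "\<dots> = (\<Sum>n\<in>{1..j}. x n * hom_sym Const x (j - n))"
      by (rule sum.mono_neutral_cong) (use assms in auto)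
    also have "\<dots> = of_int k * fls_nth (hom_series x) k"
      unfolding C.hom_sym_newton[symmetric] by (simp add: hom_series_nth j)
    finally show ?thesis
      by (simp add: z_euler_nth)
  next
    case True
    then have "fls_nth ((\<Sum>n\<in>{1..N}. fls_const (x n) * z_pow (- int n)) * hom_series x) k = 0"
      unfolding sum_distrib_right fls_nth_sum mult.assoc
      by (intro sum.neutral ballI) (auto simp: z_pow_mult_nth hom_series_nth)
    then show ?thesis
      using True by (simp add: z_euler_nth hom_series_nth)
  qed
qed

lemma fps_deriv_exp_series_compose:
  fixes g :: "coeff_ring fps"
  assumes g0: "fps_nth g 0 = 0"
  shows "fps_deriv (fps_compose (exp_series Const 1) g) = fps_deriv g * fps_compose (exp_series Const 1) g"
proof (rule fps_ext)
  fix n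
  have Const_fact: "Const (1 / fact (Suc i)) * of_nat (Suc i) = Const (1 / fact i)" for i
    unfolding C.emb_of_nat[symmetric] C.emb_mult[symmetric] by (simp del: of_nat_Suc)
  have coeff: "fps_nth (exp_series Const 1) i = Const (1 / fact i)" for i
    by (simp add: exp_series_def)
  have "fps_nth (fps_deriv (fps_compose (exp_series Const 1) g)) n =
      (\<Sum>i\<in>{0..Suc n}. Const (1 / fact i) * fps_nth (fps_deriv (g ^ i)) n)"
    by (simp only: fps_deriv_nth fps_compose_nth coeff sum_distrib_left mult.left_commute Suc_eq_plus1)
  also have "\<dots> = (\<Sum>i\<in>{0..n}. Const (1 / fact (Suc i)) * fps_nth (fps_deriv (g ^ Suc i)) n)"
  proof -
    have "fps_deriv (g ^ 0) = 0"
      by simp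
    then show ?thesis
      by (simp only: sum.atLeast0_atMost_Suc_shift comp_def fps_zero_nth mult_zero_right add_0)
  qed
  also have "\<dots> = (\<Sum>i\<in>{0..n}. Const (1 / fact i) * fps_nth (fps_deriv g * g ^ i) n)"
  proof (intro sum.cong refl)
    fix i
    have "fps_deriv (g ^ Suc i) = fps_const (of_nat (Suc i)) * (fps_deriv g * g ^ i)"
      by (simp only: fps_deriv_power diff_Suc_1 mult.assoc)
    then have "fps_nth (fps_deriv (g ^ Suc i)) n = of_nat (Suc i) * fps_nth (fps_deriv g * g ^ i) n"
      by (simp only: fps_mult_left_const_nth)
    then show "Const (1 / fact (Suc i)) * fps_nth (fps_deriv (g ^ Suc i)) n =
        Const (1 / fact i) * fps_nth (fps_deriv g * g ^ i) n"
      by (simp only: mult.assoc[symmetric] Const_fact)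
  qed
  also have "\<dots> = (\<Sum>i\<in>{0..n}. \<Sum>k\<in>{0..n}. Const (1 / fact i) * (fps_nth (fps_deriv g) k * fps_nth (g ^ i) (n - k)))"
    by (simp only: fps_mult_nth sum_distrib_left)
  also have "\<dots> = (\<Sum>k\<in>{0..n}. fps_nth (fps_deriv g) k * (\<Sum>i\<in>{0..n}. Const (1 / fact i) * fps_nth (g ^ i) (n - k)))"
    by (subst sum.swap) (simp only: sum_distrib_left mult_ac)
  also have "\<dots> = (\<Sum>k\<in>{0..n}. fps_nth (fps_deriv g) k * fps_nth (fps_compose (exp_series Const 1) g) (n - k))"
  proof (intro sum.cong refl arg_cong2[where f = "(*)"])
    fix k
    show "(\<Sum>i\<in>{0..n}. Const (1 / fact i) * fps_nth (g ^ i) (n - k)) =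
        fps_nth (fps_compose (exp_series Const 1) g) (n - k)"
      unfolding fps_compose_nth coeff
      \<comment> \<open>Since \<open>g\<close> has no constant term, \<open>g ^ i\<close> starts in
        degree \<open>i\<close>, so the terms with \<open>i > n - k\<close> vanish.\<close>
      by (rule sum.mono_neutral_right) (use startsby_zero_power_prefix[OF g0] in auto)
  qed
  finally show "fps_nth (fps_deriv (fps_compose (exp_series Const 1) g)) n =
      fps_nth (fps_deriv g * fps_compose (exp_series Const 1) g) n"
    by (simp add: fps_mult_nth)
qed

text \<open>By the chain rule the exponential solves the first-order equation that characterizes
  \<open>hom_fps\<close>.\<close>

lemma vertex_exp_eq: "vertex_exp c v = hom_series (\<lambda>n. Const c * Var (v n))"
proof -
  define g where "g = Abs_fps (\<lambda>n. if n = 0 then 0 else Const (c / of_nat n) * Var (v n))"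
  define F where "F = fps_compose (exp_series Const 1) g"
  have "fps_X * fps_deriv g = C.sum_fps (\<lambda>n. Const c * Var (v n))"
  proof (rule fps_ext)
    fix n
    have "of_nat (Suc k) * Const (c / of_nat (Suc k)) = Const c" for k
      unfolding C.emb_of_nat[symmetric] C.emb_mult[symmetric] by (simp del: of_nat_Suc)
    then show "fps_nth (fps_X * fps_deriv g) n = fps_nth (C.sum_fps (\<lambda>n. Const c * Var (v n))) n"
      by (cases n) (simp_all add: C.sum_fps_def g_def del: of_nat_Suc flip: mult.assoc)
  qed
  then have "fps_X * fps_deriv F = C.sum_fps (\<lambda>n. Const c * Var (v n)) * F"
    unfolding F_def by (subst fps_deriv_exp_series_compose) (simp_all add: g_def mult.assoc[symmetric])
  then have "fps_nth F n = hom_sym Const (\<lambda>n. Const c * Var (v n)) n" for n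
    by (rule C.hom_sym_eqI[rotated]) (simp add: F_def exp_series_def)
  then have "F = C.hom_fps (\<lambda>n. Const c * Var (v n))"
    by (intro fps_ext) (simp add: C.hom_fps_def)
  then show ?thesis
    by (simp add: vertex_exp_def hom_series_def F_def g_def)
qed

section \<open>The evolution in \<open>\<beta>\<close>\<close>

definition scalars :: "zseries set \<Rightarrow> bool" where
  "scalars K \<longleftrightarrow> range zConst \<subseteq> K \<and> (\<forall>x\<in>K. \<forall>y\<in>K. x + y \<in> K \<and> x * y \<in> K)"

text \<open>Polynomials over \<open>K\<close> in the \<open>P n\<close>, homogeneous of degree
  \<open>d\<close> when \<open>P n\<close> has degree \<open>n\<close>. The coefficients of tau are
  such polynomials, and their properties are checked on monomials.\<close>

inductive_set weight_span :: "nat \<Rightarrow> (nat \<Rightarrow> zseries) \<Rightarrow> zseries set \<Rightarrow> zseries set"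
  for d P K where
  weight: "g permutes {1..d} \<Longrightarrow> c \<in> K \<Longrightarrow> c * cyc_weight {1..d} P g \<in> weight_span d P K"
| zero: "0 \<in> weight_span d P K"
| add: "f \<in> weight_span d P K \<Longrightarrow> h \<in> weight_span d P K \<Longrightarrow> f + h \<in> weight_span d P K"

lemma weight_span_sum:
  "(\<And>x. x \<in> A \<Longrightarrow> f x \<in> weight_span d P K) \<Longrightarrow> (\<Sum>x\<in>A. f x) \<in> weight_span d P K"
  by (induction A rule: infinite_finite_induct) (auto intro: weight_span.zero weight_span.add)

lemma weight_span_scale:
  assumes "scalars K" "c \<in> K" "f \<in> weight_span d P K"
  shows "c * f \<in> weight_span d P K"
  using assms(3)
proof induction
  case (weight g c')
  then have "c * c' * cyc_weight {1..d} P g \<in> weight_span d P K"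
    using assms(1,2) by (intro weight_span.weight) (auto simp: scalars_def)
  then show ?case
    by (simp only: mult.assoc)
qed (auto simp: distrib_left intro: weight_span.zero weight_span.add)

lemma scalars_zConst: "scalars K \<Longrightarrow> zConst c \<in> K"
  by (auto simp: scalars_def)

lemma scalars_prod: "scalars K \<Longrightarrow> (\<And>x. x \<in> A \<Longrightarrow> f x \<in> K) \<Longrightarrow> prod f A \<in> K"
proof (induction A rule: infinite_finite_induct)
  case (insert x A)
  then show ?case
    by (auto simp: scalars_def)
qed (use scalars_zConst[of K 1] in auto)

lemma hurwitz_weight_in_weight_span:
  assumes "scalars K" "g permutes {1..d}"
  shows "hurwitz_weight d P b g \<in> weight_span d P K"
  using assms(2)
proof (induction b arbitrary: g)
  case 0
  show ?case
    using weight_span.weight[OF 0 scalars_zConst[OF assms(1)], of 1 P] by simp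
next
  case (Suc b)
  then show ?case
    unfolding hurwitz_weight.simps
    by (intro weight_span_sum Suc.IH permutes_compose[OF _ transpositions_permutes])
qed

lemma tau_nth_in_weight_span:
  assumes K: "scalars K" and P': "\<And>n. P' n \<in> K"
  shows "fps_nth (fps_nth (tau P P') d) b \<in> weight_span d P K"
proof -
  have "cyc_weight {1..d} P' g * hurwitz_weight d P b g \<in> weight_span d P K"
    if "g permutes {1..d}" for g
    unfolding cyc_weight_def family_weight_def
    by (intro weight_span_scale[OF K] scalars_prod[OF K] P' hurwitz_weight_in_weight_span[OF K that])
  then have "(\<Sum>g\<in>{g. g permutes {1..d}}. hurwitz_weight d P b g * cyc_weight {1..d} P' g) \<in> weight_span d P K"
    by (intro weight_span_sum) (simp add: mult.commute)
  then show ?thesis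
    unfolding tau_nth by (rule weight_span_scale[OF K scalars_zConst[OF K]])
qed

lemma exp_series_power: "exp_series zConst c ^ n = exp_series zConst (of_nat n * c)"
proof -
  have prod: "exp_series zConst x * exp_series zConst y = exp_series zConst (x + y)" for x y
  proof (rule fps_ext)
    fix n
    have sum: "zConst (sum f A) = (\<Sum>i\<in>A. zConst (f i))" for f and A :: "nat set"
      by (induction A rule: infinite_finite_induct) (simp_all add: Z.emb_add)
    have "fps_nth (exp_series zConst (x + y)) n = zConst (fps_nth (fps_exp x * fps_exp y) n)"
      by (simp only: exp_series_def fps_nth_Abs_fps fps_exp_add_mult)
    then show "fps_nth (exp_series zConst x * exp_series zConst y) n = fps_nth (exp_series zConst (x + y)) n"
      by (simp only: fps_mult_nth sum Z.emb_mult exp_series_def fps_nth_Abs_fps)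
  qed
  have "exp_series zConst 0 = 1"
    by (rule fps_ext) (simp add: exp_series_def)
  then show ?thesis
    by (induction n) (simp_all add: prod distrib_right)
qed

lemma (in rat_algebra) fps_deriv_exp_series:
  "fps_deriv (exp_series emb c) = fps_const (emb c) * exp_series emb c"
proof (rule fps_ext)
  fix n
  have "of_nat (Suc n) * (c ^ Suc n / fact (Suc n)) = c * (c ^ n / fact n)"
    by (simp del: of_nat_Suc)
  then have "of_nat (Suc n) * emb (c ^ Suc n / fact (Suc n)) = emb c * emb (c ^ n / fact n)"
    unfolding emb_of_nat[symmetric] emb_mult[symmetric] by (simp only:)
  then show "fps_nth (fps_deriv (exp_series emb c)) n = fps_nth (fps_const (emb c) * exp_series emb c) n"
    by (simp only: fps_deriv_nth exp_series_def fps_nth_Abs_fps fps_exp_nth fps_mult_left_const_nth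
        Suc_eq_plus1 of_nat_fact)
qed

lemma (in rat_algebra) emb_of_int: "emb (of_int k) = of_int k"
proof -
  have "emb (- x) = - emb x" for x
    using emb_add[of "- x" x] by (simp add: eq_neg_iff_add_eq_0)
  then show ?thesis
    by (cases k rule: int_cases2) (simp_all add: emb_of_nat)
qed

text \<open>Replacing q by \<open>e^(k \<beta>) q\<close> multiplies the coefficient of
  \<open>q^d\<close> by \<open>e^(d k \<beta>)\<close>.\<close>

lemma tau_at_nth:
  "fps_nth (tau_at P P' k) d = exp_series zConst (of_nat d * of_int k) * fps_nth (tau P P') d"
  by (simp add: tau_at_def exp_series_power)

lemma tau_at_nth_in_weight_span:
  assumes K: "scalars K" and P': "\<And>n. P' n \<in> K"
  shows "fps_nth (fps_nth (tau_at P P' k) d) b \<in> weight_span d P K"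
  unfolding tau_at_nth fps_mult_nth
  by (intro weight_span_sum weight_span_scale[OF K] tau_nth_in_weight_span[OF K] P')
    (simp add: exp_series_def scalars_zConst[OF K])

lemma tau_at_nth_0: "fps_nth (fps_nth (tau_at P P' k) d) 0 = hom_sym zConst (\<lambda>n. P n * P' n) d"
  unfolding tau_at_nth fps_mult_nth by (simp add: tau_nth_0 exp_series_def)

lemma tau_at_0: "tau_at P P' 0 = tau P P'"
proof (rule fps_ext)
  have "exp_series zConst 0 = 1"
    by (rule fps_ext) (simp add: exp_series_def)
  then show "fps_nth (tau_at P P' 0) d = fps_nth (tau P P') d" for d
    by (simp add: tau_at_nth)
qed

lemma euler_add:
  assumes "\<And>n. derivation (\<delta> n)"
  shows "euler N a \<delta> (f + g) = euler N a \<delta> f + euler N a \<delta> g"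
  by (simp add: euler_def derivation_simps[OF assms] distrib_left sum.distrib)

lemma euler_scale:
  assumes "\<And>n. derivation (\<delta> n)" "\<And>n. \<delta> n c = 0"
  shows "euler N a \<delta> (c * f) = c * euler N a \<delta> f"
  by (simp add: euler_def derivation_simps[OF assms(1)] assms(2) sum_distrib_left mult_ac)

lemma euler_0:
  assumes "\<And>n. derivation (\<delta> n)"
  shows "euler N a \<delta> 0 = 0"
  by (simp add: euler_def derivation_simps[OF assms])

text \<open>Serves with \<open>h = P\<close> for Euler's identity and with powers of z for the
  action of \<open>z d/dz\<close>.\<close>

lemma sum_dual_derivation_cyc_weight:
  assumes \<delta>: "dual_derivations \<delta> Q" and g: "g permutes {1..d}" and "d \<le> N"
  shows "(\<Sum>n\<in>{1..N}. h n * \<delta> n (cyc_weight {1..d} Q g)) =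
    (\<Sum>X\<in>orbit g ` {1..d}. of_nat (card X) * h (card X) * family_weight Q (orbit g ` {1..d} - {X}))"
proof -
  let ?F = "orbit g ` {1..d}"
  have D: "derivation (\<delta> n)" for n
    using \<delta> by (simp add: dual_derivations_def)
  have pg: "permutation g"
    using g by (auto simp: permutation_permutes)
  have card: "card X \<in> {1..N}" if "X \<in> ?F" for X
  proof -
    have "card X \<le> (\<Sum>X\<in>?F. card X)"
      by (rule member_le_sum[OF that]) auto
    then show ?thesis
      using card_orbits[OF g] card_orbit_pos[OF pg that] assms(3) by auto
  qed
  have "(\<Sum>n\<in>{1..N}. h n * \<delta> n (cyc_weight {1..d} Q g)) =
      (\<Sum>n\<in>{1..N}. \<Sum>X\<in>?F. if card X = n then of_nat (card X) * h (card X) * family_weight Q (?F - {X}) else 0)"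
    using \<delta> unfolding cyc_weight_def dual_derivations_def
    by (intro sum.cong refl) (auto simp: family_weight_derivation sum_distrib_left mult_ac intro!: sum.cong)
  also have "\<dots> = (\<Sum>X\<in>?F. of_nat (card X) * h (card X) * family_weight Q (?F - {X}))"
    by (subst sum.swap) (intro sum.cong refl, use card in simp)
  finally show ?thesis .
qed

text \<open>Euler's identity for homogeneous polynomials. It turns the factor \<open>d k\<close>
  from differentiating \<open>e^(d k \<beta>)\<close> into \<open>k\<close> times the Euler
  operator.\<close>

lemma euler_weight_span:
  assumes \<delta>: "dual_derivations \<delta> P" and K: "\<And>c n. c \<in> K \<Longrightarrow> \<delta> n c = 0" and "d \<le> N"
    and "f \<in> weight_span d P K"
  shows "euler N P \<delta> f = of_nat d * f"
proof -
  have D: "derivation (\<delta> n)" for n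
    using \<delta> by (simp add: dual_derivations_def)
  show ?thesis
    using assms(4)
  proof induction
    case (weight g c)
    have "euler N P \<delta> (cyc_weight {1..d} P g) =
        (\<Sum>X\<in>orbit g ` {1..d}. of_nat (card X) * (P (card X) * family_weight P (orbit g ` {1..d} - {X})))"
      unfolding euler_def using sum_dual_derivation_cyc_weight[OF \<delta> weight(1) assms(3)]
      by (simp add: mult.assoc)
    also have "\<dots> = (\<Sum>X\<in>orbit g ` {1..d}. of_nat (card X) * cyc_weight {1..d} P g)"
      unfolding cyc_weight_def family_weight_def
      by (intro sum.cong refl arg_cong2[where f = "(*)"] prod.remove[symmetric]) auto
    also have "\<dots> = of_nat d * cyc_weight {1..d} P g"
      using card_orbits[OF weight(1)] by (simp flip: sum_distrib_right of_nat_sum)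
    finally show ?case
      using K[OF weight(2)] by (simp add: euler_scale[OF D] mult_ac)
  qed (simp_all add: euler_0[OF D] euler_add[OF D] distrib_left)
qed

text \<open>Two distinct cycles of lengths \<open>i\<close> and \<open>j\<close> would have total
  length greater than \<open>N\<close>, but only \<open>d \<le> N\<close> points are
  available.\<close>

lemma dual_derivation2_weight_span:
  assumes \<delta>: "dual_derivations \<delta> P" and K: "\<And>c n. c \<in> K \<Longrightarrow> \<delta> n c = 0" and "d \<le> N"
    and f: "f \<in> weight_span d P K" and ij: "(i, j) \<in> index_rest N"
  shows "\<delta> i (\<delta> j f) = 0"
proof -
  have D: "derivation (\<delta> n)" for n
    using \<delta> by (simp add: dual_derivations_def)
  have ij': "0 < i" "0 < j" "N < i + j"
    using ij by (auto simp: index_rest_def index_pairs_def)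
  show ?thesis
    using f
  proof induction
    case (weight g c)
    define F where "F = orbit g ` {1..d}"
    have F: "finite F"
      by (simp add: F_def)
    have no: "\<not> (card X = j \<and> card Y = i)" if "X \<in> F" "Y \<in> F - {X}" for X Y
    proof -
      have "(\<Sum>Z\<in>{X, Y}. card Z) \<le> (\<Sum>Z\<in>F. card Z)"
        using that F by (intro sum_mono2) auto
      moreover have "X \<noteq> Y"
        using that by auto
      ultimately show ?thesis
        using card_orbits[OF weight(1)] assms(3) ij'(3) by (auto simp: F_def)
    qed
    have "\<delta> i (\<delta> j (cyc_weight {1..d} P g)) = 0"
      unfolding cyc_weight_def F_def[symmetric] family_weight_dual_derivation2[where \<delta> = \<delta>, OF \<delta> F ij'(1,2)]
    proof (intro sum.neutral ballI)
      fix X Y assume "X \<in> F" "Y \<in> F - {X}"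
      then show "(if card X = j then of_nat j else 0) *
          ((if card Y = i then of_nat i else 0) * family_weight P (F - {X, Y})) = 0"
        using no[of X Y] by auto
    qed
    then show ?case
      using K[OF weight(2)] by (simp add: derivation_simps[OF D])
  qed (simp_all add: derivation_simps[OF D])
qed

lemma derivation_weight_span_0:
  assumes D: "derivation D" and K: "\<And>c. c \<in> K \<Longrightarrow> D c = 0" and P: "\<And>k. D (P k) = 0"
    and "f \<in> weight_span d P K"
  shows "D f = 0"
  using assms(4)
proof induction
  case (weight g c)
  have "D (cyc_weight {1..d} P g) = 0"
    unfolding cyc_weight_def by (simp add: family_weight_derivation[OF D] P)
  then show ?case
    using K[OF weight(2)] by (simp add: derivation_simps[OF D])
qed (simp_all add: derivation_simps[OF D])

lemma tau_at_evolution: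
  fixes d b N :: nat and k :: int
  assumes \<delta>: "dual_derivations \<delta> P" and scal: "scalars K" and K: "\<And>c n. c \<in> K \<Longrightarrow> \<delta> n c = 0"
    and P': "\<And>n. P' n \<in> K" and N: "d \<le> N"
  defines "U \<equiv> fps_nth (tau_at P P' k) d"
  shows "2 * fps_nth (fps_deriv U) b =
    cutjoin N P \<delta> (fps_nth U b) + 2 * of_int k * euler N P \<delta> (fps_nth U b)"
proof -
  have D: "derivation (\<delta> n)" for n
    using \<delta> by (simp add: dual_derivations_def)
  define t where "t = fps_nth (tau P P') d"
  define E where "E = exp_series zConst (of_nat d * of_int k)"
  have U: "U = E * t"
    by (simp add: U_def tau_at_nth E_def t_def)
  have E0: "\<delta> n (fps_nth E i) = 0" for n i
    by (simp add: E_def exp_series_def K scalars_zConst[OF scal])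
  have t: "2 * fps_nth (fps_deriv t) b = cutjoin N P \<delta> (fps_nth t b)" for b
  proof -
    define c where "c = zConst (1 / (fact d * fact b))"
    have c: "of_nat (Suc b) * zConst (1 / (fact d * fact (Suc b))) = c"
      unfolding c_def Z.emb_of_nat[symmetric] Z.emb_mult[symmetric] by (simp del: of_nat_Suc)
    have cw: "\<delta> n (cyc_weight {1..d} P' g) = 0" for n g
      unfolding cyc_weight_def by (simp add: family_weight_derivation[OF D] K P')
    have "2 * fps_nth (fps_deriv t) b = c * (\<Sum>g\<in>{g. g permutes {1..d}}.
        (2 * hurwitz_weight d P (Suc b) g) * cyc_weight {1..d} P' g)"
      unfolding c[symmetric]
      by (simp add: t_def tau_nth sum_distrib_left mult_ac del: hurwitz_weight.simps)
    also have "\<dots> = c * (\<Sum>g\<in>{g. g permutes {1..d}}.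
        cutjoin N P \<delta> (cyc_weight {1..d} P' g * hurwitz_weight d P b g))"
    proof (intro arg_cong2[where f = "(*)"] sum.cong refl)
      fix g assume "g \<in> {g. g permutes {1..d}}"
      then have "2 * hurwitz_weight d P (Suc b) g = cutjoin N P \<delta> (hurwitz_weight d P b g)"
        by (intro hurwitz_weight_Suc[OF _ N \<delta>]) simp
      then show "(2 * hurwitz_weight d P (Suc b) g) * cyc_weight {1..d} P' g =
          cutjoin N P \<delta> (cyc_weight {1..d} P' g * hurwitz_weight d P b g)"
        unfolding cutjoin_scale[where \<delta> = \<delta>, OF D cw] by (simp only: mult.commute)
    qed
    also have "\<dots> = cutjoin N P \<delta> (fps_nth t b)"
      using K[OF scalars_zConst[OF scal]]
      by (simp add: t_def tau_nth c_def cutjoin_scale[where \<delta> = \<delta>, OF D]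
          cutjoin_sum[where \<delta> = \<delta>, OF D] mult.commute)
    finally show ?thesis .
  qed
  have "fps_deriv U = fps_const (zConst (of_nat d * of_int k)) * U + E * fps_deriv t"
    by (simp add: U E_def Z.fps_deriv_exp_series algebra_simps)
  moreover have "2 * fps_nth (E * fps_deriv t) b = cutjoin N P \<delta> (fps_nth U b)"
  proof -
    have "2 * fps_nth (E * fps_deriv t) b =
        (\<Sum>i\<in>{0..b}. fps_nth E i * (2 * fps_nth (fps_deriv t) (b - i)))"
      by (simp only: fps_mult_nth sum_distrib_left mult.left_commute)
    also have "\<dots> = (\<Sum>i\<in>{0..b}. cutjoin N P \<delta> (fps_nth E i * fps_nth t (b - i)))"
      by (simp only: t cutjoin_scale[where \<delta> = \<delta>, OF D E0])
    finally show ?thesis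
      by (simp only: U fps_mult_nth cutjoin_sum[where \<delta> = \<delta>, OF D])
  qed
  moreover have "zConst (of_nat d * of_int k) = of_int k * of_nat d"
    by (simp add: Z.emb_mult Z.emb_of_nat Z.emb_of_int mult.commute)
  moreover have "euler N P \<delta> (fps_nth U b) = of_nat d * fps_nth U b"
    unfolding U_def by (rule euler_weight_span[OF \<delta> K N tau_at_nth_in_weight_span[OF scal P']])
  ultimately show ?thesis
    by (simp add: algebra_simps)
qed

section \<open>The bilinear equation\<close>

definition gen_series :: "int \<Rightarrow> nat \<Rightarrow> zseries" where
  "gen_series s n = fls_const (gen s n)"

text \<open>For \<open>s = 1\<close> and \<open>s = -1\<close> these are the unprimed arguments of
  the two factors on the right-hand side.\<close>

definition shifted :: "int \<Rightarrow> nat \<Rightarrow> zseries" where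
  "shifted s n = gen_series s n - of_int s * z_pow (int n)"

text \<open>Two rings of constants are used. This one may involve z, as needed on the left where the
  primed variables are shifted; \<open>const_scalars\<close> is free of z, so that on the right
  \<open>z d/dz\<close> kills it too.\<close>

definition z_scalars :: "zseries set" where
  "z_scalars = {c. \<forall>s n. zgen_deriv s n c = 0}"

definition const_scalars :: "zseries set" where
  "const_scalars = fls_const ` {c. \<forall>s n. gen_deriv s n c = 0}"

lemma scalars_z_scalars: "scalars z_scalars"
  by (auto simp: scalars_def z_scalars_def zConst_def zgen_deriv_const gen_deriv_Const
      derivation_simps[OF derivation_zgen_deriv])

lemma scalars_const_scalars: "scalars const_scalars"
  unfolding scalars_def const_scalars_def
proof (intro conjI ballI)
  show "range zConst \<subseteq> fls_const ` {c. \<forall>s n. gen_deriv s n c = 0}"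
    by (auto simp: zConst_def gen_deriv_Const)
  fix x y
  assume "x \<in> fls_const ` {c. \<forall>s n. gen_deriv s n c = 0}"
    "y \<in> fls_const ` {c. \<forall>s n. gen_deriv s n c = 0}"
  then obtain c c' where c: "x = fls_const c" "y = fls_const c'"
    "\<And>s n. gen_deriv s n c = 0" "\<And>s n. gen_deriv s n c' = 0"
    by auto
  show "x + y \<in> fls_const ` {c. \<forall>s n. gen_deriv s n c = 0}"
    by (rule image_eqI[of _ _ "c + c'"]) (simp_all add: c derivation_simps[OF derivation_gen_deriv] fls_plus_const)
  show "x * y \<in> fls_const ` {c. \<forall>s n. gen_deriv s n c = 0}"
    by (rule image_eqI[of _ _ "c * c'"]) (simp_all add: c derivation_simps[OF derivation_gen_deriv])
qed

lemma const_scalars_subset: "const_scalars \<subseteq> z_scalars"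
  by (auto simp: const_scalars_def z_scalars_def zgen_deriv_const)

lemma zgen_deriv_z_scalars: "c \<in> z_scalars \<Longrightarrow> zgen_deriv s n c = 0"
  by (simp add: z_scalars_def)

lemma zgen_deriv_const_scalars: "c \<in> const_scalars \<Longrightarrow> zgen_deriv s n c = 0"
  using const_scalars_subset zgen_deriv_z_scalars by blast

lemma gen_deriv_0: "gen_deriv s 0 f = 0"
  by (simp add: gen_deriv_def)

lemma zgen_deriv_gen_series:
  assumes "s \<in> {1, -1}" "s' \<in> {1, -1}"
  shows "zgen_deriv s n (gen_series s' k) = (if s = s' \<and> k = n then of_nat n else 0)"
  by (auto simp: gen_series_def zgen_deriv_const gen_deriv_gen[OF assms] fls_of_nat)

lemma zgen_deriv_shifted:
  assumes "s \<in> {1, -1}" "s' \<in> {1, -1}"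
  shows "zgen_deriv s n (shifted s' k) = (if s = s' \<and> k = n then of_nat n else 0)"
  by (simp add: shifted_def derivation_simps[OF derivation_zgen_deriv] zgen_deriv_z_pow
      zgen_deriv_gen_series[OF assms])

lemma dual_derivations_gen_series:
  "s \<in> {1, -1} \<Longrightarrow> dual_derivations (zgen_deriv s) (gen_series s)"
  by (simp add: dual_derivations_def derivation_zgen_deriv zgen_deriv_gen_series)

lemma dual_derivations_shifted:
  "s \<in> {1, -1} \<Longrightarrow> dual_derivations (zgen_deriv s) (shifted s)"
  by (simp add: dual_derivations_def derivation_zgen_deriv zgen_deriv_shifted)

text \<open>Twice the common operator of both sides, without its scalar term, which
  \<open>evolves\<close> adds.\<close>

definition evolution :: "nat \<Rightarrow> int \<Rightarrow> (int \<Rightarrow> nat \<Rightarrow> 'a) \<Rightarrow> (int \<Rightarrow> nat \<Rightarrow> 'a \<Rightarrow> 'a) \<Rightarrow> 'a \<Rightarrow> 'a::comm_ring_1" where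
  "evolution N m a \<delta> f =
     cutjoin N (a 1) (\<delta> 1) f + 2 * of_int (m + 1) * euler N (a 1) (\<delta> 1) f +
     (cutjoin N (a (-1)) (\<delta> (-1)) f - 2 * euler N (a (-1)) (\<delta> (-1)) f)"

lemma evolution_add:
  assumes "\<And>s n. derivation (\<delta> s n)"
  shows "evolution N m a \<delta> (f + g) = evolution N m a \<delta> f + evolution N m a \<delta> g"
  by (simp add: evolution_def cutjoin_add[OF assms] euler_add[OF assms] algebra_simps)

lemma evolution_sum:
  assumes "\<And>s n. derivation (\<delta> s n)"
  shows "evolution N m a \<delta> (\<Sum>x\<in>A. f x) = (\<Sum>x\<in>A. evolution N m a \<delta> (f x))"
  by (induction A rule: infinite_finite_induct)
    (simp_all add: evolution_add[where \<delta> = \<delta>, OF assms], simp_all add: evolution_def cutjoin_0[OF assms] euler_0[OF assms])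

lemma evolution_0:
  assumes "\<And>s n. derivation (\<delta> s n)"
  shows "evolution N m a \<delta> 0 = 0"
  by (simp add: evolution_def cutjoin_0[OF assms] euler_0[OF assms])

lemma evolution_scale:
  assumes "\<And>s n. derivation (\<delta> s n)" "\<And>s n. \<delta> s n c = 0"
  shows "evolution N m a \<delta> (c * f) = c * evolution N m a \<delta> f"
  by (simp add: evolution_def cutjoin_scale[OF assms] euler_scale[OF assms] algebra_simps)

lemma evolution_mult:
  assumes D: "\<And>s n. derivation (\<delta> s n)"
    and f: "\<And>n. \<delta> (-1) n f = 0" and g: "\<And>n. \<delta> 1 n g = 0"
  shows "evolution N m a \<delta> (f * g) =
    (cutjoin N (a 1) (\<delta> 1) f + 2 * of_int (m + 1) * euler N (a 1) (\<delta> 1) f) * g +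
    f * (cutjoin N (a (-1)) (\<delta> (-1)) g - 2 * euler N (a (-1)) (\<delta> (-1)) g)"
proof -
  have "cutjoin N (a 1) (\<delta> 1) (f * g) = g * cutjoin N (a 1) (\<delta> 1) f"
    "euler N (a 1) (\<delta> 1) (f * g) = g * euler N (a 1) (\<delta> 1) f"
    using cutjoin_scale[where \<delta> = "\<delta> 1", OF D g, of N "a 1" f]
      euler_scale[where \<delta> = "\<delta> 1", OF D g, of N "a 1" f] by (simp_all add: mult.commute)
  then show ?thesis
    by (simp add: evolution_def cutjoin_scale[where \<delta> = "\<delta> (-1)", OF D f]
        euler_scale[where \<delta> = "\<delta> (-1)", OF D f] algebra_simps)
qed

text \<open>The operator does not involve z, so it commutes with extracting a coefficient.\<close>

lemma evolution_nth:
  "fls_nth (evolution N m gen_series zgen_deriv F) k = evolution N m gen gen_deriv (fls_nth F k)"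
proof -
  have cj: "fls_nth (cutjoin N (gen_series s) (zgen_deriv s) F) k = cutjoin N (gen s) (gen_deriv s) (fls_nth F k)" for s
    by (simp add: cutjoin_def fls_nth_sum gen_series_def case_prod_unfold zgen_deriv_nth mult.assoc)
  have eu: "fls_nth (euler N (gen_series s) (zgen_deriv s) F) k = euler N (gen s) (gen_deriv s) (fls_nth F k)" for s
    by (simp add: euler_def fls_nth_sum gen_series_def zgen_deriv_nth)
  have "evolution N m gen_series zgen_deriv F = cutjoin N (gen_series 1) (zgen_deriv 1) F +
     of_int (2 * (m + 1)) * euler N (gen_series 1) (zgen_deriv 1) F +
     (cutjoin N (gen_series (-1)) (zgen_deriv (-1)) F - of_int 2 * euler N (gen_series (-1)) (zgen_deriv (-1)) F)"
    by (simp add: evolution_def)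
  then show ?thesis
    by (simp only: fls_plus_nth fls_minus_nth fls_mult_of_int_nth cj eu) (simp add: evolution_def)
qed

text \<open>In terms of z, only powers up to \<open>z^(-A)\<close> occur.\<close>

definition vanish_below :: "zseries \<Rightarrow> int \<Rightarrow> bool" where
  "vanish_below F A \<longleftrightarrow> (\<forall>k<A. fls_nth F k = 0)"

lemma vanish_below_mult:
  assumes "vanish_below F A" "vanish_below G B"
  shows "vanish_below (F * G) (A + B)"
  unfolding vanish_below_def
proof (intro allI impI)
  fix n assume "n < A + B"
  then have "fls_nth F i * fls_nth G (n - i) = 0" for i
    using assms unfolding vanish_below_def by (cases "i < A") auto
  then show "fls_nth (F * G) n = 0"
    by (simp add: fls_times_nth(2))
qed

lemma vanish_below_sum: "(\<And>x. x \<in> S \<Longrightarrow> vanish_below (f x) A) \<Longrightarrow> vanish_below (\<Sum>x\<in>S. f x) A"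
  by (auto simp: vanish_below_def fls_nth_sum)

lemma vanish_below_fls_const: "vanish_below (fls_const c) 0"
  by (simp add: vanish_below_def)

lemma vanish_below_hom_series: "vanish_below (hom_series x) 0"
  by (simp add: vanish_below_def hom_series_nth)

lemma vanish_below_shifted: "vanish_below (shifted s n) (- int n)"
  by (simp add: vanish_below_def shifted_def gen_series_def z_pow_nth)

lemma vanish_below_prod:
  assumes "finite F" "\<And>x. x \<in> F \<Longrightarrow> vanish_below (f x) (- int (h x))"
  shows "vanish_below (\<Prod>x\<in>F. f x) (- int (\<Sum>x\<in>F. h x))"
  using assms
proof (induction F)
  case empty
  show ?case
    using vanish_below_fls_const[of 1] by simp
next
  case (insert x F)
  then show ?case
    using vanish_below_mult[of "f x" "- int (h x)" "\<Prod>x\<in>F. f x" "- int (\<Sum>x\<in>F. h x)"] by simp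
qed

lemma vanish_below_weight_span:
  assumes "f \<in> weight_span d (shifted s) const_scalars"
  shows "vanish_below f (- int d)"
  using assms
proof induction
  case (weight g c)
  have "vanish_below (cyc_weight {1..d} (shifted s) g) (- int d)"
  proof -
    have "vanish_below (cyc_weight {1..d} (shifted s) g) (- int (\<Sum>X\<in>orbit g ` {1..d}. card X))"
      unfolding cyc_weight_def family_weight_def
      by (rule vanish_below_prod) (auto simp: vanish_below_shifted)
    then show ?thesis
      unfolding card_orbits[OF weight(1) finite_atLeastAtMost] by simp
  qed
  moreover have "vanish_below c 0"
    using weight(2) vanish_below_fls_const by (auto simp: const_scalars_def)
  ultimately show ?case
    using vanish_below_mult[of c 0] by fastforce
qed (auto simp: vanish_below_def)

text \<open>The chain rule: \<open>f\<close> depends on z only through the shifted variables, and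
  \<open>z d/dz\<close> maps \<open>shifted s n\<close> to \<open>- s n z^n\<close>.\<close>

lemma z_euler_weight_span:
  assumes s: "s \<in> {1, -1}" and "d \<le> N" and f: "f \<in> weight_span d (shifted s) const_scalars"
  shows "z_euler f = - of_int s * (\<Sum>n\<in>{1..N}. z_pow (int n) * zgen_deriv s n f)"
  using f
proof induction
  case (weight g c)
  let ?W = "cyc_weight {1..d} (shifted s) g" and ?F = "orbit g ` {1..d}"
  have "z_euler (shifted s n) = - of_int s * (of_nat n * z_pow (int n))" for n
    by (simp add: shifted_def derivation_simps[OF derivation_z_euler] gen_series_def z_euler_const z_euler_z_pow)
  then have "z_euler ?W = - of_int s * (\<Sum>X\<in>?F. of_nat (card X) * z_pow (int (card X)) *
      family_weight (shifted s) (?F - {X}))"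
    by (simp add: cyc_weight_def family_weight_derivation[OF derivation_z_euler] sum_distrib_left mult.assoc sum_negf)
  also have "\<dots> = - of_int s * (\<Sum>n\<in>{1..N}. z_pow (int n) * zgen_deriv s n ?W)"
    by (simp only: sum_dual_derivation_cyc_weight[OF dual_derivations_shifted[OF s] weight(1) assms(2)])
  finally have W: "z_euler ?W = - of_int s * (\<Sum>n\<in>{1..N}. z_pow (int n) * zgen_deriv s n ?W)" .
  have c: "z_euler c = 0" "zgen_deriv s n c = 0" for n
    using weight(2) zgen_deriv_const_scalars by (auto simp: const_scalars_def z_euler_const)
  show ?case
    unfolding derivation_mult[OF derivation_z_euler] derivation_mult[OF derivation_zgen_deriv] c W
    by (simp add: sum_distrib_left mult_ac)
qed (simp_all add: derivation_simps[OF derivation_z_euler] derivation_simps[OF derivation_zgen_deriv]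
    distrib_left sum.distrib)

text \<open>The truncated factor exp(s sum (p_n + s s_n)/(n z^n)) over n up to \<open>N\<close>. In
  the product for \<open>s = 1\<close> and \<open>s = -1\<close> the p_n cancel and the exponents 2
  s_n remain.\<close>

definition half_vertex :: "nat \<Rightarrow> int \<Rightarrow> zseries" where
  "half_vertex N s = hom_series (\<lambda>k. if k \<le> N then of_int s * gen s k else 0)"

lemma zgen_deriv_half_vertex:
  assumes "s \<in> {1, -1}" "n \<in> {1..N}"
  shows "zgen_deriv s n (half_vertex N s) = of_int s * z_pow (- int n) * half_vertex N s"
  unfolding half_vertex_def
  by (rule zgen_deriv_hom_series)
    (use assms in \<open>auto simp: derivation_simps[OF derivation_gen_deriv] gen_deriv_gen\<close>)

lemma zgen_deriv_half_vertex_other: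
  assumes "s \<in> {1, -1}" "s' \<in> {1, -1}" "s \<noteq> s'"
  shows "zgen_deriv s n (half_vertex N s') = 0"
proof (cases "n = 0")
  case True
  then show ?thesis
    by (intro fls_eqI) (simp add: zgen_deriv_nth gen_deriv_0)
next
  case False
  then have "zgen_deriv s n (half_vertex N s') = of_int 0 * z_pow (- int n) * half_vertex N s'"
    unfolding half_vertex_def
    by (intro zgen_deriv_hom_series)
      (use assms in \<open>auto simp: derivation_simps[OF derivation_gen_deriv] gen_deriv_gen\<close>)
  then show ?thesis
    by simp
qed

lemma z_euler_half_vertex:
  "z_euler (half_vertex N s) =
     - of_int s * (\<Sum>n\<in>{1..N}. gen_series s n * z_pow (- int n)) * half_vertex N s"
proof -
  have "(\<Sum>n\<in>{1..N}. fls_const (if n \<le> N then of_int s * gen s n else 0) * z_pow (- int n)) =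
      of_int s * (\<Sum>n\<in>{1..N}. gen_series s n * z_pow (- int n))"
    unfolding sum_distrib_left
    by (intro sum.cong) (auto simp: gen_series_def fls_of_int mult.assoc simp flip: fls_const_mult_const)
  then show ?thesis
    unfolding half_vertex_def
    using z_euler_hom_series[of N "\<lambda>k. if k \<le> N then of_int s * gen s k else 0"] by simp
qed

definition vertex_error :: "nat \<Rightarrow> int \<Rightarrow> zseries" where
  "vertex_error N s = (\<Sum>(i, j)\<in>index_rest N. gen_series s i * gen_series s j * z_pow (- int i - int j))"

lemma vanish_below_vertex_error: "vanish_below (vertex_error N s) (int N + 1)"
  unfolding vertex_error_def
proof (intro vanish_below_sum, clarify)
  fix i j assume "(i, j) \<in> index_rest N"
  then have "int N + 1 \<le> int i + int j"
    by (auto simp: index_rest_def index_pairs_def)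
  then show "vanish_below (gen_series s i * gen_series s j * z_pow (- int i - int j)) (int N + 1)"
    by (auto simp: vanish_below_def gen_series_def z_pow_nth)
qed

lemma cutjoin_half_vertex:
  assumes s: "s \<in> {1, -1}" and d: "d \<le> N" and f: "f \<in> weight_span d (shifted s) const_scalars"
  defines "X \<equiv> half_vertex N s * f"
  shows "cutjoin N (gen_series s) (zgen_deriv s) X +
      2 * (m + of_int s) * euler N (gen_series s) (zgen_deriv s) X =
    half_vertex N s * (cutjoin N (shifted s) (zgen_deriv s) f + 2 * m * euler N (shifted s) (zgen_deriv s) f) +
    of_int s * z_euler (z_euler X) - (2 * m + of_int s) * z_euler X - of_int s * vertex_error N s * X"
proof -
  have "cutjoin N (gen_series s) (zgen_deriv s) X +
      2 * (m + of_int s) * euler N (gen_series s) (zgen_deriv s) X -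
    half_vertex N s * (cutjoin N (shifted s) (zgen_deriv s) f + 2 * m * euler N (shifted s) (zgen_deriv s) f) =
    of_int s * z_euler (z_euler X) - (2 * m + of_int s) * z_euler X - of_int s * vertex_error N s * X"
    unfolding X_def vertex_error_def shifted_def
    by (rule cutjoin_vertex[where \<delta> = "zgen_deriv s" and Z = z_pow,
          OF derivation_zgen_deriv derivation_z_euler z_euler_zgen_deriv z_pow_0 z_pow_add
            zgen_deriv_z_pow z_euler_z_pow _ _ zgen_deriv_half_vertex[OF s] z_euler_half_vertex
            z_euler_weight_span[OF s d f]
            dual_derivation2_weight_span[OF dual_derivations_shifted[OF s] zgen_deriv_const_scalars d f]])
      (use s in \<open>auto simp: gen_series_def z_euler_const\<close>)
  then show ?thesis
    by (simp add: algebra_simps)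
qed

text \<open>The defect between both sides is \<open>z d/dz - (m + 1)\<close> applied to a bilinear expression, so
  the coefficient of \<open>z\<^sup>m\<^sup>+\<^sup>1\<close> does not see it.\<close>

lemma evolution_half_vertices:
  assumes d: "d1 \<le> N" "d2 \<le> N" "int (d1 + d2) - (m + 1) \<le> int N"
    and f1: "f1 \<in> weight_span d1 (shifted 1) const_scalars"
    and f2: "f2 \<in> weight_span d2 (shifted (-1)) const_scalars"
  shows "fls_nth (evolution N m gen_series zgen_deriv (half_vertex N 1 * half_vertex N (-1) * (f1 * f2))
      + of_int (m * (m + 1)) * (half_vertex N 1 * half_vertex N (-1) * (f1 * f2))) (- (m + 1)) =
    fls_nth (half_vertex N 1 * half_vertex N (-1) *
      ((cutjoin N (shifted 1) (zgen_deriv 1) f1 + 2 * of_int m * euler N (shifted 1) (zgen_deriv 1) f1) * f2 +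
       f1 * cutjoin N (shifted (-1)) (zgen_deriv (-1)) f2)) (- (m + 1))"
proof -
  define X where "X = half_vertex N 1 * f1"
  define Y where "Y = half_vertex N (-1) * f2"
  \<comment> \<open>Writing \<open>X'\<close> for \<open>z_euler X\<close>, the two factors leave
    \<open>X'' Y - X Y'' - (2 m + 1) X' Y + X Y'\<close>. This equals \<open>G' - (m + 1) G\<close>
    minus \<open>m (m + 1) X Y\<close>, whence the scalar term and the factor
    \<open>e^(m (m + 1) \<beta> / 2)\<close>.\<close>
  define G where "G = z_euler X * Y - X * z_euler Y - of_int m * (X * Y)"
  define err where "err = vertex_error N (-1) - vertex_error N 1"
  define H1 where "H1 = cutjoin N (shifted 1) (zgen_deriv 1) f1 + 2 * of_int m * euler N (shifted 1) (zgen_deriv 1) f1"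
  define H2 where "H2 = cutjoin N (shifted (-1)) (zgen_deriv (-1)) f2"
  have XY: "half_vertex N 1 * half_vertex N (-1) * (f1 * f2) = X * Y"
    by (simp add: X_def Y_def mult_ac)
  have "zgen_deriv (-1) n f1 = 0" "zgen_deriv 1 n f2 = 0" for n
    by (rule derivation_weight_span_0[OF derivation_zgen_deriv zgen_deriv_const_scalars _ f1]
        derivation_weight_span_0[OF derivation_zgen_deriv zgen_deriv_const_scalars _ f2];
      simp add: zgen_deriv_shifted)+
  then have kill: "zgen_deriv (-1) n X = 0" "zgen_deriv 1 n Y = 0" for n
    by (simp_all add: X_def Y_def derivation_mult[OF derivation_zgen_deriv] zgen_deriv_half_vertex_other)
  have "evolution N m gen_series zgen_deriv (X * Y) =
    (half_vertex N 1 * H1 + z_euler (z_euler X) - (2 * of_int m + 1) * z_euler X - vertex_error N 1 * X) * Y +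
    X * (half_vertex N (-1) * H2 - z_euler (z_euler Y) + z_euler Y + vertex_error N (-1) * Y)"
    using cutjoin_half_vertex[OF _ d(1) f1, of "of_int m"] cutjoin_half_vertex[OF _ d(2) f2, of 0]
    unfolding evolution_mult[where \<delta> = zgen_deriv, OF derivation_zgen_deriv kill]
    by (simp add: X_def Y_def H1_def H2_def)
  then have "evolution N m gen_series zgen_deriv (X * Y) + of_int (m * (m + 1)) * (X * Y) =
    half_vertex N 1 * half_vertex N (-1) * (H1 * f2 + f1 * H2) +
    (z_euler G - of_int (m + 1) * G) + err * (X * Y)"
    by (simp add: G_def derivation_simps[OF derivation_z_euler] err_def algebra_simps)
      (simp add: X_def Y_def algebra_simps)
  moreover have "fls_nth (z_euler G - of_int (m + 1) * G) (- (m + 1)) = 0"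
    by (simp only: fls_minus_nth fls_mult_of_int_nth z_euler_nth of_int_minus minus_minus diff_self)
  \<comment> \<open>The error has powers at most \<open>z^(-N-1)\<close>, and \<open>X * Y\<close>
    at most \<open>z^(d1+d2)\<close>; by the third assumption on \<open>N\<close> the product stays
    below \<open>z^(m+1)\<close>.\<close>
  moreover have "fls_nth (err * (X * Y)) (- (m + 1)) = 0"
  proof -
    have "vanish_below err (int N + 1)"
      using vanish_below_vertex_error[of N 1] vanish_below_vertex_error[of N "-1"]
      by (simp add: err_def vanish_below_def)
    moreover have "vanish_below X (- int d1)" "vanish_below Y (- int d2)"
      using vanish_below_mult[OF vanish_below_hom_series vanish_below_weight_span]  f1 f2
      by (fastforce simp: X_def Y_def half_vertex_def)+
    ultimately have "vanish_below (err * (X * Y)) (int N + 1 + (- int d1 + - int d2))"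
      by (intro vanish_below_mult)
    then show ?thesis
      using d(3) by (simp add: vanish_below_def)
  qed
  ultimately show ?thesis
    unfolding XY H1_def[symmetric] H2_def[symmetric] by simp
qed

section \<open>The two sides of the equation as solutions of one recursion in beta\<close>

definition gen' :: "int \<Rightarrow> nat \<Rightarrow> coeff_ring" where
  "gen' s n = Var (VP' n) + of_int s * Var (VS' n)"

lemma gen_deriv_gen': "gen_deriv s n (gen' s' k) = 0"
  by (simp add: gen'_def derivation_simps[OF derivation_gen_deriv] gen_deriv_Var')

lemma fls_const_gen'_in_const_scalars: "fls_const (gen' s n) \<in> const_scalars"
  by (auto simp: const_scalars_def gen_deriv_gen')

lemma shifted_gen'_in_z_scalars: "fls_const (gen' s n) + of_int s' * z_pow k \<in> z_scalars"
  using zgen_deriv_const_scalars[OF fls_const_gen'_in_const_scalars]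
  by (simp add: z_scalars_def derivation_simps[OF derivation_zgen_deriv] zgen_deriv_z_pow)

lemma fps_mult_deriv_nth:
  "fps_nth (fps_deriv (U * W)) b = (\<Sum>j\<in>{0..b}. fps_nth (fps_deriv U) j * fps_nth W (b - j) +
     fps_nth U j * fps_nth (fps_deriv W) (b - j))"
  by (simp only: fps_deriv_mult fps_add_nth fps_mult_nth sum.distrib add.commute)

lemma z_coeff_nth:
  "fps_nth (fps_nth (z_coeff k (fps_const (fps_const V) * F * G)) d) b =
     (\<Sum>i\<in>{0..d}. fls_nth (V * fps_nth (fps_nth F i * fps_nth G (d - i)) b) (- k))"
proof -
  have "fps_nth (fps_nth (fps_const (fps_const V) * F * G) d) b =
      (\<Sum>i\<in>{0..d}. V * fps_nth (fps_nth F i * fps_nth G (d - i)) b)"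
    by (simp add: mult.assoc fps_mult_nth[of F G] fps_sum_nth sum_distrib_left)
  then show ?thesis
    by (simp add: z_coeff_def fls_nth_sum)
qed

definition evolves :: "nat \<Rightarrow> int \<Rightarrow> coeff_ring fps \<Rightarrow> bool" where
  "evolves N m F \<longleftrightarrow> (\<forall>b. 2 * fps_nth (fps_deriv F) b =
     evolution N m gen gen_deriv (fps_nth F b) + of_int (m * (m + 1)) * fps_nth F b)"

lemma evolves_0: "evolves N m 0"
  by (simp add: evolves_def evolution_0[where \<delta> = gen_deriv, OF derivation_gen_deriv])

text \<open>The coefficient of index \<open>b\<close> determines the one of index
  \<open>b + 1\<close> after division by \<open>2 (b + 1)\<close>.\<close>

lemma evolves_unique:
  assumes "evolves N m F" "evolves N m G" "fps_nth F 0 = fps_nth G 0"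
  shows "F = G"
proof (rule fps_ext)
  fix b
  show "fps_nth F b = fps_nth G b"
  proof (induction b)
    case (Suc b)
    have "of_nat (2 * Suc b) * fps_nth F (Suc b) = 2 * fps_nth (fps_deriv F) b"
      "of_nat (2 * Suc b) * fps_nth G (Suc b) = 2 * fps_nth (fps_deriv G) b"
      by (simp_all add: algebra_simps)
    then have "of_nat (2 * Suc b) * fps_nth F (Suc b) = of_nat (2 * Suc b) * fps_nth G (Suc b)"
      using assms(1,2) Suc by (simp only: evolves_def)
    then show ?case
      by (rule C.of_nat_mult_cancel[rotated]) simp
  qed (rule assms(3))
qed

definition lhs_A :: "int \<Rightarrow> zseries fps fps" where
  "lhs_A m = tau_at (gen_series 1) (\<lambda>n. fls_const (gen' 1 n) + of_int 1 * z_pow (int n)) (m + 1)"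

definition lhs_B :: "zseries fps fps" where
  "lhs_B = tau_at (gen_series (-1)) (\<lambda>n. fls_const (gen' (-1) n) + of_int (-1) * z_pow (int n)) (-1)"

definition rhs_C :: "int \<Rightarrow> zseries fps fps" where
  "rhs_C m = tau_at (shifted 1) (\<lambda>n. fls_const (gen' 1 n)) m"

definition rhs_D :: "zseries fps fps" where
  "rhs_D = tau_at (shifted (-1)) (\<lambda>n. fls_const (gen' (-1) n)) 0"

lemma vertex_exp_VS'_in_z_scalars: "vertex_exp c VS' \<in> z_scalars"
proof -
  have "gen_deriv s n (hom_sym Const (\<lambda>n. Const c * Var (VS' n)) k) = 0" for s n k
  proof (induction k rule: less_induct)
    case (less k)
    show ?case
      by (subst hom_sym.simps)
        (auto simp: derivation_simps[OF derivation_gen_deriv] gen_deriv_Const gen_deriv_Var' less)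
  qed
  then show ?thesis
    unfolding vertex_exp_eq z_scalars_def mem_Collect_eq
    by (intro allI fls_eqI) (simp add: zgen_deriv_nth hom_series_nth derivation_0[OF derivation_gen_deriv])
qed

text \<open>All z-dependence sits in primed variables and in \<open>V\<close>, which are constants
  for the operator; hence the equation holds at every power of z.\<close>

lemma lhs_evolution:
  fixes d N :: nat and k m :: int
  assumes N: "d \<le> N" and V: "V \<in> z_scalars"
  defines "F \<equiv> fps_nth (z_coeff k (fps_const (fps_const V) * lhs_A m * lhs_B)) d"
  shows "2 * fps_nth (fps_deriv F) b = evolution N m gen gen_deriv (fps_nth F b)"
proof -
  define U where "U i = fps_nth (lhs_A m) i" for i
  define W where "W i = fps_nth lhs_B i" for i
  have F: "fps_nth F b = (\<Sum>i\<in>{0..d}. fls_nth (V * fps_nth (U i * W (d - i)) b) (- k))" for b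
    by (simp add: F_def z_coeff_nth U_def W_def)
  have U_span: "fps_nth (U i) j \<in> weight_span i (gen_series 1) z_scalars" for i j
    unfolding U_def lhs_A_def
    by (rule tau_at_nth_in_weight_span[OF scalars_z_scalars shifted_gen'_in_z_scalars])
  have W_span: "fps_nth (W i) j \<in> weight_span i (gen_series (-1)) z_scalars" for i j
    unfolding W_def lhs_B_def
    by (rule tau_at_nth_in_weight_span[OF scalars_z_scalars shifted_gen'_in_z_scalars])
  have kill: "zgen_deriv (-1) n (fps_nth (U i) j) = 0" "zgen_deriv 1 n (fps_nth (W i) j) = 0" for n i j
    by (rule derivation_weight_span_0[OF derivation_zgen_deriv zgen_deriv_z_scalars _ U_span]
        derivation_weight_span_0[OF derivation_zgen_deriv zgen_deriv_z_scalars _ W_span];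
      simp add: zgen_deriv_gen_series)+
  have step: "2 * fps_nth (fps_deriv (U i * W (d - i))) b =
      evolution N m gen_series zgen_deriv (fps_nth (U i * W (d - i)) b)" if i: "i \<le> d" for i b
  proof -
    have dU: "2 * fps_nth (fps_deriv (U i)) j =
        cutjoin N (gen_series 1) (zgen_deriv 1) (fps_nth (U i) j) +
        2 * of_int (m + 1) * euler N (gen_series 1) (zgen_deriv 1) (fps_nth (U i) j)" for j
      unfolding U_def lhs_A_def
      by (rule tau_at_evolution[OF dual_derivations_gen_series scalars_z_scalars zgen_deriv_z_scalars
            shifted_gen'_in_z_scalars]) (use N i in auto)
    have dW: "2 * fps_nth (fps_deriv (W (d - i))) j =
        cutjoin N (gen_series (-1)) (zgen_deriv (-1)) (fps_nth (W (d - i)) j) -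
        2 * euler N (gen_series (-1)) (zgen_deriv (-1)) (fps_nth (W (d - i)) j)" for j
      unfolding W_def lhs_B_def
      by (subst tau_at_evolution[OF dual_derivations_gen_series scalars_z_scalars zgen_deriv_z_scalars
            shifted_gen'_in_z_scalars]) (use N in auto)
    have "2 * fps_nth (fps_deriv (U i * W (d - i))) b =
      (\<Sum>j\<in>{0..b}. (2 * fps_nth (fps_deriv (U i)) j) * fps_nth (W (d - i)) (b - j) +
        fps_nth (U i) j * (2 * fps_nth (fps_deriv (W (d - i))) (b - j)))"
      unfolding fps_mult_deriv_nth sum_distrib_left by (intro sum.cong refl) (simp add: algebra_simps)
    also have "\<dots> = (\<Sum>j\<in>{0..b}. evolution N m gen_series zgen_deriv (fps_nth (U i) j * fps_nth (W (d - i)) (b - j)))"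
      unfolding dU dW evolution_mult[where \<delta> = zgen_deriv, OF derivation_zgen_deriv kill] ..
    also have "\<dots> = evolution N m gen_series zgen_deriv (fps_nth (U i * W (d - i)) b)"
      by (simp only: fps_mult_nth evolution_sum[where \<delta> = zgen_deriv, OF derivation_zgen_deriv])
    finally show ?thesis .
  qed
  have "2 * fps_nth (fps_deriv F) b =
      (\<Sum>i\<in>{0..d}. fls_nth (V * (2 * fps_nth (fps_deriv (U i * W (d - i))) b)) (- k))"
  proof -
    have two: "fls_nth (V * (2 * (of_nat n * G))) j = 2 * (of_nat n * fls_nth (V * G) j)" for n G j
    proof -
      have "V * (2 * (of_nat n * G)) = of_nat (2 * n) * (V * G)"
        by (simp add: mult_ac)
      then show ?thesis
        by (simp only: fls_mult_of_nat_nth) (simp add: mult.assoc)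
    qed
    show ?thesis
      by (simp only: fps_deriv_nth F sum_distrib_left two)
  qed
  also have "\<dots> = (\<Sum>i\<in>{0..d}. fls_nth (evolution N m gen_series zgen_deriv (V * fps_nth (U i * W (d - i)) b)) (- k))"
  proof (intro sum.cong refl)
    fix i assume "i \<in> {0..d}"
    then have "i \<le> d"
      by simp
    then show "fls_nth (V * (2 * fps_nth (fps_deriv (U i * W (d - i))) b)) (- k) =
        fls_nth (evolution N m gen_series zgen_deriv (V * fps_nth (U i * W (d - i)) b)) (- k)"
      by (simp only: step evolution_scale[where \<delta> = zgen_deriv, OF derivation_zgen_deriv zgen_deriv_z_scalars[OF V]])
  qed
  also have "\<dots> = evolution N m gen gen_deriv (fps_nth F b)"
    by (simp only: evolution_nth F evolution_sum[where \<delta> = gen_deriv, OF derivation_gen_deriv])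
  finally show ?thesis .
qed

lemma lhs_evolves:
  assumes N: "d \<le> N"
  shows "evolves N m (exp_series Const (of_int (m * (m + 1)) / 2) *
     fps_nth (z_coeff k (fps_const (fps_const (vertex_exp c VS')) * lhs_A m * lhs_B)) d)"
proof -
  define E where "E = exp_series Const (of_int (m * (m + 1)) / 2)"
  define F where "F = fps_nth (z_coeff k (fps_const (fps_const (vertex_exp c VS')) * lhs_A m * lhs_B)) d"
  have F: "2 * fps_nth (fps_deriv F) b = evolution N m gen gen_deriv (fps_nth F b)" for b
    unfolding F_def by (rule lhs_evolution[OF N vertex_exp_VS'_in_z_scalars])
  have "2 * Const (of_int (m * (m + 1)) / 2) = of_int (m * (m + 1))"
    unfolding C.emb_of_int[symmetric] using C.emb_mult[of 2 "of_int (m * (m + 1)) / 2"] C.emb_of_nat[of 2]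
    by simp
  then have two: "2 * (Const (of_int (m * (m + 1)) / 2) * x) = of_int (m * (m + 1)) * x" for x
    by (simp only: mult.assoc[symmetric])
  have "fps_deriv (E * F) = fps_const (Const (of_int (m * (m + 1)) / 2)) * (E * F) + E * fps_deriv F"
    by (simp add: E_def C.fps_deriv_exp_series algebra_simps)
  then have "fps_nth (fps_deriv (E * F)) b =
      Const (of_int (m * (m + 1)) / 2) * fps_nth (E * F) b + fps_nth (E * fps_deriv F) b" for b
    by (simp only: fps_add_nth fps_mult_left_const_nth)
  then have "2 * fps_nth (fps_deriv (E * F)) b =
      of_int (m * (m + 1)) * fps_nth (E * F) b + 2 * fps_nth (E * fps_deriv F) b" for b
    by (simp only: distrib_left[of 2] two)
  moreover have "2 * fps_nth (E * fps_deriv F) b = evolution N m gen gen_deriv (fps_nth (E * F) b)" for b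
  proof -
    have E: "gen_deriv s n (fps_nth E i) = 0" for s n i
      by (simp add: E_def exp_series_def gen_deriv_Const)
    have "2 * fps_nth (E * fps_deriv F) b = (\<Sum>i\<in>{0..b}. fps_nth E i * (2 * fps_nth (fps_deriv F) (b - i)))"
      by (simp only: fps_mult_nth sum_distrib_left mult.left_commute)
    then show ?thesis
      by (simp only: F fps_mult_nth evolution_sum[where \<delta> = gen_deriv, OF derivation_gen_deriv]
          evolution_scale[where \<delta> = gen_deriv, OF derivation_gen_deriv E])
  qed
  ultimately show ?thesis
    by (simp add: evolves_def E_def F_def)
qed

text \<open>\<open>gen 1 n - gen (-1) n\<close> is twice the variable s_n, and a coefficient of
  index up to \<open>N\<close> does not see the variables beyond \<open>N\<close>.\<close>

lemma vertex_exp_VS_nth: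
  assumes "k \<le> int N"
  shows "fls_nth (vertex_exp 2 VS) k = fls_nth (half_vertex N 1 * half_vertex N (-1)) k"
proof -
  have "Const 2 = 2"
    using C.emb_of_nat[of 2] by simp
  moreover have "half_vertex N 1 * half_vertex N (-1) = hom_series (\<lambda>k. (if k \<le> N then of_int 1 * gen 1 k else 0) +
      (if k \<le> N then of_int (-1) * gen (-1) k else 0))"
    by (simp only: half_vertex_def hom_series_add)
  ultimately show ?thesis
    using assms unfolding vertex_exp_eq
    by (auto simp: hom_series_nth gen_def intro!: C.hom_sym_cong)
qed

lemma fls_nth_mult_cong:
  fixes F F' G :: zseries
  assumes "\<And>j. j \<le> M \<Longrightarrow> fls_nth F j = fls_nth F' j" and "vanish_below G B" and "k - B \<le> M"
  shows "fls_nth (F * G) k = fls_nth (F' * G) k"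
proof -
  have "vanish_below (F - F') (M + 1)"
    using assms(1) by (simp add: vanish_below_def)
  then have "vanish_below ((F - F') * G) (M + 1 + B)"
    using assms(2) by (rule vanish_below_mult)
  then show ?thesis
    using assms(3) by (simp add: vanish_below_def left_diff_distrib)
qed

lemma rhs_evolves:
  assumes N: "d \<le> N" "int d - (m + 1) \<le> int N"
  shows "evolves N m (fps_nth (z_coeff (m + 1) (fps_const (fps_const (vertex_exp 2 VS)) * rhs_C m * rhs_D)) d)"
proof -
  define F where "F = fps_nth (z_coeff (m + 1) (fps_const (fps_const (vertex_exp 2 VS)) * rhs_C m * rhs_D)) d"
  define V where "V = half_vertex N 1 * half_vertex N (-1)"
  define U where "U i = fps_nth (rhs_C m) i" for i
  define W where "W i = fps_nth rhs_D i" for i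
  have U_span: "fps_nth (U i) j \<in> weight_span i (shifted 1) const_scalars" for i j
    unfolding U_def rhs_C_def
    by (rule tau_at_nth_in_weight_span[OF scalars_const_scalars fls_const_gen'_in_const_scalars])
  have W_span: "fps_nth (W i) j \<in> weight_span i (shifted (-1)) const_scalars" for i j
    unfolding W_def rhs_D_def
    by (rule tau_at_nth_in_weight_span[OF scalars_const_scalars fls_const_gen'_in_const_scalars])
  have "vanish_below (fps_nth (U i * W (d - i)) b) (- int d)" if "i \<le> d" for i b
    unfolding fps_mult_nth
  proof (rule vanish_below_sum)
    fix j
    have "vanish_below (fps_nth (U i) j * fps_nth (W (d - i)) (b - j)) (- int i + - int (d - i))"
      by (rule vanish_below_mult; rule vanish_below_weight_span, rule U_span W_span)
    then show "vanish_below (fps_nth (U i) j * fps_nth (W (d - i)) (b - j)) (- int d)"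
      using that by (simp add: of_nat_diff)
  qed
  \<comment> \<open>The tau factors contain powers up to \<open>z^d\<close> only, so just the
    coefficients of the exponential of index at most \<open>d - (m + 1)\<close>, hence at most
    \<open>N\<close>, are involved.\<close>
  then have "fls_nth (vertex_exp 2 VS * fps_nth (U i * W (d - i)) b) (- (m + 1)) =
      fls_nth (V * fps_nth (U i * W (d - i)) b) (- (m + 1))" if "i \<le> d" for i b
    using that N(2) unfolding V_def
    by (intro fls_nth_mult_cong[of "int N" _ _ _ "- int d"] vertex_exp_VS_nth) auto
  then have F: "fps_nth F b = (\<Sum>i\<in>{0..d}. fls_nth (V * fps_nth (U i * W (d - i)) b) (- (m + 1)))" for b
    unfolding F_def z_coeff_nth U_def[symmetric] W_def[symmetric] by (intro sum.cong) auto
  have step: "fls_nth (V * (2 * fps_nth (fps_deriv (U i * W (d - i))) b)) (- (m + 1)) =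
      evolution N m gen gen_deriv (fls_nth (V * fps_nth (U i * W (d - i)) b) (- (m + 1))) +
      of_int (m * (m + 1)) * fls_nth (V * fps_nth (U i * W (d - i)) b) (- (m + 1))"
    if i: "i \<le> d" for i b
  proof -
    have dU: "2 * fps_nth (fps_deriv (U i)) j =
        cutjoin N (shifted 1) (zgen_deriv 1) (fps_nth (U i) j) +
        2 * of_int m * euler N (shifted 1) (zgen_deriv 1) (fps_nth (U i) j)" for j
      unfolding U_def rhs_C_def
      by (rule tau_at_evolution[OF dual_derivations_shifted scalars_const_scalars zgen_deriv_const_scalars
            fls_const_gen'_in_const_scalars]) (use N i in auto)
    have dW: "2 * fps_nth (fps_deriv (W (d - i))) j =
        cutjoin N (shifted (-1)) (zgen_deriv (-1)) (fps_nth (W (d - i)) j)" for j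
      unfolding W_def rhs_D_def
      by (subst tau_at_evolution[OF dual_derivations_shifted scalars_const_scalars zgen_deriv_const_scalars
            fls_const_gen'_in_const_scalars]) (use N in auto)
    have "2 * fps_nth (fps_deriv (U i * W (d - i))) b =
      (\<Sum>j\<in>{0..b}. (2 * fps_nth (fps_deriv (U i)) j) * fps_nth (W (d - i)) (b - j) +
        fps_nth (U i) j * (2 * fps_nth (fps_deriv (W (d - i))) (b - j)))"
      unfolding fps_mult_deriv_nth sum_distrib_left by (intro sum.cong refl) (simp add: algebra_simps)
    then have "fls_nth (V * (2 * fps_nth (fps_deriv (U i * W (d - i))) b)) (- (m + 1)) =
      (\<Sum>j\<in>{0..b}. fls_nth (V * ((2 * fps_nth (fps_deriv (U i)) j) * fps_nth (W (d - i)) (b - j) +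
        fps_nth (U i) j * (2 * fps_nth (fps_deriv (W (d - i))) (b - j)))) (- (m + 1)))"
      by (simp only: sum_distrib_left[of V] fls_nth_sum)
    also have "\<dots> = (\<Sum>j\<in>{0..b}. fls_nth (evolution N m gen_series zgen_deriv
        (V * (fps_nth (U i) j * fps_nth (W (d - i)) (b - j))) +
        of_int (m * (m + 1)) * (V * (fps_nth (U i) j * fps_nth (W (d - i)) (b - j)))) (- (m + 1)))"
      unfolding dU dW V_def
      by (intro sum.cong refl evolution_half_vertices[OF _ _ _ U_span W_span, symmetric])
        (use N i in auto)
    also have "\<dots> = fls_nth (evolution N m gen_series zgen_deriv (V * fps_nth (U i * W (d - i)) b) +
        of_int (m * (m + 1)) * (V * fps_nth (U i * W (d - i)) b)) (- (m + 1))"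
      by (simp only: fps_mult_nth sum_distrib_left evolution_sum[where \<delta> = zgen_deriv, OF derivation_zgen_deriv]
          sum.distrib[symmetric] fls_nth_sum)
    finally show ?thesis
      by (simp only: fls_plus_nth evolution_nth fls_mult_of_int_nth)
  qed
  have "2 * fps_nth (fps_deriv F) b =
      (\<Sum>i\<in>{0..d}. fls_nth (V * (2 * fps_nth (fps_deriv (U i * W (d - i))) b)) (- (m + 1)))" for b
  proof -
    have two: "fls_nth (V * (2 * (of_nat n * G))) j = 2 * (of_nat n * fls_nth (V * G) j)" for n G j
    proof -
      have "V * (2 * (of_nat n * G)) = of_nat (2 * n) * (V * G)"
        by (simp add: mult_ac)
      then show ?thesis
        by (simp only: fls_mult_of_nat_nth) (simp add: mult.assoc)
    qed
    show ?thesis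
      by (simp only: fps_deriv_nth F sum_distrib_left two)
  qed
  also have "(\<Sum>i\<in>{0..d}. fls_nth (V * (2 * fps_nth (fps_deriv (U i * W (d - i))) b)) (- (m + 1))) =
      evolution N m gen gen_deriv (fps_nth F b) + of_int (m * (m + 1)) * fps_nth F b" for b
  proof -
    have "(\<Sum>i\<in>{0..d}. fls_nth (V * (2 * fps_nth (fps_deriv (U i * W (d - i))) b)) (- (m + 1))) =
      (\<Sum>i\<in>{0..d}. evolution N m gen gen_deriv (fls_nth (V * fps_nth (U i * W (d - i)) b) (- (m + 1))) +
        of_int (m * (m + 1)) * fls_nth (V * fps_nth (U i * W (d - i)) b) (- (m + 1)))"
      by (intro sum.cong refl step) simp
    then show ?thesis
      by (simp only: F evolution_sum[where \<delta> = gen_deriv, OF derivation_gen_deriv] sum.distrib sum_distrib_left)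
  qed
  finally show ?thesis
    by (simp add: evolves_def F_def)
qed

section \<open>The initial values\<close>

lemma hom_sym_fls_const: "hom_sym zConst (\<lambda>k. fls_const (u k)) n = fls_const (hom_sym Const u n)"
proof (rule sym, rule Z.hom_sym_unique)
  fix n :: nat
  have "of_nat n * fls_const (hom_sym Const u n) = fls_const (of_nat n * hom_sym Const u n)"
    by (simp add: fls_of_nat)
  also have "\<dots> = (\<Sum>k\<in>{1..n}. fls_const (u k) * fls_const (hom_sym Const u (n - k)))"
    unfolding C.hom_sym_newton by (rule fls_eqI) (simp add: fls_nth_sum)
  finally show "of_nat n * fls_const (hom_sym Const u n) =
    (\<Sum>k\<in>{1..n}. fls_const (u k) * fls_const (hom_sym Const u (n - k)))" .
qed simp

lemma z_pow_int: "z_pow (int n) = z_pow 1 ^ n"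
  by (induction n) (simp_all add: z_pow_0 z_pow_add)

text \<open>At beta = 0 the two exponents add up. The part with \<open>z^n\<close> ties the power of
  z to the degree, so taking a coefficient of z selects a single vertex coefficient for each
  \<open>i\<close>.\<close>

lemma initial_value:
  assumes "\<And>n. P n * P' n + Q n * Q' n = fls_const (u n) + z_pow (int n) * fls_const (w n)"
  shows "fps_nth (fps_nth (z_coeff k (fps_const (fps_const (hom_series v)) * tau_at P P' i * tau_at Q Q' j)) d) 0 =
    (\<Sum>i\<in>{0..d}. hom_sym Const u i * hom_sym Const w (d - i) * fls_nth (hom_series v) (int (d - i) - k))"
proof -
  have "(\<Sum>i\<in>{0..d}. hom_sym zConst (\<lambda>n. P n * P' n) i * hom_sym zConst (\<lambda>n. Q n * Q' n) (d - i)) =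
      hom_sym zConst (\<lambda>n. fls_const (u n) + z_pow 1 ^ n * fls_const (w n)) d"
    unfolding Z.hom_sym_add[symmetric] assms z_pow_int ..
  also have "\<dots> = (\<Sum>i\<in>{0..d}. fls_const (hom_sym Const u i) *
      (z_pow (int (d - i)) * fls_const (hom_sym Const w (d - i))))"
    unfolding Z.hom_sym_add Z.hom_sym_scale hom_sym_fls_const z_pow_int ..
  finally have "fps_nth (fps_nth (z_coeff k (fps_const (fps_const (hom_series v)) * tau_at P P' i * tau_at Q Q' j)) d) 0 =
    fls_nth (hom_series v * (\<Sum>i\<in>{0..d}. fls_const (hom_sym Const u i) *
      (z_pow (int (d - i)) * fls_const (hom_sym Const w (d - i))))) (- k)"
    by (simp only: z_coeff_nth fps_mult_nth_0 tau_at_nth_0 fls_nth_sum[symmetric] sum_distrib_left[symmetric])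
  also have "hom_series v * (\<Sum>i\<in>{0..d}. fls_const (hom_sym Const u i) *
      (z_pow (int (d - i)) * fls_const (hom_sym Const w (d - i)))) =
    (\<Sum>i\<in>{0..d}. fls_const (hom_sym Const u i * hom_sym Const w (d - i)) * (z_pow (int (d - i)) * hom_series v))"
    unfolding sum_distrib_left fls_const_mult_const[symmetric] by (intro sum.cong refl) (simp only: mult_ac)
  finally show ?thesis
    by (simp add: fls_nth_sum z_pow_mult_nth)
qed

text \<open>\<open>n\<close> is the exponent of q in the full equation. On the left the 2 s_n come
  from the shift by z and the -2 s'_n from the vertex factor; on the right the roles are exchanged.
  Coefficients of negative index are 0, so any bound \<open>M\<close> that is large enough gives the
  same sum.\<close>

definition common_value :: "nat \<Rightarrow> int \<Rightarrow> int \<Rightarrow> coeff_ring" where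
  "common_value M m n = (\<Sum>i\<in>{0..M}.
     hom_sym Const (\<lambda>k. gen 1 k * gen' 1 k + gen (-1) k * gen' (-1) k) i *
     fls_nth (vertex_exp (-2) VS') (n - int i) * fls_nth (vertex_exp 2 VS) (n - int i - (m + 1)))"

lemma Const_2: "Const 2 = 2" "Const (- 2) = - 2"
  using C.emb_of_int[of 2] C.emb_of_int[of "-2"] by simp_all

lemma rhs_initial_value:
  assumes "d \<le> M"
  shows "fps_nth (fps_nth (z_coeff (m + 1) (fps_const (fps_const (vertex_exp 2 VS)) * rhs_C m * rhs_D)) d) 0 =
    common_value M m (int d)"
proof -
  have "shifted 1 n * fls_const (gen' 1 n) + shifted (-1) n * fls_const (gen' (-1) n) =
    fls_const (gen 1 n * gen' 1 n + gen (-1) n * gen' (-1) n) + z_pow (int n) * fls_const (Const (-2) * Var (VS' n))" for n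
  proof -
    have "Const (-2) * Var (VS' n) = gen' (-1) n - gen' 1 n"
      by (simp add: gen'_def Const_2)
    show ?thesis
      unfolding \<open>Const (-2) * Var (VS' n) = gen' (-1) n - gen' 1 n\<close>
      by (simp add: shifted_def gen_series_def algebra_simps
          flip: fls_plus_const fls_minus_const fls_const_mult_const)
  qed
  from initial_value[of "shifted 1" "\<lambda>n. fls_const (gen' 1 n)" "shifted (-1)" "\<lambda>n. fls_const (gen' (-1) n)", OF this]
  have "fps_nth (fps_nth (z_coeff (m + 1) (fps_const (fps_const (vertex_exp 2 VS)) * rhs_C m * rhs_D)) d) 0 =
    (\<Sum>i\<in>{0..d}. hom_sym Const (\<lambda>k. gen 1 k * gen' 1 k + gen (-1) k * gen' (-1) k) i *
     hom_sym Const (\<lambda>k. Const (-2) * Var (VS' k)) (d - i) * fls_nth (vertex_exp 2 VS) (int (d - i) - (m + 1)))"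
    unfolding rhs_C_def rhs_D_def vertex_exp_eq .
  also have "\<dots> = common_value M m (int d)"
    unfolding common_value_def
    by (rule sum.mono_neutral_cong_left)
      (use assms in \<open>auto simp: vertex_exp_eq hom_series_nth nat_diff_distrib of_nat_diff\<close>)
  finally show ?thesis .
qed

lemma lhs_initial_value:
  assumes "d \<le> M"
  shows "fps_nth (fps_nth (z_coeff (- 1 - m) (fps_const (fps_const (vertex_exp (-2) VS')) * lhs_A m * lhs_B)) d) 0 =
    common_value M m (int d + m + 1)"
proof -
  have "gen_series 1 n * (fls_const (gen' 1 n) + of_int 1 * z_pow (int n)) +
      gen_series (-1) n * (fls_const (gen' (-1) n) + of_int (-1) * z_pow (int n)) =
    fls_const (gen 1 n * gen' 1 n + gen (-1) n * gen' (-1) n) + z_pow (int n) * fls_const (Const 2 * Var (VS n))" for n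
  proof -
    have "Const 2 * Var (VS n) = gen 1 n - gen (-1) n"
      by (simp add: gen_def Const_2)
    show ?thesis
      unfolding \<open>Const 2 * Var (VS n) = gen 1 n - gen (-1) n\<close>
      by (simp add: gen_series_def algebra_simps
          flip: fls_plus_const fls_minus_const fls_const_mult_const)
  qed
  from initial_value[of "gen_series 1" "\<lambda>n. fls_const (gen' 1 n) + of_int 1 * z_pow (int n)"
      "gen_series (-1)" "\<lambda>n. fls_const (gen' (-1) n) + of_int (-1) * z_pow (int n)", OF this]
  have "fps_nth (fps_nth (z_coeff (- 1 - m) (fps_const (fps_const (vertex_exp (-2) VS')) * lhs_A m * lhs_B)) d) 0 =
    (\<Sum>i\<in>{0..d}. hom_sym Const (\<lambda>k. gen 1 k * gen' 1 k + gen (-1) k * gen' (-1) k) i *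
     hom_sym Const (\<lambda>k. Const 2 * Var (VS k)) (d - i) * fls_nth (vertex_exp (-2) VS') (int (d - i) - (- 1 - m)))"
    unfolding lhs_A_def lhs_B_def vertex_exp_eq .
  also have "\<dots> = common_value M m (int d + m + 1)"
    unfolding common_value_def
    by (rule sum.mono_neutral_cong_left)
      (use assms in \<open>auto simp: vertex_exp_eq hom_series_nth nat_diff_distrib of_nat_diff algebra_simps\<close>)
  finally show ?thesis .
qed

text \<open>For \<open>0 \<le> n < m + 1\<close> the left-hand side has no \<open>q^n\<close> at
  all, so the right-hand coefficient has to vanish; for \<open>m + 1 \<le> n < 0\<close> the roles
  are reversed.\<close>

lemma common_value_eq_0:
  assumes "n < 0 \<or> n < m + 1"
  shows "common_value M m n = 0"
  using assms unfolding common_value_def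
  by (intro sum.neutral) (auto simp: vertex_exp_eq hom_series_nth)

lemma bilinear_coefficient:
  fixes n m :: int
  shows "exp_series Const (of_int (m * (m + 1)) / 2) * (if n < m + 1 then 0 else
      fps_nth (z_coeff (- 1 - m) (fps_const (fps_const (vertex_exp (-2) VS')) * lhs_A m * lhs_B)) (nat (n - (m + 1)))) =
    (if n < 0 then 0 else
      fps_nth (z_coeff (m + 1) (fps_const (fps_const (vertex_exp 2 VS)) * rhs_C m * rhs_D)) (nat n))"
    (is "?L = ?R")
proof -
  \<comment> \<open>One bound for both sides: it dominates both degrees \<open>n\<close> and
    \<open>n - (m + 1)\<close>, the latter also being the bound needed for the truncation
    error.\<close>
  define N where "N = nat \<bar>n\<bar> + nat \<bar>m + 1\<bar>"
  have L: "evolves N m ?L"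
  proof (cases "n < m + 1")
    case False
    then have "nat (n - (m + 1)) \<le> N"
      by (auto simp: N_def)
    then show ?thesis
      using False lhs_evolves by auto
  qed (simp add: evolves_0)
  have R: "evolves N m ?R"
  proof (cases "n < 0")
    case False
    then have "nat n \<le> N" "int (nat n) - (m + 1) \<le> int N"
      by (auto simp: N_def)
    then show ?thesis
      using False rhs_evolves by auto
  qed (simp add: evolves_0)
  have L0: "fps_nth ?L 0 = common_value N m n"
  proof (cases "n < m + 1")
    case False
    then have "nat (n - (m + 1)) \<le> N" "int (nat (n - (m + 1))) + m + 1 = n"
      by (auto simp: N_def)
    then show ?thesis
      using False lhs_initial_value[of "nat (n - (m + 1))" N m] by (simp add: exp_series_def)
  qed (simp add: common_value_eq_0)
  have R0: "fps_nth ?R 0 = common_value N m n"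
  proof (cases "n < 0")
    case False
    then have "nat n \<le> N"
      by (auto simp: N_def)
    then show ?thesis
      using False rhs_initial_value[of "nat n" N m] by simp
  qed (simp add: common_value_eq_0)
  show ?thesis
    by (rule evolves_unique[OF L R]) (simp only: L0 R0)
qed

text \<open>The outer Laurent series is in q, so here \<open>fls_X_intpow\<close> is a power of q,
  possibly negative; inside \<open>zseries\<close> the same library variable stands for
  \<open>z^(-1)\<close>.\<close>

theorem mainTheorem1:
  fixes m :: int
  defines "A \<equiv> tau_at (\<lambda>n. p_seq n + s_seq n) (\<lambda>n. p'_seq n + s'_seq n + z_seq n) (m + 1)"
    and "B \<equiv> tau_at (\<lambda>n. p_seq n - s_seq n) (\<lambda>n. p'_seq n - s'_seq n - z_seq n) (- 1)"
    and "C \<equiv> tau_at (\<lambda>n. p_seq n + s_seq n - z_seq n) (\<lambda>n. p'_seq n + s'_seq n) m"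
    and "D \<equiv> tau (\<lambda>n. p_seq n - s_seq n + z_seq n) (\<lambda>n. p'_seq n - s'_seq n)"
  shows "fls_X_intpow (m + 1) * fls_const (exp_series Const (of_int (m * (m + 1)) / 2)) *
           fps_to_fls (z_coeff (- 1 - m) (fps_const (fps_const (vertex_exp (- 2) VS')) * A * B))
         = fps_to_fls (z_coeff (m + 1) (fps_const (fps_const (vertex_exp 2 VS)) * C * D))"
proof -
  have gens: "p_seq n + s_seq n = gen_series 1 n" "p_seq n - s_seq n = gen_series (-1) n"
    "p'_seq n + s'_seq n = fls_const (gen' 1 n)" "p'_seq n - s'_seq n = fls_const (gen' (-1) n)" for n
    by (simp_all add: p_seq_def s_seq_def p'_seq_def s'_seq_def gen_series_def gen_def gen'_def
        fls_plus_const fls_minus_const)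
  have "A = lhs_A m" "B = lhs_B" "C = rhs_C m" "D = rhs_D"
    unfolding A_def B_def C_def D_def lhs_A_def lhs_B_def rhs_C_def rhs_D_def tau_at_0 gens z_seq_eq
    by (simp_all add: shifted_def [abs_def])
  moreover have "fls_nth (fls_X_intpow (m + 1) * fls_const E * fps_to_fls F) n =
      E * (if n < m + 1 then 0 else fps_nth F (nat (n - (m + 1))))"
    for E :: "coeff_ring fps" and F and n
  proof -
    have shift: "fls_X_intpow (m + 1) * fls_const E * fps_to_fls F = fls_shift (- (m + 1)) (fls_const E * fps_to_fls F)"
      unfolding mult.assoc[of _ _ "fps_to_fls F"] by (rule fls_X_intpow_times_conv_shift(1))
    have index: "n + - (m + 1) = n - (m + 1)"
      by simp
    show ?thesis
      unfolding shift fls_shift_nth fls_mult_const_nth fps_to_fls_nth index by simp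
  qed
  ultimately show ?thesis
    by (intro fls_eqI) (simp only: bilinear_coefficient fps_to_fls_nth)
qed

end
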